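(* Let $\omega\subset\mathbb{R}^2$ be open and let $f:\omega\to\mathbb{R}$ be locally Lipschitz. If $f$ is stationary, then $\nabla^f f$ is locally Lipschitz on $\omega$ and $\nabla^f f$ is constant along the integral curves of the vector field $\nabla^f$. In particular, $f\in\mathscr{C}^1_{\mathbb{W}}(\omega)$.
   Context: Coordinates on $\mathbb{R}^2$ are $(y,t)$. For $f\in W^{1,1}_{loc}(\omega)$, $\nabla^f=\partial_y+f\,\partial_t$ is a vector field on $\omega$, and $\nabla^f f=\partial_y f+f\partial_t f$ (an a.e. defined function; statements about its regularity refer to a representative). Define $\mathscr{A}_f(E)=\int_E\sqrt{1+(\nabla^f f)^2}\,d\mathcal{L}^2$ for measurable $E\subset\omega$. $f$ is stationary if for all $\varphi\in C^\infty_c(\omega)$ $$I_f(\varphi):=\frac{d}{d\epsilon}\Big|_{\epsilon=0}\mathscr{A}_{f+\epsilon\varphi}(\mathrm{spt}(\varphi))=0 .$$ $f\in\mathscr{C}^1_{\mathbb{W}}(\omega)$ ($f$ is $C^1$-intrinsic) means that $f\in C^0(\omega)$ and $\nabla^f f\in C^0(\omega)$. *)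

theory Defs
  imports "HOL-Analysis.Analysis"
begin

definition locally_lipschitz_on :: "'a::metric_space set \<Rightarrow> ('a \<Rightarrow> 'b::metric_space) \<Rightarrow> bool"
  where "locally_lipschitz_on S f \<longleftrightarrow>
    (\<forall>x\<in>S. \<exists>r>0. \<exists>L. L-lipschitz_on (ball x r \<inter> S) f)"

definition dir_deriv :: "'a::euclidean_space \<Rightarrow> ('a \<Rightarrow> real) \<Rightarrow> 'a \<Rightarrow> real"
  where "dir_deriv v \<phi> x = frechet_derivative \<phi> (at x) v"

primrec iter_dir_deriv :: "'a::euclidean_space list \<Rightarrow> ('a \<Rightarrow> real) \<Rightarrow> 'a \<Rightarrow> real" where
  "iter_dir_deriv [] \<phi> = \<phi>"
| "iter_dir_deriv (v # vs) \<phi> = dir_deriv v (iter_dir_deriv vs \<phi>)"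

text \<open>Smoothness on the whole space: \<open>\<phi>\<close> and all its iterated directional derivatives
  are (Frechet) differentiable everywhere. The derivative of \<open>\<phi>\<close> is determined by the directional
  derivatives, so this says that \<open>\<phi>\<close> is differentiable to every order.\<close>

definition smooth :: "('a::euclidean_space \<Rightarrow> real) \<Rightarrow> bool"
  where "smooth \<phi> \<longleftrightarrow> (\<forall>vs x. iter_dir_deriv vs \<phi> differentiable (at x))"

definition spt :: "('a::euclidean_space \<Rightarrow> real) \<Rightarrow> 'a set"
  where "spt \<phi> = closure {x. \<phi> x \<noteq> 0}"

text \<open>Elements of \<open>C\<^sub>c\<^sup>\<infinity>(\<omega>)\<close> are represented by their extensions by zero.\<close>

definition test_functions :: "'a::euclidean_space set \<Rightarrow> ('a \<Rightarrow> real) set"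
  where "test_functions \<omega> = {\<phi>. smooth \<phi> \<and> compact (spt \<phi>) \<and> spt \<phi> \<subseteq> \<omega>}"

definition loc_integrable_on :: "('a::euclidean_space \<Rightarrow> real) \<Rightarrow> 'a set \<Rightarrow> bool"
  where "loc_integrable_on f \<omega> \<longleftrightarrow>
    (\<forall>K. compact K \<and> K \<subseteq> \<omega> \<longrightarrow> f absolutely_integrable_on K)"

definition weak_deriv ::
  "'a::euclidean_space set \<Rightarrow> 'a \<Rightarrow> ('a \<Rightarrow> real) \<Rightarrow> ('a \<Rightarrow> real) \<Rightarrow> bool"
  where "weak_deriv \<omega> v f g \<longleftrightarrow>
    loc_integrable_on f \<omega> \<and> loc_integrable_on g \<omega> \<and>
    (\<forall>\<phi>\<in>test_functions \<omega>.
      (LINT x:\<omega>|lebesgue. f x * dir_deriv v \<phi> x) = - (LINT x:\<omega>|lebesgue. g x * \<phi> x))"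

text \<open>Points of the plane are pairs \<open>(y, t)\<close>. The relation says that \<open>f\<close> is in \<open>W\<^sup>1\<^sup>,\<^sup>1\<close> locally on
  \<open>\<omega>\<close> and that \<open>g\<close> is a representative of the almost everywhere defined function
  \<open>\<partial>\<^sub>y f + f \<partial>\<^sub>t f\<close>; values outside \<open>\<omega>\<close> are irrelevant.\<close>

definition represents_intrinsic_grad ::
  "(real \<times> real) set \<Rightarrow> (real \<times> real \<Rightarrow> real) \<Rightarrow> (real \<times> real \<Rightarrow> real) \<Rightarrow> bool"
  where "represents_intrinsic_grad \<omega> f g \<longleftrightarrow>
    (\<exists>f\<^sub>y f\<^sub>t. weak_deriv \<omega> (1, 0) f f\<^sub>y \<and> weak_deriv \<omega> (0, 1) f f\<^sub>t \<and>
      (AE p in lebesgue. p \<in> \<omega> \<longrightarrow> g p = f\<^sub>y p + f p * f\<^sub>t p))"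

text \<open>An arbitrary representative; all of them agree almost everywhere on \<open>\<omega>\<close>, so
  the area below does not depend on the choice. Meaningful only when \<open>f\<close> is in \<open>W\<^sup>1\<^sup>,\<^sup>1\<close>
  locally on \<open>\<omega>\<close>.\<close>

definition intrinsic_grad ::
  "(real \<times> real) set \<Rightarrow> (real \<times> real \<Rightarrow> real) \<Rightarrow> real \<times> real \<Rightarrow> real"
  where "intrinsic_grad \<omega> f = (SOME g. represents_intrinsic_grad \<omega> f g)"

definition intrinsic_area ::
  "(real \<times> real) set \<Rightarrow> (real \<times> real \<Rightarrow> real) \<Rightarrow> (real \<times> real) set \<Rightarrow> ennreal"
  where "intrinsic_area \<omega> f E =
    (\<integral>\<^sup>+p\<in>E. ennreal (sqrt (1 + (intrinsic_grad \<omega> f p)\<^sup>2)) \<partial>lebesgue)"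

text \<open>If \<open>f\<close> is locally Lipschitz, all areas occurring here are finite, so that \<open>enn2real\<close> loses
  nothing.\<close>

definition stationary :: "(real \<times> real) set \<Rightarrow> (real \<times> real \<Rightarrow> real) \<Rightarrow> bool"
  where "stationary \<omega> f \<longleftrightarrow>
    (\<forall>\<phi>\<in>test_functions \<omega>.
      ((\<lambda>\<epsilon>. enn2real (intrinsic_area \<omega> (\<lambda>p. f p + \<epsilon> * \<phi> p) (spt \<phi>)))
        has_real_derivative 0) (at 0))"

definition C1_intrinsic :: "(real \<times> real) set \<Rightarrow> (real \<times> real \<Rightarrow> real) \<Rightarrow> bool"
  where "C1_intrinsic \<omega> f \<longleftrightarrow>
    continuous_on \<omega> f \<and> (\<exists>g. represents_intrinsic_grad \<omega> f g \<and> continuous_on \<omega> g)"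

definition integral_curve ::
  "'a::real_normed_vector set \<Rightarrow> ('a \<Rightarrow> 'a) \<Rightarrow> real set \<Rightarrow> (real \<Rightarrow> 'a) \<Rightarrow> bool"
  where "integral_curve \<omega> X I \<gamma> \<longleftrightarrow>
    is_interval I \<and>
    (\<forall>s\<in>I. \<gamma> s \<in> \<omega> \<and> (\<gamma> has_vector_derivative X (\<gamma> s)) (at s within I))"

text \<open>The vector field \<open>\<partial>\<^sub>y + f \<partial>\<^sub>t\<close>.\<close>

definition intrinsic_field :: "(real \<times> real \<Rightarrow> real) \<Rightarrow> real \<times> real \<Rightarrow> real \<times> real"
  where "intrinsic_field f p = (1, f p)"

end

theory Submission
  imports Defs
begin

text \<open>Write \<open>g = \<partial>\<^sub>y f + f \<partial>\<^sub>t f\<close> and \<open>h = g / sqrt (1 + g\<^sup>2)\<close>. The first variation of the area is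
  \<open>\<integral> h (\<partial>\<^sub>y \<phi> + f \<partial>\<^sub>t \<phi> + \<phi> \<partial>\<^sub>t f)\<close>, so stationarity is the weak form of the transport equation
  \<open>\<partial>\<^sub>y h + f \<partial>\<^sub>t h = 0\<close>. Mollify \<open>h\<close>: along a characteristic \<open>y \<mapsto> (y, \<xi> y)\<close>, \<open>\<xi>' = f\<close>, the
  derivative of the mollified function is a commutator that is bounded and tends to \<open>0\<close> at the
  Lebesgue points of \<open>h\<close>. Null sets stay null under the bi-Lipschitz straightening of the
  characteristics, so \<open>h\<close>, and with it \<open>g\<close>, is constant along almost every characteristic. There \<open>f\<close>
  is affine in \<open>y\<close> with slope \<open>g\<close>; by continuity \<open>f\<close> is affine along every characteristic, and the
  slope is a difference quotient of \<open>f\<close> between two points of the characteristic, hence a locally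
  Lipschitz function of the characteristic. It is the required representative of \<open>g\<close>.\<close>

section \<open>Smooth functions\<close>

text \<open>The obstacle is that \<open>h\<close> is only bounded and measurable while a
  characteristic is a null set, so the transport equation cannot simply be restricted to one curve.
  Two facts tame the commutator. Differentiating a mollifier at scale 1/(n+1) costs a factor n+1,
  but on its support f deviates from its value at the base point by O(1/(n+1)), so the kernel is no
  larger than a mollifier. And the kernel has integral 0, so \<open>h\<close> may be replaced by its
  deviation from the value at the base point, whose average vanishes in the limit at a Lebesgue
  point. The same computation for f has the limit \<open>g\<close> instead of 0; this is why f
  becomes affine. The passage from \<open>h\<close> to \<open>g\<close> is harmless because z / sqrt
  (1 + z^2) is injective. Derivatives of f are limits along the fixed steps 1/(n+1), so they are
  Borel functions defined everywhere. An arbitrary integral curve is compared with the flow only to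
  first order: it is tangent to a characteristic at each of its points, and a Lipschitz function has
  the same derivative along tangent curves.\<close>

definition flat_exp :: "real poly \<Rightarrow> real \<Rightarrow> real"
  where "flat_exp p x = (if x > 0 then poly p (1 / x) * exp (- 1 / x) else 0)"

lemma flat_exp_tendsto_0: "(flat_exp p \<longlongrightarrow> 0) (at 0)"
proof -
  have *: "((\<lambda>z. poly p z / exp z) \<longlongrightarrow> 0) at_top"
  proof -
    have "((\<lambda>z. \<Sum>i\<le>degree p. coeff p i * (z ^ i / exp z)) \<longlongrightarrow> (\<Sum>i\<le>degree p. coeff p i * 0)) at_top"
      by (intro tendsto_sum tendsto_mult tendsto_const tendsto_power_div_exp_0)
    then show ?thesis
      by (simp add: poly_altdef sum_divide_distrib)
  qed
  have "((\<lambda>x. poly p (inverse x) / exp (inverse x)) \<longlongrightarrow> 0) (at_right 0)"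
    by (rule filterlim_compose[OF * filterlim_inverse_at_top_right])
  moreover have "eventually (\<lambda>x. poly p (inverse x) / exp (inverse x) = flat_exp p x) (at_right (0::real))"
    by (auto simp: flat_exp_def eventually_at_filter exp_minus field_simps)
  ultimately have r: "(flat_exp p \<longlongrightarrow> 0) (at_right 0)"
    by (rule Lim_transform_eventually)
  have "eventually (\<lambda>x. 0 = flat_exp p x) (at_left (0::real))"
    by (auto simp: flat_exp_def eventually_at_filter)
  then have "(flat_exp p \<longlongrightarrow> 0) (at_left 0)"
    by (rule Lim_transform_eventually[OF tendsto_const])
  with r show ?thesis
    by (simp add: filterlim_split_at)
qed

text \<open>With z = 1/x, the derivative of p(z) exp(-z) in x is z^2 (p(z) - p'(z)) exp(-z), so the
  family is closed under differentiation. At 0 the difference quotient is itself a member, with z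
  p(z) in place of p(z), and tends to 0.\<close>

lemma flat_exp_has_derivative:
  "(flat_exp p has_real_derivative flat_exp ([:0, 0, 1:] * (p - pderiv p)) x) (at x)"
proof -
  consider "x > 0" | "x < 0" | "x = 0" by linarith
  then show ?thesis
  proof cases
    case 1
    have "((\<lambda>x. poly p (1 / x) * exp (- 1 / x)) has_real_derivative
        flat_exp ([:0, 0, 1:] * (p - pderiv p)) x) (at x)"
      using 1 by (auto intro!: derivative_eq_intros DERIV_chain'[OF _ poly_DERIV]
        simp: flat_exp_def field_simps power2_eq_square)
    then show ?thesis
      by (rule has_field_derivative_transform_within_open[of _ _ _ "{0<..}"])
        (use 1 in \<open>auto simp: flat_exp_def\<close>)
  next
    case 2
    have "((\<lambda>x. 0) has_real_derivative flat_exp ([:0, 0, 1:] * (p - pderiv p)) x) (at x)"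
      using 2 by (simp add: flat_exp_def)
    then show ?thesis
      by (rule has_field_derivative_transform_within_open[of _ _ _ "{..<0}"])
        (use 2 in \<open>auto simp: flat_exp_def\<close>)
  next
    case 3
    have "flat_exp ([:0, 1:] * p) = (\<lambda>h. flat_exp p h / h)"
      by (auto simp: flat_exp_def fun_eq_iff)
    then have "((\<lambda>h. flat_exp p h / h) \<longlongrightarrow> 0) (at 0)"
      using flat_exp_tendsto_0[of "[:0, 1:] * p"] by simp
    then show ?thesis
      using 3 by (simp add: DERIV_def flat_exp_def)
  qed
qed

text \<open>\<open>smooth\<close> quantifies over all iterated directional derivatives. This class
  contains the directional derivatives of its members, so smoothness becomes an induction on the
  list of directions; it is just large enough for products of bumps in affine coordinates.\<close>

inductive smooth_expr :: "('a::euclidean_space \<Rightarrow> real) \<Rightarrow> bool" where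
  flat: "smooth_expr (\<lambda>x. flat_exp p (a \<bullet> x + b))"
| const: "smooth_expr (\<lambda>x. c)"
| add: "smooth_expr f \<Longrightarrow> smooth_expr g \<Longrightarrow> smooth_expr (\<lambda>x. f x + g x)"
| mult: "smooth_expr f \<Longrightarrow> smooth_expr g \<Longrightarrow> smooth_expr (\<lambda>x. f x * g x)"

lemma smooth_expr_has_derivative:
  "smooth_expr f \<Longrightarrow> \<exists>f'. (\<forall>x. (f has_derivative f' x) (at x)) \<and> (\<forall>v. smooth_expr (\<lambda>x. f' x v))"
proof (induction rule: smooth_expr.induct)
  case (flat p a b)
  let ?q = "[:0, 0, 1:] * (p - pderiv p)"
  have "((\<lambda>x. flat_exp p (a \<bullet> x + b)) has_derivative
      (\<lambda>v. flat_exp ?q (a \<bullet> x + b) * (a \<bullet> v))) (at x)" for x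
    by (rule has_derivative_eq_rhs[OF has_derivative_compose[OF _
          flat_exp_has_derivative[unfolded has_field_derivative_def]]])
      (auto intro!: derivative_eq_intros)
  moreover have "smooth_expr (\<lambda>x. flat_exp ?q (a \<bullet> x + b) * (a \<bullet> v))" for v
    by (intro smooth_expr.intros)
  ultimately show ?case
    by (intro exI[of _ "\<lambda>x v. flat_exp ?q (a \<bullet> x + b) * (a \<bullet> v)"]) blast
next
  case (const c)
  show ?case
    by (intro exI[of _ "\<lambda>x v. 0"]) (auto intro: smooth_expr.intros)
next
  case (add f g)
  then obtain f' g' where "\<forall>x. (f has_derivative f' x) (at x)" "\<forall>v. smooth_expr (\<lambda>x. f' x v)"
    "\<forall>x. (g has_derivative g' x) (at x)" "\<forall>v. smooth_expr (\<lambda>x. g' x v)"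
    by blast
  then show ?case
    by (intro exI[of _ "\<lambda>x v. f' x v + g' x v"])
      (auto intro: smooth_expr.intros has_derivative_add)
next
  case (mult f g)
  then obtain f' g' where "\<forall>x. (f has_derivative f' x) (at x)" "\<forall>v. smooth_expr (\<lambda>x. f' x v)"
    "\<forall>x. (g has_derivative g' x) (at x)" "\<forall>v. smooth_expr (\<lambda>x. g' x v)"
    by blast
  with mult show ?case
    by (intro exI[of _ "\<lambda>x v. f x * g' x v + f' x v * g x"])
      (auto intro!: smooth_expr.intros has_derivative_mult)
qed

lemma smooth_expr_imp_smooth:
  assumes "smooth_expr f"
  shows "smooth f"
proof -
  have "smooth_expr (iter_dir_deriv vs f)" for vs
  proof (induction vs)
    case (Cons v vs)
    then obtain f' where f': "\<forall>x. (iter_dir_deriv vs f has_derivative f' x) (at x)"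
        "\<forall>v. smooth_expr (\<lambda>x. f' x v)"
      using smooth_expr_has_derivative by blast
    then have "iter_dir_deriv (v # vs) f = (\<lambda>x. f' x v)"
      by (auto simp: dir_deriv_def fun_eq_iff intro: frechet_derivative_at[THEN sym, THEN fun_cong])
    with f' show ?case by simp
  qed (use assms in simp)
  then show ?thesis
    using smooth_expr_has_derivative unfolding smooth_def differentiable_def by blast
qed

lemma smooth_expr_prod:
  "finite A \<Longrightarrow> (\<And>a. a \<in> A \<Longrightarrow> smooth_expr (f a)) \<Longrightarrow> smooth_expr (\<lambda>x. \<Prod>a\<in>A. f a x)"
  by (induction A rule: finite_induct) (auto intro: smooth_expr.intros)

section \<open>Derivatives and bounds of test functions\<close>

lemma smooth_differentiable: "smooth \<phi> \<Longrightarrow> \<phi> differentiable (at x)"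
  unfolding smooth_def by (drule spec[of _ "[]"]) simp

lemma smooth_dir_deriv:
  assumes "smooth \<phi>"
  shows "smooth (dir_deriv v \<phi>)"
proof -
  have "iter_dir_deriv vs (dir_deriv v \<phi>) = iter_dir_deriv (vs @ [v]) \<phi>" for vs
    by (induction vs) auto
  with assms show ?thesis
    unfolding smooth_def by metis
qed

lemma smooth_has_derivative:
  "smooth \<phi> \<Longrightarrow> (\<phi> has_derivative (\<lambda>v. dir_deriv v \<phi> x)) (at x)"
  using iffD1[OF frechet_derivative_works smooth_differentiable] by (simp add: dir_deriv_def)

lemma smooth_continuous_on: "smooth \<phi> \<Longrightarrow> continuous_on S \<phi>"
  using has_derivative_continuous[OF smooth_has_derivative, of \<phi>]
  by (simp add: continuous_at_imp_continuous_on)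

lemma smooth_measurable: "smooth \<phi> \<Longrightarrow> \<phi> \<in> borel_measurable borel"
  by (intro borel_measurable_continuous_onI smooth_continuous_on)

text \<open>Linearity in the direction reduces bounds for all directions to the finitely many basis
  vectors.\<close>

lemma dir_deriv_eq_sum:
  assumes "smooth \<phi>"
  shows "dir_deriv v \<phi> x = (\<Sum>b\<in>Basis. (v \<bullet> b) * dir_deriv b \<phi> x)"
proof -
  interpret bounded_linear "\<lambda>v. dir_deriv v \<phi> x"
    using smooth_has_derivative[OF assms] by (rule has_derivative_bounded_linear)
  have "dir_deriv (\<Sum>b\<in>Basis. (v \<bullet> b) *\<^sub>R b) \<phi> x = (\<Sum>b\<in>Basis. (v \<bullet> b) * dir_deriv b \<phi> x)"
    by (simp add: sum scaleR)
  then show ?thesis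
    by (simp add: euclidean_representation)
qed

lemma not_in_spt_zero: "x \<notin> spt \<phi> \<Longrightarrow> \<phi> x = 0"
  unfolding spt_def using closure_subset[of "{x. \<phi> x \<noteq> 0}"] by blast

lemma dir_deriv_zero_outside_spt:
  assumes "x \<notin> spt \<phi>"
  shows "dir_deriv v \<phi> x = 0"
proof -
  have "(\<phi> has_derivative (\<lambda>v. 0)) (at x)"
  proof (rule has_derivative_transform_within_open)
    show "((\<lambda>x. 0) has_derivative (\<lambda>v. 0)) (at x)" by simp
    show "open (- spt \<phi>)" by (simp add: spt_def open_Compl)
  qed (use assms not_in_spt_zero in force)+
  then show ?thesis
    unfolding dir_deriv_def by (metis frechet_derivative_at)
qed

lemma test_functionsD:
  assumes "\<phi> \<in> test_functions \<omega>"
  shows "smooth \<phi>" "compact (spt \<phi>)" "spt \<phi> \<subseteq> \<omega>"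
  using assms by (auto simp: test_functions_def)

lemma continuous_bounded_compact_zero:
  fixes u :: "'a::euclidean_space \<Rightarrow> real"
  assumes "continuous_on UNIV u" "compact K" "\<And>x. x \<notin> K \<Longrightarrow> u x = 0"
  obtains C where "C \<ge> 0" "\<And>x. \<bar>u x\<bar> \<le> C"
proof -
  have "compact (u ` K)"
    by (rule compact_continuous_image[OF continuous_on_subset[OF assms(1)] assms(2)]) simp
  then obtain C where C: "\<And>x. x \<in> K \<Longrightarrow> \<bar>u x\<bar> \<le> C"
    using compact_imp_bounded by (fastforce simp: bounded_iff)
  have "\<bar>u x\<bar> \<le> max 0 C" for x
    using C[of x] assms(3)[of x] by (cases "x \<in> K") auto
  then show ?thesis using that[of "max 0 C"] by simp
qed

text \<open>The function and its basis derivatives are continuous and vanish off a compact set, so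
  each is bounded; the sum of these bounds serves for all the clauses at once.\<close>

lemma test_function_bounds:
  fixes \<phi> :: "'a::euclidean_space \<Rightarrow> real"
  assumes "\<phi> \<in> test_functions \<omega>"
  obtains C where "C \<ge> 0" "\<And>x. \<bar>\<phi> x\<bar> \<le> C" "\<And>v x. \<bar>dir_deriv v \<phi> x\<bar> \<le> C * norm v"
    "C-lipschitz_on UNIV \<phi>"
proof -
  note \<phi> = test_functionsD[OF assms]
  obtain C0 where C0: "C0 \<ge> 0" "\<And>x. \<bar>\<phi> x\<bar> \<le> C0"
    using continuous_bounded_compact_zero[OF smooth_continuous_on[OF \<phi>(1)] \<phi>(2)] not_in_spt_zero
    by blast
  have "\<exists>C\<ge>0. \<forall>x. \<bar>dir_deriv b \<phi> x\<bar> \<le> C" for b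
    using continuous_bounded_compact_zero[OF smooth_continuous_on[OF smooth_dir_deriv[OF \<phi>(1)]] \<phi>(2)]
      dir_deriv_zero_outside_spt by metis
  then obtain B where B: "\<And>b. B b \<ge> 0" "\<And>b x. \<bar>dir_deriv b \<phi> x\<bar> \<le> B b"
    by metis
  define C where "C = C0 + (\<Sum>b\<in>Basis. B b)"
  have S0: "0 \<le> (\<Sum>b\<in>Basis. B b)"
    by (simp add: sum_nonneg B)
  have bd: "\<bar>dir_deriv v \<phi> x\<bar> \<le> C * norm v" for v x
  proof -
    have "\<bar>dir_deriv v \<phi> x\<bar> \<le> (\<Sum>b\<in>Basis. \<bar>(v \<bullet> b) * dir_deriv b \<phi> x\<bar>)"
      unfolding dir_deriv_eq_sum[OF \<phi>(1), of v] by (rule sum_abs)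
    also have "\<dots> \<le> (\<Sum>b\<in>Basis. norm v * B b)"
      unfolding abs_mult by (intro sum_mono mult_mono B Basis_le_norm) auto
    also have "\<dots> = norm v * (\<Sum>b\<in>Basis. B b)"
      by (simp add: sum_distrib_left)
    also have "\<dots> \<le> norm v * C"
      using C0(1) by (intro mult_left_mono) (auto simp: C_def)
    finally show ?thesis by (simp add: mult.commute)
  qed
  have lip: "C-lipschitz_on UNIV \<phi>"
  proof (rule lipschitz_onI)
    fix x y :: 'a
    have "norm (\<phi> x - \<phi> y) \<le> C * norm (x - y)"
    proof (rule differentiable_bound[of UNIV])
      show "(\<phi> has_derivative (\<lambda>v. dir_deriv v \<phi> x)) (at x within UNIV)" for x
        using smooth_has_derivative[OF \<phi>(1)] by simp
      show "onorm (\<lambda>v. dir_deriv v \<phi> x) \<le> C" for x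
        by (rule onorm_le) (use bd in auto)
    qed auto
    then show "dist (\<phi> x) (\<phi> y) \<le> C * dist x y"
      by (simp add: dist_norm)
  qed (use C0 S0 C_def in auto)
  have "\<bar>\<phi> x\<bar> \<le> C" for x
    using C0(2)[of x] S0 by (simp add: C_def)
  then show ?thesis
    by (rule that[of C, rotated]) (use C0 S0 bd lip in \<open>auto simp: C_def\<close>)
qed

section \<open>Mollifiers\<close>

definition bump1 :: "real \<Rightarrow> real"
  where "bump1 x = flat_exp 1 x * flat_exp 1 (1 - x)"

lemma bump1_nonneg: "bump1 x \<ge> 0"
  and bump1_pos: "0 < x \<Longrightarrow> x < 1 \<Longrightarrow> bump1 x > 0"
  and bump1_zero: "x \<le> 0 \<or> x \<ge> 1 \<Longrightarrow> bump1 x = 0"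
  by (auto simp: bump1_def flat_exp_def)

definition bump :: "'a::euclidean_space \<Rightarrow> real"
  where "bump x = (\<Prod>b\<in>Basis. bump1 (x \<bullet> b))"

lemma smooth_expr_bump: "smooth_expr (\<lambda>x. c * bump (r *\<^sub>R (x - x0)))"
proof -
  have *: "smooth_expr (\<lambda>x. bump1 (r *\<^sub>R (x - x0) \<bullet> b))" for b
  proof -
    have "smooth_expr (\<lambda>x. flat_exp 1 ((r *\<^sub>R b) \<bullet> x + (- r * (x0 \<bullet> b))) *
        flat_exp 1 ((- r *\<^sub>R b) \<bullet> x + (1 + r * (x0 \<bullet> b))))"
      by (intro smooth_expr.intros)
    then show ?thesis
      by (simp add: bump1_def inner_diff_left inner_commute algebra_simps)
  qed
  show ?thesis
    unfolding bump_def by (intro smooth_expr.intros smooth_expr_prod *) auto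
qed

lemma bump_nonneg: "bump x \<ge> 0"
  by (simp add: bump_def bump1_nonneg prod_nonneg)

lemma bump_zero: "x \<notin> box 0 One \<Longrightarrow> bump x = 0"
  by (force simp: bump_def mem_box intro!: bump1_zero)

lemma bump_pos: "x \<in> box 0 One \<Longrightarrow> bump x > 0"
  by (auto simp: bump_def mem_box intro!: prod_pos bump1_pos)

lemma bump_continuous: "continuous_on S (bump :: 'a::euclidean_space \<Rightarrow> real)"
proof -
  have "smooth (\<lambda>x :: 'a. 1 * bump (1 *\<^sub>R (x - 0)))"
    by (intro smooth_expr_imp_smooth smooth_expr_bump)
  then have "smooth (bump :: 'a \<Rightarrow> real)"
    by simp
  then show ?thesis
    by (rule smooth_continuous_on)
qed

lemma integrable_continuous_compact_zero:
  fixes u :: "'a::euclidean_space \<Rightarrow> real"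
  assumes "continuous_on UNIV u" "compact K" "\<And>x. x \<notin> K \<Longrightarrow> u x = 0"
  shows "integrable lborel u"
proof -
  have "set_integrable lborel K u"
    unfolding set_integrable_def
    by (rule borel_integrable_compact[OF assms(2)]) (use assms(1) continuous_on_subset in blast)
  moreover have "(\<lambda>x. indicator K x *\<^sub>R u x) = u"
    using assms(3) by (auto simp: indicator_def fun_eq_iff)
  ultimately show ?thesis
    by (simp add: set_integrable_def)
qed

lemma integrable_bump: "integrable lborel (bump :: 'a::euclidean_space \<Rightarrow> real)"
proof (rule integrable_continuous_compact_zero[OF bump_continuous compact_cbox[of 0 One]])
  fix x :: 'a assume "x \<notin> cbox 0 One"
  then have "x \<notin> box 0 One"
    using box_subset_cbox by blast
  then show "bump x = 0"
    by (rule bump_zero)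
qed

text \<open>A vanishing integral would force the bump to vanish almost everywhere, although it is
  positive on a box of measure 1.\<close>

lemma integral_bump_pos: "integral\<^sup>L lborel (bump :: 'a::euclidean_space \<Rightarrow> real) > 0"
proof -
  have "integral\<^sup>L lborel (bump :: 'a \<Rightarrow> real) \<noteq> 0"
  proof
    assume "integral\<^sup>L lborel (bump :: 'a \<Rightarrow> real) = 0"
    then have "AE x in lborel. bump (x :: 'a) = 0"
      using integral_nonneg_eq_0_iff_AE[OF integrable_bump] bump_nonneg by auto
    then have "AE x in lborel. (x :: 'a) \<notin> box 0 One"
      by eventually_elim (metis bump_pos less_irrefl)
    then have "emeasure lborel (box 0 One :: 'a set) = 0"
      by (subst (asm) AE_iff_measurable[of "box 0 One"]) auto
    then show False
      by (simp add: emeasure_lborel_box_eq)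
  qed
  moreover have "integral\<^sup>L lborel (bump :: 'a \<Rightarrow> real) \<ge> 0"
    by (simp add: bump_nonneg)
  ultimately show ?thesis by linarith
qed

text \<open>The support of the mollifier is the box with lower corner \<open>x0\<close>, and not a ball around
  \<open>x0\<close>, because the Lebesgue differentiation theorem is available for such boxes.\<close>

definition mollifier :: "nat \<Rightarrow> 'a::euclidean_space \<Rightarrow> 'a \<Rightarrow> real"
  where "mollifier n x0 x =
    real (Suc n) ^ DIM('a) / integral\<^sup>L lborel (bump :: 'a \<Rightarrow> real) * bump (real (Suc n) *\<^sub>R (x - x0))"

definition corner_box :: "nat \<Rightarrow> 'a::euclidean_space \<Rightarrow> 'a set"
  where "corner_box n x0 = cbox x0 (x0 + (1 / real (Suc n)) *\<^sub>R One)"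

lemma mollifier_smooth: "smooth (mollifier n x0)"
  unfolding mollifier_def by (intro smooth_expr_imp_smooth smooth_expr_bump)

lemma mollifier_nonneg: "mollifier n x0 x \<ge> 0"
  unfolding mollifier_def using integral_bump_pos bump_nonneg
  by (intro mult_nonneg_nonneg divide_nonneg_nonneg) (auto simp: less_imp_le)

lemma mollifier_zero: "x \<notin> corner_box n x0 \<Longrightarrow> mollifier n x0 x = 0"
proof -
  assume a: "x \<notin> corner_box n x0"
  have "real (Suc n) *\<^sub>R (x - x0) \<notin> box 0 One"
  proof
    assume "real (Suc n) *\<^sub>R (x - x0) \<in> box 0 One"
    then have "\<forall>b\<in>Basis. x0 \<bullet> b \<le> x \<bullet> b \<and> (x \<bullet> b - x0 \<bullet> b) * real (Suc n) \<le> 1"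
      by (auto simp: mem_box inner_diff_left pos_le_divide_eq zero_less_mult_iff less_imp_le
          algebra_simps simp del: of_nat_Suc)
    with a show False
      by (auto simp: corner_box_def mem_box inner_add_left pos_le_divide_eq[symmetric]
          simp del: of_nat_Suc)
  qed
  then show ?thesis
    by (simp add: mollifier_def bump_zero)
qed

lemma spt_mollifier: "spt (mollifier n x0) \<subseteq> corner_box n x0"
  unfolding spt_def by (rule closure_minimal) (use mollifier_zero in \<open>auto simp: corner_box_def\<close>)

lemma compact_spt_mollifier: "compact (spt (mollifier n x0))"
  using spt_mollifier[of n x0] unfolding corner_box_def compact_eq_bounded_closed
  by (auto simp: spt_def intro: bounded_subset bounded_cbox)

lemma mollifier_test_function: "corner_box n x0 \<subseteq> \<omega> \<Longrightarrow> mollifier n x0 \<in> test_functions \<omega>"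
  using spt_mollifier mollifier_smooth compact_spt_mollifier by (auto simp: test_functions_def)

text \<open>The substitution (n + 1)(x - x0) produces the power of n + 1 by which the definition is
  normalized.\<close>

lemma integral_mollifier: "integral\<^sup>L lborel (mollifier n (x0 :: 'a::euclidean_space)) = 1"
proof -
  let ?c = "real (Suc n)" and ?I = "integral\<^sup>L lborel (bump :: 'a \<Rightarrow> real)"
  have "?I = (\<integral>x. bump x \<partial>density (distr lborel borel (\<lambda>x. - (?c *\<^sub>R x0) + ?c *\<^sub>R x)) (\<lambda>_. \<bar>?c\<bar>^DIM('a)))"
    by (subst lborel_affine[of ?c "- (?c *\<^sub>R x0)"]) auto
  also have "\<dots> = ?c ^ DIM('a) * (\<integral>x. bump (- (?c *\<^sub>R x0) + ?c *\<^sub>R (x :: 'a)) \<partial>lborel)"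
    using borel_measurable_continuous_onI[OF bump_continuous[of UNIV]]
    by (subst integral_density)
      (auto simp: integral_distr ennreal_power simp del: of_nat_Suc)
  finally have "?I = ?c ^ DIM('a) * (\<integral>x. bump (?c *\<^sub>R (x - x0)) \<partial>lborel)"
    by (simp add: algebra_simps)
  then show ?thesis
    unfolding mollifier_def using integral_bump_pos[where 'a='a]
    by (auto simp: divide_simps simp del: of_nat_Suc)
qed

section \<open>Difference quotients of Lipschitz functions\<close>

lemma negligible_imp_AE: "negligible N \<Longrightarrow> AE x in lborel. x \<notin> N"
  using AE_not_in[of N lebesgue] by (simp add: negligible_iff_null_sets AE_completion_iff)

text \<open>By Lindelof, countably many of the balls have the same union, and countably many
  exceptional null sets form a null set.\<close>

lemma AE_local_to_global:
  fixes S :: "'a::euclidean_space set"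
  assumes "\<And>x. x \<in> S \<Longrightarrow> \<exists>r>0. AE z in lborel. z \<in> ball x r \<longrightarrow> P z"
  shows "AE z in lborel. z \<in> S \<longrightarrow> P z"
proof -
  obtain r where r: "\<And>x. x \<in> S \<Longrightarrow> r x > 0 \<and> (AE z in lborel. z \<in> ball x (r x) \<longrightarrow> P z)"
    using assms by metis
  obtain \<F> where \<F>: "\<F> \<subseteq> (\<lambda>x. ball x (r x)) ` S" "countable \<F>"
      "\<Union>\<F> = \<Union>((\<lambda>x. ball x (r x)) ` S)"
    by (rule Lindelof[of "(\<lambda>x. ball x (r x)) ` S"]) auto
  have "AE z in lborel. z \<in> B \<longrightarrow> P z" if "B \<in> \<F>" for B
    using that \<F>(1) r by blast
  with \<F>(2) have "AE z in lborel. \<forall>B\<in>\<F>. z \<in> B \<longrightarrow> P z"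
    by (intro AE_ball_countable') auto
  then show ?thesis
  proof eventually_elim
    case (elim z)
    have "z \<in> \<Union>\<F>" if "z \<in> S"
      unfolding \<F>(3) using that r[OF that] centre_in_ball by blast
    with elim show ?case by blast
  qed
qed

definition diff_quot :: "'a::real_vector \<Rightarrow> ('a \<Rightarrow> real) \<Rightarrow> nat \<Rightarrow> 'a \<Rightarrow> real"
  where "diff_quot v f n x = real (Suc n) * (f (x + (1 / real (Suc n)) *\<^sub>R v) - f x)"

text \<open>Only the countably many steps 1/(n+1) enter, so that the set of convergence and the
  limit are Borel for Borel \<open>f\<close>. The default 0 keeps the Lipschitz bound valid at
  points where there is no limit.\<close>

definition quot_deriv :: "'a::real_vector \<Rightarrow> ('a \<Rightarrow> real) \<Rightarrow> 'a \<Rightarrow> real"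
  where "quot_deriv v f x =
    (if convergent (\<lambda>n. diff_quot v f n x) then lim (\<lambda>n. diff_quot v f n x) else 0)"

lemma quot_deriv_eqI: "(\<lambda>n. diff_quot v f n x) \<longlonglongrightarrow> l \<Longrightarrow> quot_deriv v f x = l"
  unfolding quot_deriv_def by (auto simp: convergent_def limI)

lemma tendsto_quot_deriv:
  "convergent (\<lambda>n. diff_quot v f n x) \<Longrightarrow> (\<lambda>n. diff_quot v f n x) \<longlonglongrightarrow> quot_deriv v f x"
  by (simp add: quot_deriv_def convergent_LIMSEQ_iff)

lemma diff_quot_measurable:
  fixes f :: "'a::euclidean_space \<Rightarrow> real"
  assumes [measurable]: "f \<in> borel_measurable borel"
  shows "diff_quot v f n \<in> borel_measurable borel"
  unfolding diff_quot_def by measurable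

lemma convergent_diff_quot_sets:
  fixes f :: "'a::euclidean_space \<Rightarrow> real"
  assumes "f \<in> borel_measurable borel"
  shows "{x. convergent (\<lambda>n. diff_quot v f n x)} \<in> sets borel"
  using sets_Collect_Cauchy[of "\<lambda>n. diff_quot v f n" borel] diff_quot_measurable[OF assms]
  by (simp add: Cauchy_convergent_iff)

lemma quot_deriv_measurable:
  fixes f :: "'a::euclidean_space \<Rightarrow> real"
  assumes "f \<in> borel_measurable borel"
  shows "quot_deriv v f \<in> borel_measurable borel"
proof -
  note [measurable] = diff_quot_measurable[OF assms]
  have [measurable]: "Measurable.pred borel (\<lambda>x. convergent (\<lambda>n. diff_quot v f n x))"
    using convergent_diff_quot_sets[OF assms] by (simp add: pred_def)
  show ?thesis
    unfolding quot_deriv_def by measurable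
qed

lemma diff_quot_bound:
  fixes f :: "'a::real_normed_vector \<Rightarrow> real"
  assumes "L-lipschitz_on S f" "x \<in> S" "x + (1 / real (Suc n)) *\<^sub>R v \<in> S"
  shows "\<bar>diff_quot v f n x\<bar> \<le> L * norm v"
proof -
  have "\<bar>f (x + (1 / real (Suc n)) *\<^sub>R v) - f x\<bar> \<le> L * (norm v / real (Suc n))"
    using lipschitz_onD[OF assms(1,3,2)] by (simp add: dist_norm)
  then have "real (Suc n) * \<bar>f (x + (1 / real (Suc n)) *\<^sub>R v) - f x\<bar>
      \<le> real (Suc n) * (L * (norm v / real (Suc n)))"
    by (intro mult_left_mono) auto
  then show ?thesis
    by (simp add: diff_quot_def abs_mult del: of_nat_Suc)
qed

lemma tendsto_step: "(\<lambda>n. x + (1 / real (Suc n)) *\<^sub>R v) \<longlonglongrightarrow> (x::'a::real_normed_vector)"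
proof -
  have "(\<lambda>n. x + (1 / real (Suc n)) *\<^sub>R v) \<longlonglongrightarrow> x + 0 *\<^sub>R v"
    using LIMSEQ_inverse_real_of_nat
    by (intro tendsto_intros) (simp add: inverse_eq_divide)
  then show ?thesis by simp
qed

lemma quot_deriv_bound:
  fixes f :: "'a::real_normed_vector \<Rightarrow> real"
  assumes "L-lipschitz_on U f" "open U" "x \<in> U"
  shows "\<bar>quot_deriv v f x\<bar> \<le> L * norm v"
proof (cases "convergent (\<lambda>n. diff_quot v f n x)")
  case True
  then have "(\<lambda>n. \<bar>diff_quot v f n x\<bar>) \<longlonglongrightarrow> \<bar>quot_deriv v f x\<bar>"
    by (intro tendsto_rabs tendsto_quot_deriv)
  moreover have "eventually (\<lambda>n. x + (1 / real (Suc n)) *\<^sub>R v \<in> U) sequentially"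
    using tendsto_step[of x v] assms(2,3) by (rule topological_tendstoD)
  then have "eventually (\<lambda>n. \<bar>diff_quot v f n x\<bar> \<le> L * norm v) sequentially"
    by eventually_elim (rule diff_quot_bound[OF assms(1,3)])
  ultimately show ?thesis
    by (rule tendsto_upperbound) simp
next
  case False
  then show ?thesis
    using lipschitz_on_nonneg[OF assms(1)] by (simp add: quot_deriv_def)
qed

lemma diff_quot_cong:
  fixes f :: "'a::real_normed_vector \<Rightarrow> real"
  assumes "open U" "x \<in> U" "\<And>z. z \<in> U \<Longrightarrow> f z = g z"
  shows "eventually (\<lambda>n. diff_quot v f n x = diff_quot v g n x) sequentially"
proof -
  have "eventually (\<lambda>n. x + (1 / real (Suc n)) *\<^sub>R v \<in> U) sequentially"
    using tendsto_step[of x v] assms(1,2) by (rule topological_tendstoD)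
  then show ?thesis
    by eventually_elim (use assms in \<open>simp add: diff_quot_def\<close>)
qed

lemma convergent_diff_quot_cong:
  fixes f :: "'a::real_normed_vector \<Rightarrow> real"
  assumes "open U" "x \<in> U" "\<And>z. z \<in> U \<Longrightarrow> f z = g z"
  shows "convergent (\<lambda>n. diff_quot v f n x) \<longleftrightarrow> convergent (\<lambda>n. diff_quot v g n x)"
  using tendsto_cong[OF diff_quot_cong[OF assms]] by (simp add: convergent_def)

lemma quot_deriv_cong:
  fixes f :: "'a::real_normed_vector \<Rightarrow> real"
  assumes "open U" "x \<in> U" "\<And>z. z \<in> U \<Longrightarrow> f z = g z"
  shows "quot_deriv v f x = quot_deriv v g x"
  using tendsto_cong[OF diff_quot_cong[OF assms]]
  by (simp add: quot_deriv_def convergent_def lim_def)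

text \<open>After adding a linear function, \<open>u\<close> is an increasing bi-Lipschitz bijection; the image of
  Lebesgue measure under its inverse is absolutely continuous, and its density is the derivative.\<close>

lemma lipschitz_AE_convergent_real:
  fixes u :: "real \<Rightarrow> real"
  assumes L: "L-lipschitz_on UNIV u"
  shows "AE t in lborel. convergent (\<lambda>n. diff_quot 1 u n t)"
proof -
  \<comment> \<open>The added slope exceeds the Lipschitz constant by 1: \<open>v\<close> grows at
    least as fast as the identity, so its inverse \<open>w\<close> will be 1-Lipschitz.\<close>
  define v where "v t = u t + (L + 1) * t" for t
  have L0: "L \<ge> 0" using lipschitz_on_nonneg[OF L] .
  have ulip: "\<bar>u s - u t\<bar> \<le> L * \<bar>s - t\<bar>" for s t
    using lipschitz_onD[OF L, of s t] by (simp add: dist_real_def)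
  have vinc: "t - s \<le> v t - v s" if "s \<le> t" for s t
    using ulip[of t s] that by (simp add: v_def abs_le_iff algebra_simps)
  have vlip: "\<bar>v s - v t\<bar> \<le> (2 * L + 1) * \<bar>s - t\<bar>" for s t
    using ulip[of t s] L0 unfolding v_def by (auto simp: abs_if algebra_simps split: if_splits)
  have vcont: "continuous_on S v" for S
    unfolding v_def by (intro continuous_intros lipschitz_on_continuous_on[of L]
        lipschitz_on_subset[OF L]) auto
  have vstrict: "s < t \<longleftrightarrow> v s < v t" for s t
    using vinc[of s t] vinc[of t s] by linarith
  have "\<exists>t. v t = a" for a
  proof -
    have "v (- \<bar>a - v 0\<bar>) \<le> a" "a \<le> v \<bar>a - v 0\<bar>"
      using vinc[of "- \<bar>a - v 0\<bar>" 0] vinc[of 0 "\<bar>a - v 0\<bar>"] by linarith+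
    then show ?thesis
      using IVT'[of v "- \<bar>a - v 0\<bar>" a "\<bar>a - v 0\<bar>"] vcont by auto
  qed
  then obtain w where vw: "\<And>a. v (w a) = a"
    by metis
  have wv: "w (v t) = t" for t
    using vw[of "v t"] vstrict[of t "w (v t)"] vstrict[of "w (v t)" t] by linarith
  have "1-lipschitz_on UNIV w"
  proof (rule lipschitz_onI)
    fix a b
    show "dist (w a) (w b) \<le> 1 * dist a b"
      using vinc[of "w a" "w b"] vinc[of "w b" "w a"] vw[of a] vw[of b]
      by (auto simp: dist_real_def abs_if)
  qed simp
  then have w[measurable]: "w \<in> borel_measurable borel"
    using borel_measurable_continuous_onI lipschitz_on_continuous_on by blast
  \<comment> \<open>Images under \<open>v\<close> become preimages under the continuous
    \<open>w\<close>, hence stay Borel.\<close>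
  have vimg: "w -` A = v ` A" for A
    unfolding vimage_def image_def using wv vw by (metis (mono_tags, lifting))
  define \<mu> where "\<mu> = distr lborel borel w"
  have \<mu>: "emeasure \<mu> A = emeasure lborel (v ` A)" if "A \<in> sets borel" for A
    unfolding \<mu>_def using that by (simp add: emeasure_distr vimg)
  have "absolutely_continuous lborel \<mu>"
    unfolding absolutely_continuous_def
  proof
    fix A :: "real set" assume "A \<in> null_sets lborel"
    then have A: "A \<in> sets borel" "negligible A"
      by (auto simp: negligible_iff_null_sets null_sets_completionI)
    have "negligible (v ` A)"
    proof (rule negligible_locally_Lipschitz_image[OF _ A(2)])
      show "\<exists>T B. open T \<and> x \<in> T \<and> (\<forall>y\<in>A \<inter> T. norm (v y - v x) \<le> B * norm (y - x))" for x
        by (rule exI[of _ UNIV], rule exI[of _ "2 * L + 1"]) (use vlip in auto)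
    qed simp
    moreover have "v ` A \<in> sets borel"
      using measurable_sets[OF w A(1)] by (simp add: vimg)
    ultimately have "emeasure lborel (v ` A) = 0"
      by (simp add: negligible_iff_null_sets null_sets_def)
    then show "A \<in> null_sets \<mu>"
      using A \<mu> by (auto simp: null_sets_def \<mu>_def)
  qed
  then obtain D where D[measurable]: "D \<in> borel_measurable borel" and dens: "density lborel D = \<mu>"
    using sigma_finite_measure.Radon_Nikodym[OF sigma_finite_lborel, of \<mu>] by (auto simp: \<mu>_def)
  have nnD: "(\<integral>\<^sup>+x. D x * indicator {a..b} x \<partial>lborel) = ennreal (v b - v a)" if "a \<le> b" for a b
  proof -
    have "v ` {a..b} = {v a..v b}"
    proof
      show "v ` {a..b} \<subseteq> {v a..v b}"
        using vinc by force
      show "{v a..v b} \<subseteq> v ` {a..b}"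
      proof
        fix c assume "c \<in> {v a..v b}"
        then have "w c \<in> {a..b}"
          using vstrict[of "w c" a] vstrict[of b "w c"] vw[of c] by auto
        then show "c \<in> v ` {a..b}"
          using vw[of c] by (metis imageI)
      qed
    qed
    then have "emeasure \<mu> {a..b} = ennreal (v b - v a)"
      using vinc[OF that] that by (simp add: \<mu>)
    then show ?thesis
      by (simp add: dens[symmetric] emeasure_density)
  qed
  \<comment> \<open>The integrals of \<open>D\<close> over the bounded intervals of an exhaustion
    are finite, so \<open>D\<close> is finite almost everywhere and can be replaced by a real
    function.\<close>
  have "AE x in lborel. \<forall>n::nat. D x * indicator {- real n..real n} x \<noteq> \<infinity>"
    unfolding AE_all_countable by (intro allI nn_integral_PInf_AE) (auto simp: nnD)
  then have fin: "AE x in lborel. D x \<noteq> \<infinity>"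
  proof eventually_elim
    case (elim x)
    obtain n where "\<bar>x\<bar> \<le> real n" using real_arch_simple by blast
    then have "indicator {- real n..real n} x = (1 :: ennreal)"
      by (simp add: abs_le_iff)
    with elim[rule_format, of n] show ?case
      by simp
  qed
  define d where "d x = enn2real (D x)" for x
  have int: "(d has_integral (v b - v a)) {a..b}" if "a \<le> b" for a b
  proof -
    have eq: "(\<integral>\<^sup>+x. ennreal (if x \<in> {a..b} then d x else 0) \<partial>lborel) = ennreal (v b - v a)"
      unfolding nnD[OF that, symmetric]
      by (intro nn_integral_cong_AE, use fin in eventually_elim)
        (auto simp: d_def indicator_def less_top)
    have [measurable]: "d \<in> borel_measurable borel"
      unfolding d_def by measurable
    have "((\<lambda>x. if x \<in> {a..b} then d x else 0) has_integral (v b - v a)) UNIV"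
    proof (rule nn_integral_has_integral[OF _ _ eq])
      show "0 \<le> v b - v a"
        using vinc[OF that] that by simp
    qed (auto simp: d_def)
    then show ?thesis
      by (simp only: has_integral_restrict_UNIV)
  qed
  have "d integrable_on cbox a b" for a b
    using int[of a b] by (cases "a \<le> b") (auto simp: integrable_on_def cbox_interval)
  \<comment> \<open>The averages are over [x, x + h]; for h = 1/(n+1) they are exactly the forward
    difference quotients of \<open>v\<close>.\<close>
  then obtain N where "negligible N" and N: "\<And>x e. \<lbrakk>x \<notin> N; 0 < e\<rbrakk> \<Longrightarrow>
      \<exists>\<delta>>0. \<forall>h. 0 < h \<and> h < \<delta> \<longrightarrow>
        norm (integral (cbox x (x + h *\<^sub>R One)) d /\<^sub>R h ^ DIM(real) - d x) < e"
    using integrable_ccontinuous_explicit[of d] by metis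
  have "convergent (\<lambda>n. diff_quot 1 u n x)" if "x \<notin> N" for x
  proof -
    have "(\<lambda>n. diff_quot 1 v n x) \<longlonglongrightarrow> d x"
    proof (rule LIMSEQ_I)
      fix e :: real assume "e > 0"
      from N[OF that this] obtain \<delta> where \<delta>: "\<delta> > 0"
        "\<And>h. 0 < h \<Longrightarrow> h < \<delta> \<Longrightarrow>
          norm (integral (cbox x (x + h *\<^sub>R One)) d /\<^sub>R h ^ DIM(real) - d x) < e"
        by blast
      obtain n0 where n0: "1 / real (Suc n0) < \<delta>"
        using nat_approx_posE[OF \<delta>(1)] by blast
      have "norm (diff_quot 1 v n x - d x) < e" if "n \<ge> n0" for n
      proof -
        let ?h = "1 / real (Suc n)"
        have "?h \<le> 1 / real (Suc n0)"
          using that by (intro divide_left_mono) auto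
        then have "norm (integral (cbox x (x + ?h *\<^sub>R One)) d /\<^sub>R ?h ^ DIM(real) - d x) < e"
          using n0 by (intro \<delta>(2)) auto
        then have "norm (integral {x..x + ?h} d / ?h - d x) < e"
          by (simp add: divide_inverse mult.commute)
        moreover have "integral {x..x + ?h} d = v (x + ?h) - v x"
          by (intro integral_unique int) simp
        ultimately show ?thesis
          by (simp add: diff_quot_def mult.commute)
      qed
      then show "\<exists>no. \<forall>n\<ge>no. norm (diff_quot 1 v n x - d x) < e"
        by blast
    qed
    moreover have "diff_quot 1 u n x = diff_quot 1 v n x - (L + 1)" for n
      by (simp add: diff_quot_def v_def field_simps del: of_nat_Suc)
    ultimately have "(\<lambda>n. diff_quot 1 u n x) \<longlonglongrightarrow> d x - (L + 1)"
      by (auto intro: tendsto_diff)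
    then show ?thesis
      by (auto simp: convergent_def)
  qed
  then show ?thesis
    using negligible_imp_AE[OF \<open>negligible N\<close>] by auto
qed

text \<open>Fubini over the lines parallel to \<open>v\<close>. The outer quantifier has to run over
  y; for v = (1, 0) the one-dimensional result gives the other order, and the measurability of the
  set of convergence allows the exchange.\<close>

lemma lipschitz_AE_convergent:
  fixes f :: "real \<times> real \<Rightarrow> real"
  assumes f: "L-lipschitz_on UNIV f" and v: "v = (1, 0) \<or> v = (0, 1)"
  shows "AE x in lborel. convergent (\<lambda>n. diff_quot v f n x)"
proof -
  let ?P = "\<lambda>x. convergent (\<lambda>n. diff_quot v f n x)"
  have L0: "L \<ge> 0" using lipschitz_on_nonneg[OF f] .
  have "f \<in> borel_measurable borel"
    by (rule borel_measurable_continuous_onI[OF lipschitz_on_continuous_on[OF f]])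
  then have m: "{x \<in> space (lborel \<Otimes>\<^sub>M lborel). ?P x} \<in> sets (lborel \<Otimes>\<^sub>M lborel)"
    using convergent_diff_quot_sets[of f v] unfolding lborel_prod by simp
  have "AE y in lborel. AE t in lborel. ?P (y, t)"
    using v
  proof
    assume v: "v = (0, 1)"
    have "AE t in lborel. ?P (y, t)" for y
    proof -
      have "L-lipschitz_on UNIV (\<lambda>t. f (y, t))"
        using lipschitz_onD[OF f, of "(y, _)" "(y, _)"] L0
        by (intro lipschitz_onI) (auto simp: dist_prod_def)
      from lipschitz_AE_convergent_real[OF this] show ?thesis
        by (simp add: diff_quot_def v)
    qed
    then show ?thesis by simp
  next
    assume v: "v = (1, 0)"
    have "AE y in lborel. ?P (y, t)" for t
    proof -
      have "L-lipschitz_on UNIV (\<lambda>y. f (y, t))"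
        using lipschitz_onD[OF f, of "(_, t)" "(_, t)"] L0
        by (intro lipschitz_onI) (auto simp: dist_prod_def)
      from lipschitz_AE_convergent_real[OF this] show ?thesis
        by (simp add: diff_quot_def v)
    qed
    then have "AE t in lborel. AE y in lborel. ?P (y, t)"
      by simp
    then show ?thesis
      using lborel_pair.AE_commute[of "\<lambda>y t. ?P (y, t)"] m by simp
  qed
  from lborel_pair.AE_pair_measure[OF m this] show ?thesis
    unfolding lborel_prod .
qed

text \<open>Composition with the nearest-point map \<open>clamp\<close> of a small box, which is
  1-Lipschitz, keeps the Lipschitz constant and takes only values of \<open>f\<close> on a compact
  set.\<close>

lemma locally_lipschitz_extension:
  fixes f :: "'a::euclidean_space \<Rightarrow> real"
  assumes "open \<omega>" "locally_lipschitz_on \<omega> f" "p \<in> \<omega>"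
  obtains r L F M where "r > 0" "ball p r \<subseteq> \<omega>" "L-lipschitz_on UNIV F"
    "\<And>x. x \<in> ball p r \<Longrightarrow> f x = F x" "\<And>x. \<bar>F x\<bar> \<le> M"
proof -
  obtain r0 L where r0: "r0 > 0" "L-lipschitz_on (ball p r0 \<inter> \<omega>) f"
    using assms unfolding locally_lipschitz_on_def by blast
  obtain r1 where r1: "r1 > 0" "ball p r1 \<subseteq> ball p r0 \<inter> \<omega>"
    using assms(1,3) r0(1) open_contains_ball[of "ball p r0 \<inter> \<omega>"]
    by (metis IntI centre_in_ball open_Int open_ball)
  obtain a b where ab: "p \<in> box a b" "cbox a b \<subseteq> ball p r1"
    by (rule open_contains_cbox[of "ball p r1" p]) (use r1(1) in auto)
  obtain r where r: "r > 0" "ball p r \<subseteq> box a b"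
    using ab(1) open_contains_ball[of "box a b"] by auto
  have le: "a \<bullet> i \<le> b \<bullet> i" if "i \<in> Basis" for i
    using ab(1) that by (force simp: mem_box)
  have lip: "L-lipschitz_on (cbox a b) f"
    by (rule lipschitz_on_subset[OF r0(2)]) (use ab r1 in auto)
  define F where "F = f \<circ> clamp a b"
  have cl: "clamp a b x \<in> cbox a b" for x
    by (rule clamp_in_interval) (use le in auto)
  have "(L * 1)-lipschitz_on UNIV F"
    unfolding F_def
  proof (rule lipschitz_on_compose)
    show "1-lipschitz_on UNIV (clamp a b)"
      by (rule lipschitz_onI) (auto simp: dist_clamps_le_dist_args)
    show "L-lipschitz_on (clamp a b ` UNIV) f"
      by (rule lipschitz_on_subset[OF lip]) (use cl in auto)
  qed
  moreover have "f x = F x" if "x \<in> ball p r" for x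
    using that r(2) box_subset_cbox[of a b] by (auto simp: F_def clamp_cancel_cbox subset_iff)
  moreover obtain M where "\<And>x. x \<in> cbox a b \<Longrightarrow> \<bar>f x\<bar> \<le> M"
    using compact_imp_bounded[OF compact_continuous_image[OF lipschitz_on_continuous_on[OF lip] compact_cbox]]
    by (auto simp: bounded_iff)
  then have "\<bar>F x\<bar> \<le> M" for x
    using cl by (simp add: F_def)
  moreover have "ball p r \<subseteq> \<omega>"
    using r(2) ab(2) r1(2) box_subset_cbox[of a b] by blast
  ultimately show ?thesis
    using that[of r "L" F M] r(1) by simp
qed

lemma locally_lipschitz_AE_convergent:
  fixes f :: "real \<times> real \<Rightarrow> real"
  assumes "open \<omega>" "locally_lipschitz_on \<omega> f" "v = (1, 0) \<or> v = (0, 1)"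
  shows "AE x in lborel. x \<in> \<omega> \<longrightarrow> convergent (\<lambda>n. diff_quot v f n x)"
proof (rule AE_local_to_global)
  fix p assume "p \<in> \<omega>"
  then obtain r L F M where *: "r > 0" "ball p r \<subseteq> \<omega>" "L-lipschitz_on UNIV F"
      "\<And>x. x \<in> ball p r \<Longrightarrow> f x = F x" "\<And>x. \<bar>F x\<bar> \<le> M"
    using locally_lipschitz_extension[OF assms(1,2)] by metis
  have "AE z in lborel. convergent (\<lambda>n. diff_quot v F n z)"
    by (rule lipschitz_AE_convergent[OF *(3) assms(3)])
  then have "AE z in lborel. z \<in> ball p r \<longrightarrow> convergent (\<lambda>n. diff_quot v f n z)"
  proof eventually_elim
    case (elim z)
    show ?case
      using convergent_diff_quot_cong[OF open_ball _ *(4), of z p r _ v] elim by auto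
  qed
  with *(1) show "\<exists>r>0. AE z in lborel. z \<in> ball p r \<longrightarrow> convergent (\<lambda>n. diff_quot v f n z)"
    by blast
qed

section \<open>Mollification at Lebesgue points\<close>

lemma mollifier_scale:
  "mollifier n x0 x = real (Suc n) ^ DIM('a) * mollifier 0 0 (real (Suc n) *\<^sub>R (x - (x0 :: 'a::euclidean_space)))"
  by (simp add: mollifier_def del: of_nat_Suc) simp

lemma mollifier_translate: "mollifier n x0 x = mollifier n 0 (x - x0)"
  by (simp add: mollifier_def)

text \<open>Scaling from n = 0: every derivative costs one further factor n + 1. The constant is
  uniform in n and in the base point.\<close>

lemma mollifier_bounds:
  obtains C where "C \<ge> 0"
    "\<And>n x0 x. \<bar>mollifier n (x0 :: 'a::euclidean_space) x\<bar> \<le> C * real (Suc n) ^ DIM('a)"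
    "\<And>n v x0 x. \<bar>dir_deriv v (mollifier n (x0 :: 'a)) x\<bar> \<le> C * real (Suc n) ^ (DIM('a) + 1) * norm v"
proof -
  have "mollifier 0 (0 :: 'a) \<in> test_functions UNIV"
    by (rule mollifier_test_function) simp
  then obtain C where C: "C \<ge> 0" "\<And>x. \<bar>mollifier 0 (0 :: 'a) x\<bar> \<le> C"
      "\<And>v x. \<bar>dir_deriv v (mollifier 0 (0 :: 'a)) x\<bar> \<le> C * norm v"
    using test_function_bounds by metis
  have 1: "\<bar>mollifier n (x0 :: 'a) x\<bar> \<le> C * real (Suc n) ^ DIM('a)" for n x0 x
    unfolding mollifier_scale[of n x0] abs_mult
    using C(2)[of "real (Suc n) *\<^sub>R (x - x0)"]
    by (subst mult.commute) (auto intro!: mult_right_mono simp del: of_nat_Suc)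
  have 2: "\<bar>dir_deriv v (mollifier n (x0 :: 'a)) x\<bar> \<le> C * real (Suc n) ^ (DIM('a) + 1) * norm v" for n v x0 x
  proof -
    let ?c = "real (Suc n)"
    have "((\<lambda>x. mollifier 0 0 (?c *\<^sub>R (x - x0))) has_derivative
        (\<lambda>v. dir_deriv (?c *\<^sub>R v) (mollifier 0 0) (?c *\<^sub>R (x - x0)))) (at x)"
      by (rule has_derivative_compose[OF _ smooth_has_derivative[OF mollifier_smooth]])
        (auto intro!: derivative_eq_intros)
    then have "((\<lambda>x. ?c ^ DIM('a) * mollifier 0 0 (?c *\<^sub>R (x - x0))) has_derivative
        (\<lambda>v. ?c ^ DIM('a) * dir_deriv (?c *\<^sub>R v) (mollifier 0 0) (?c *\<^sub>R (x - x0)))) (at x)"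
      by (rule has_derivative_mult_right)
    then have "(mollifier n x0 has_derivative
        (\<lambda>v. ?c ^ DIM('a) * dir_deriv (?c *\<^sub>R v) (mollifier 0 0) (?c *\<^sub>R (x - x0)))) (at x)"
      by (subst ext[of "mollifier n x0", OF mollifier_scale])
    then have "dir_deriv v (mollifier n x0) x =
        ?c ^ DIM('a) * dir_deriv (?c *\<^sub>R v) (mollifier 0 0) (?c *\<^sub>R (x - x0))"
      unfolding dir_deriv_def[of v] by (simp only: frechet_derivative_at[symmetric])
    then have "\<bar>dir_deriv v (mollifier n x0) x\<bar> \<le> ?c ^ DIM('a) * (C * norm (?c *\<^sub>R v))"
      using C(3)[of "?c *\<^sub>R v" "?c *\<^sub>R (x - x0)"]
      by (simp add: abs_mult mult_left_mono del: of_nat_Suc norm_scaleR)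
    then show ?thesis
      by (simp add: mult_ac del: of_nat_Suc)
  qed
  show ?thesis
    by (rule that[OF C(1) 1 2])
qed

text \<open>The averages are over cubes with lower corner \<open>x\<close>, the cubes that carry the
  mollifiers based at \<open>x\<close>.\<close>

definition lebesgue_point :: "('a::euclidean_space \<Rightarrow> real) \<Rightarrow> 'a \<Rightarrow> bool"
  where "lebesgue_point u x \<longleftrightarrow>
    (\<lambda>n. real (Suc n) ^ DIM('a) * integral (corner_box n x) (\<lambda>z. \<bar>u z - u x\<bar>)) \<longlonglongrightarrow> 0"

lemma measure_corner_box: "measure lebesgue (corner_box n (x :: 'a::euclidean_space)) = (1 / real (Suc n)) ^ DIM('a)"
proof -
  have "x \<bullet> i \<le> (x + (1 / real (Suc n)) *\<^sub>R One) \<bullet> i" if "i \<in> Basis" for i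
    using that by (simp add: inner_add_left)
  then show ?thesis
    unfolding corner_box_def by (simp add: content_cbox inner_add_left)
qed

lemma corner_box_subset_cball: "corner_box n (x :: 'a::euclidean_space) \<subseteq> cball x (DIM('a) / real (Suc n))"
proof
  fix z assume "z \<in> corner_box n x"
  then have "\<bar>(z - x) \<bullet> b\<bar> \<le> 1 / real (Suc n)" if "b \<in> Basis" for b
    using that by (auto simp: corner_box_def mem_box inner_add_left inner_diff_left simp del: of_nat_Suc)
  then have "(\<Sum>b\<in>Basis. \<bar>(z - x) \<bullet> b\<bar>) \<le> (\<Sum>b\<in>(Basis :: 'a set). 1 / real (Suc n))"
    by (rule sum_mono)
  with norm_le_l1[of "z - x"] show "z \<in> cball x (DIM('a) / real (Suc n))"
    by (simp add: dist_norm norm_minus_commute del: of_nat_Suc)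
qed

lemma eventually_corner_box_subset:
  assumes "open S" "(x :: 'a::euclidean_space) \<in> S"
  shows "eventually (\<lambda>n. corner_box n x \<subseteq> S) sequentially"
proof -
  obtain e where e: "e > 0" "cball x e \<subseteq> S"
    using assms open_contains_cball by blast
  have "(\<lambda>n. DIM('a) * inverse (real (Suc n))) \<longlonglongrightarrow> real DIM('a) * 0"
    by (intro tendsto_intros LIMSEQ_inverse_real_of_nat)
  then have "eventually (\<lambda>n. DIM('a) * inverse (real (Suc n)) < e) sequentially"
    using e(1) by (intro order_tendstoD(2)) auto
  then show ?thesis
  proof eventually_elim
    case (elim n)
    then have "cball x (DIM('a) / real (Suc n)) \<subseteq> cball x e"
      by (intro subset_cball) (simp add: divide_inverse)
    with e(2) corner_box_subset_cball[of n x] show ?case by blast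
  qed
qed

text \<open>The differentiation theorem is applied to |u - q| for every rational q; the countably
  many exceptional sets form one null set, and off it u x is approximated by rationals.\<close>

lemma AE_lebesgue_point:
  fixes u :: "'a::euclidean_space \<Rightarrow> real"
  assumes u: "\<And>a b. u absolutely_integrable_on cbox a b"
  shows "AE x in lborel. lebesgue_point u x"
proof -
  let ?I = "\<lambda>n x. integral (corner_box n x) (\<lambda>z. \<bar>u z - u x\<bar>)"
  have absint: "(\<lambda>z. \<bar>u z - q\<bar>) integrable_on cbox a b" for q a b
  proof -
    have "(\<lambda>z. u z - q) absolutely_integrable_on cbox a b"
      using u absolutely_integrable_on_const[of "cbox a b" q] by (auto intro: set_integral_diff)
    then show ?thesis
      unfolding absolutely_integrable_on_def by simp
  qed
  have "\<exists>N. negligible N \<and> (\<forall>x e. x \<notin> N \<longrightarrow> 0 < e \<longrightarrow> (\<exists>d>0. \<forall>h. 0 < h \<and> h < d \<longrightarrow>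
      norm (integral (cbox x (x + h *\<^sub>R One)) (\<lambda>z. \<bar>u z - q\<bar>) /\<^sub>R h ^ DIM('a) - \<bar>u x - q\<bar>) < e))" for q
    using integrable_ccontinuous_explicit[of "\<lambda>z. \<bar>u z - q\<bar>"] absint by metis
  then obtain N where N: "\<And>q. negligible (N q)" "\<And>q x e. x \<notin> N q \<Longrightarrow> 0 < e \<Longrightarrow>
      \<exists>d>0. \<forall>h. 0 < h \<and> h < d \<longrightarrow>
      norm (integral (cbox x (x + h *\<^sub>R One)) (\<lambda>z. \<bar>u z - q\<bar>) /\<^sub>R h ^ DIM('a) - \<bar>u x - q\<bar>) < e"
    by metis
  have "negligible (\<Union>q\<in>\<rat>. N q)"
    using negligible_countable_Union[of "N ` \<rat>"] N(1) countable_rat by auto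
  moreover have "lebesgue_point u x" if x: "x \<notin> (\<Union>q\<in>\<rat>. N q)" for x
    unfolding lebesgue_point_def
  proof (rule LIMSEQ_I)
    fix e :: real assume e: "e > 0"
    \<comment> \<open>Three thirds of e: the error of the average of |u - q|, its limit |u x - q|,
      and |q - u x| once more from the triangle inequality.\<close>
    obtain q where q: "q \<in> \<rat>" "u x < q" "q < u x + e / 3"
      using Rats_dense_in_real[of "u x" "u x + e / 3"] e by auto
    obtain d where d: "d > 0" "\<And>h. 0 < h \<Longrightarrow> h < d \<Longrightarrow>
        norm (integral (cbox x (x + h *\<^sub>R One)) (\<lambda>z. \<bar>u z - q\<bar>) /\<^sub>R h ^ DIM('a) - \<bar>u x - q\<bar>) < e / 3"
      using N(2)[of x q "e / 3"] x q e by auto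
    obtain n0 where n0: "1 / real (Suc n0) < d"
      using nat_approx_posE[OF d(1)] by blast
    have "norm (real (Suc n) ^ DIM('a) * ?I n x - 0) < e"
      if "n \<ge> n0" for n
    proof -
      let ?h = "1 / real (Suc n)" and ?c = "real (Suc n) ^ DIM('a)"
      have cb: "corner_box n x = cbox x (x + ?h *\<^sub>R One)"
        by (simp add: corner_box_def)
      have c: "?c * a = a /\<^sub>R ?h ^ DIM('a)" for a
        by (simp add: field_simps power_divide del: of_nat_Suc)
      have hd: "?h < d"
        using n0 that by (smt (verit) divide_left_mono of_nat_0_less_iff of_nat_mono Suc_le_mono
            mult_pos_pos zero_less_Suc)
      have const: "(\<lambda>z. \<bar>q - u x\<bar>) integrable_on corner_box n x"
        unfolding corner_box_def by (rule integrable_const)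
      have intc: "integral (corner_box n x) (\<lambda>z. \<bar>q - u x\<bar>) = ?h ^ DIM('a) * \<bar>q - u x\<bar>"
        using measure_corner_box[of n x] unfolding corner_box_def by simp
      have "?I n x
          \<le> integral (corner_box n x) (\<lambda>z. \<bar>u z - q\<bar> + \<bar>q - u x\<bar>)"
        using absint const unfolding corner_box_def by (intro integral_le integrable_add) auto
      also have "\<dots> = integral (corner_box n x) (\<lambda>z. \<bar>u z - q\<bar>) + ?h ^ DIM('a) * \<bar>q - u x\<bar>"
        unfolding intc[symmetric] using absint const unfolding corner_box_def
        by (intro integral_add) auto
      finally have "?c * ?I n x
          \<le> ?c * (integral (corner_box n x) (\<lambda>z. \<bar>u z - q\<bar>) + ?h ^ DIM('a) * \<bar>q - u x\<bar>)"
        by (intro mult_left_mono) auto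
      also have "\<dots> = integral (corner_box n x) (\<lambda>z. \<bar>u z - q\<bar>) /\<^sub>R ?h ^ DIM('a) + \<bar>q - u x\<bar>"
        unfolding distrib_left c[of "integral (corner_box n x) (\<lambda>z. \<bar>u z - q\<bar>)"]
        by (simp add: power_divide del: of_nat_Suc)
      also have "\<dots> < e"
        using d(2)[of ?h] hd q(2,3) unfolding cb by (auto simp: abs_if split: if_splits)
      finally have "?c * ?I n x < e" .
      moreover have "0 \<le> ?c * ?I n x"
        using absint unfolding corner_box_def by (intro mult_nonneg_nonneg integral_nonneg) auto
      ultimately show ?thesis by simp
    qed
    then show "\<exists>no. \<forall>n\<ge>no. norm (real (Suc n) ^ DIM('a) *
        ?I n x - 0) < e"
      by blast
  qed
  ultimately show ?thesis
    using negligible_imp_AE by (metis (mono_tags, lifting) eventually_mono)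
qed

text \<open>A kernel of size C (n+1)^d on a cube of volume (n+1)^(-d) yields at most C times the
  mean deviation of \<open>u\<close> from its value at \<open>x\<close>. It is applied to the
  mollifier and to the commutator.\<close>

lemma lebesgue_point_kernel:
  fixes u :: "'a::euclidean_space \<Rightarrow> real"
  assumes u: "\<And>a b. u absolutely_integrable_on cbox a b" and x: "lebesgue_point u x"
    and k: "\<And>n z. \<bar>k n z\<bar> \<le> C * real (Suc n) ^ DIM('a)" "\<And>n z. z \<notin> corner_box n x \<Longrightarrow> k n z = 0"
  shows "(\<lambda>n. LINT z|lebesgue. (u z - u x) * k n z) \<longlonglongrightarrow> 0"
proof (rule Lim_null_comparison)
  let ?I = "\<lambda>n. integral (corner_box n x) (\<lambda>z. \<bar>u z - u x\<bar>)"
  have "0 \<le> C"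
    using order_trans[OF abs_ge_zero k(1)[of 0]] by simp
  have "norm (LINT z|lebesgue. (u z - u x) * k n z)
      \<le> C * (real (Suc n) ^ DIM('a) * ?I n)" for n
  proof -
    let ?B = "C * real (Suc n) ^ DIM('a)"
    have "(\<lambda>z. u z - u x) absolutely_integrable_on corner_box n x"
      unfolding corner_box_def using u absolutely_integrable_on_const
      by (auto intro!: set_integral_diff)
    then have ai: "(\<lambda>z. \<bar>u z - u x\<bar>) absolutely_integrable_on corner_box n x"
      by (rule set_integrable_abs)
    have "norm (LINT z|lebesgue. (u z - u x) * k n z) \<le> (LINT z|lebesgue. norm ((u z - u x) * k n z))"
      by (rule integral_norm_bound)
    also have "\<dots> \<le> (LINT z|lebesgue. ?B * (indicator (corner_box n x) z *\<^sub>R \<bar>u z - u x\<bar>))"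
    proof (rule integral_mono')
      show "integrable lebesgue (\<lambda>z. ?B * (indicator (corner_box n x) z *\<^sub>R \<bar>u z - u x\<bar>))"
        using ai unfolding set_integrable_def by simp
      show "norm ((u z - u x) * k n z) \<le> ?B * (indicator (corner_box n x) z *\<^sub>R \<bar>u z - u x\<bar>)" for z
        using mult_right_mono[OF k(1)[of n z], of "\<bar>u z - u x\<bar>"] k(2)[of z n]
        by (auto simp: indicator_def abs_mult mult.commute simp del: of_nat_Suc)
    qed (use \<open>0 \<le> C\<close> in auto)
    also have "\<dots> = ?B * (LINT z:corner_box n x|lebesgue. \<bar>u z - u x\<bar>)"
      by (simp add: set_lebesgue_integral_def)
    also have "\<dots> = ?B * ?I n"
      by (simp only: set_lebesgue_integral_eq_integral(2)[OF ai])
    finally show ?thesis by (simp add: mult.assoc)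
  qed
  then show "eventually (\<lambda>n. norm (LINT z|lebesgue. (u z - u x) * k n z)
      \<le> C * (real (Suc n) ^ DIM('a) * ?I n)) sequentially"
    by simp
  show "(\<lambda>n. C * (real (Suc n) ^ DIM('a) * ?I n)) \<longlonglongrightarrow> 0"
    using x unfolding lebesgue_point_def by (rule tendsto_mult_right_zero)
qed

lemma mollifier_measurable: "mollifier n x0 \<in> borel_measurable borel"
  by (rule smooth_measurable[OF mollifier_smooth])

lemma integrable_mult_bounded_compact:
  fixes u k :: "'a::euclidean_space \<Rightarrow> real"
  assumes "u absolutely_integrable_on K" "K \<in> sets borel" "k \<in> borel_measurable borel"
    and "\<And>z. \<bar>k z\<bar> \<le> B" "\<And>z. z \<notin> K \<Longrightarrow> k z = 0"
  shows "integrable lebesgue (\<lambda>z. u z * k z)"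
proof -
  have "integrable lebesgue (\<lambda>z. B * (indicator K z *\<^sub>R u z))"
    using assms(1) unfolding set_integrable_def by simp
  moreover have "(\<lambda>z. (indicator K z *\<^sub>R u z) * k z) \<in> borel_measurable lebesgue"
    using assms(1,3) unfolding set_integrable_def
    by (intro borel_measurable_times) (auto simp: measurable_completion)
  ultimately have "integrable lebesgue (\<lambda>z. (indicator K z *\<^sub>R u z) * k z)"
    by (rule Bochner_Integration.integrable_bound)
      (use order_trans[OF abs_ge_zero assms(4)] assms(4) in
        \<open>auto intro!: AE_I2 mult_right_mono simp: abs_mult mult.commute[of B] indicator_def mult_left_mono\<close>)
  moreover have "(indicator K z *\<^sub>R u z) * k z = u z * k z" for z
    using assms(5)[of z] by (auto simp: indicator_def)
  ultimately show ?thesis by (simp only:)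
qed

text \<open>Total mass 1 turns the integral into u x plus an integral of the deviation u z - u
  x.\<close>

lemma mollifier_lebesgue_point:
  fixes u :: "'a::euclidean_space \<Rightarrow> real"
  assumes u: "\<And>a b. u absolutely_integrable_on cbox a b" and x: "lebesgue_point u x"
  shows "(\<lambda>n. LINT z|lebesgue. u z * mollifier n x z) \<longlonglongrightarrow> u x"
proof -
  obtain C where C: "\<And>n x0 x. \<bar>mollifier n (x0 :: 'a) x\<bar> \<le> C * real (Suc n) ^ DIM('a)"
    using mollifier_bounds by metis
  have eq: "(LINT z|lebesgue. u z * mollifier n x z) = (LINT z|lebesgue. (u z - u x) * mollifier n x z) + u x" for n
  proof -
    have "integrable lebesgue (\<lambda>z. (u z - u x) * mollifier n x z)"
      by (rule integrable_mult_bounded_compact[where K="corner_box n x", OF _ _ mollifier_measurable C])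
        (use u absolutely_integrable_on_const in \<open>auto simp: corner_box_def mollifier_zero intro!: set_integral_diff\<close>)
    moreover have "integrable lebesgue (\<lambda>z. u x * mollifier n x z)"
      by (rule integrable_mult_bounded_compact[where K="corner_box n x", OF _ _ mollifier_measurable C])
        (use absolutely_integrable_on_const in \<open>auto simp: corner_box_def mollifier_zero\<close>)
    ultimately have "(LINT z|lebesgue. (u z - u x) * mollifier n x z + u x * mollifier n x z) =
        (LINT z|lebesgue. (u z - u x) * mollifier n x z) + (LINT z|lebesgue. u x * mollifier n x z)"
      by (rule Bochner_Integration.integral_add)
    moreover have "(LINT z|lebesgue. mollifier n x z) = 1"
      using mollifier_measurable[of n x] by (simp add: integral_completion integral_mollifier)
    ultimately show ?thesis
      by (simp add: algebra_simps)
  qed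
  have "(\<lambda>n. LINT z|lebesgue. (u z - u x) * mollifier n x z) \<longlonglongrightarrow> 0"
    by (rule lebesgue_point_kernel[OF u x C mollifier_zero])
  then show ?thesis
    unfolding eq using tendsto_add[OF _ tendsto_const[of "u x"]] by force
qed

text \<open>The fundamental lemma of the calculus of variations: small mollifiers are test
  functions, so at a Lebesgue point the value of \<open>u\<close> is a limit of zeros.\<close>

lemma AE_zero_of_test_functions:
  fixes u :: "'a::euclidean_space \<Rightarrow> real"
  assumes \<omega>: "open \<omega>" and u: "loc_integrable_on u \<omega>"
    and z: "\<And>\<phi>. \<phi> \<in> test_functions \<omega> \<Longrightarrow> (LINT x:\<omega>|lebesgue. u x * \<phi> x) = 0"
  shows "AE x in lborel. x \<in> \<omega> \<longrightarrow> u x = 0"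
proof (rule AE_local_to_global)
  fix p assume "p \<in> \<omega>"
  then obtain r where r: "r > 0" "cball p r \<subseteq> \<omega>"
    using \<omega> open_contains_cball by blast
  \<comment> \<open>The cut-off is integrable on every box, as the Lebesgue point lemmas demand, and
    leaves the integrals against mollifiers supported in the ball unchanged.\<close>
  define U where "U z = indicator (cball p r) z * u z" for z
  have U: "U absolutely_integrable_on cbox a b" for a b
  proof -
    have "compact (cball p r \<inter> cbox a b)" "cball p r \<inter> cbox a b \<subseteq> \<omega>"
      using r(2) by (auto intro: compact_Int_closed)
    then have "u absolutely_integrable_on (cball p r \<inter> cbox a b)"
      using u unfolding loc_integrable_on_def by blast
    then show ?thesis
      unfolding set_integrable_def U_def by (simp add: indicator_inter_arith mult_ac)
  qed
  have "AE x in lborel. x \<in> ball p r \<longrightarrow> u x = 0"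
    using AE_lebesgue_point[OF U]
  proof eventually_elim
    case (elim x)
    show ?case
    proof
      assume x: "x \<in> ball p r"
      have "eventually (\<lambda>n. (LINT z|lebesgue. U z * mollifier n x z) = 0) sequentially"
        using eventually_corner_box_subset[OF open_ball x]
      proof eventually_elim
        case (elim n)
        then have s: "corner_box n x \<subseteq> ball p r" "corner_box n x \<subseteq> \<omega>"
          using r(2) ball_subset_cball by blast+
        have "U z * mollifier n x z = indicator \<omega> z *\<^sub>R (u z * mollifier n x z)" for z
          using subsetD[OF s(1), of z] subsetD[OF s(2), of z] mollifier_zero[of z n x]
            ball_subset_cball[of p r]
          by (cases "z \<in> corner_box n x") (auto simp: U_def)
        then have "(LINT z|lebesgue. U z * mollifier n x z) = (LINT z:\<omega>|lebesgue. u z * mollifier n x z)"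
          unfolding set_lebesgue_integral_def by (simp only:)
        then show ?case
          using z[OF mollifier_test_function[OF s(2)]] by simp
      qed
      then have "(\<lambda>n. LINT z|lebesgue. U z * mollifier n x z) \<longlonglongrightarrow> 0"
        by (rule tendsto_eventually)
      with mollifier_lebesgue_point[OF U elim] have "U x = 0"
        using LIMSEQ_unique by blast
      with x show "u x = 0"
        by (simp add: U_def)
    qed
  qed
  with r(1) show "\<exists>r>0. AE x in lborel. x \<in> ball p r \<longrightarrow> u x = 0"
    by blast
qed

section \<open>Weak derivatives of locally Lipschitz functions\<close>

lemma locally_lipschitz_continuous_on:
  assumes "open \<omega>" "locally_lipschitz_on \<omega> f"
  shows "continuous_on \<omega> f"
proof (rule continuous_at_imp_continuous_on, rule ballI)
  fix x assume "x \<in> \<omega>"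
  then obtain r L where "r > 0" "L-lipschitz_on (ball x r \<inter> \<omega>) f"
    using assms unfolding locally_lipschitz_on_def by blast
  with assms(1) \<open>x \<in> \<omega>\<close> show "isCont f x"
    using continuous_on_interior[OF lipschitz_on_continuous_on, of L "ball x r \<inter> \<omega>" f x]
    by (simp add: interior_open open_Int)
qed

lemma locally_lipschitz_near_compact:
  fixes f :: "'a::euclidean_space \<Rightarrow> real"
  assumes "open \<omega>" "locally_lipschitz_on \<omega> f" "compact K" "K \<subseteq> \<omega>"
  obtains e L where "e > 0" "(\<Union>x\<in>K. cball x e) \<subseteq> \<omega>" "compact (\<Union>x\<in>K. cball x e)"
    "L-lipschitz_on (\<Union>x\<in>K. cball x e) f"
proof -
  obtain e where e: "e > 0" "(\<Union>x\<in>K. cball x e) \<subseteq> \<omega>"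
    using compact_subset_open_imp_cball_epsilon_subset assms(1,3,4) by metis
  let ?K = "\<Union>x\<in>K. cball x e"
  \<comment> \<open>The closed neighbourhood is the Minkowski sum of two compact sets, hence
    compact.\<close>
  have "(\<Union>x\<in>K. \<Union>y\<in>cball 0 e. {x + y}) = ?K"
  proof -
    have "(\<Union>y\<in>cball 0 e. {x + y}) = cball x e" for x :: 'a
      using image_add_cball[of x 0 e] by (simp add: UNION_singleton_eq_range)
    then show ?thesis by simp
  qed
  then have c: "compact ?K"
    using compact_sums'[OF assms(3) compact_cball[of 0 e]] by simp
  \<comment> \<open>The time set {0} is a dummy: in this form compactness yields one Lipschitz
    constant for the whole neighbourhood.\<close>
  have "local_lipschitz {0::real} ?K (\<lambda>_. f)"
  proof (rule local_lipschitzI)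
    fix x assume "x \<in> ?K"
    with e obtain r L where rL: "r > 0" "L-lipschitz_on (ball x r \<inter> \<omega>) f"
      using assms(2) unfolding locally_lipschitz_on_def by blast
    have "cball x (r / 2) \<inter> ?K \<subseteq> ball x r \<inter> \<omega>"
      using e(2) rL(1) by auto
    with rL have "L-lipschitz_on (cball x (r / 2) \<inter> ?K) f"
      by (meson lipschitz_on_subset)
    with rL(1) show "\<exists>u>0. \<exists>L. \<forall>t\<in>cball t u \<inter> {0::real}. L-lipschitz_on (cball x u \<inter> ?K) f" for t
      by (meson half_gt_zero)
  qed
  then obtain L where "L-lipschitz_on ?K f"
    by (rule local_lipschitz_compact_implies_lipschitz) (use c in auto)
  with e c that show ?thesis by blast
qed

lemma diff_quot_has_real_derivative:
  assumes "(F has_real_derivative D) (at x)"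
  shows "(\<lambda>n. diff_quot 1 F n x) \<longlonglongrightarrow> D"
proof -
  have "((\<lambda>h. (F (x + h) - F x) / h) \<longlongrightarrow> D) (at 0)"
    using assms by (simp add: DERIV_def)
  moreover have "filterlim (\<lambda>n. 1 / real (Suc n)) (at 0) sequentially"
    unfolding filterlim_at using LIMSEQ_inverse_real_of_nat by (auto simp: inverse_eq_divide)
  ultimately have "(\<lambda>n. (F (x + 1 / real (Suc n)) - F x) / (1 / real (Suc n))) \<longlonglongrightarrow> D"
    by (rule filterlim_compose)
  then show ?thesis
    by (simp add: diff_quot_def mult.commute del: of_nat_Suc)
qed

lemma diff_quot_smooth_tendsto:
  assumes "smooth \<phi>"
  shows "(\<lambda>n. diff_quot v \<phi> n x) \<longlonglongrightarrow> dir_deriv v \<phi> x"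
proof -
  interpret bounded_linear "\<lambda>v. dir_deriv v \<phi> x"
    using smooth_has_derivative[OF assms] by (rule has_derivative_bounded_linear)
  have "((\<lambda>h. \<phi> (x + h *\<^sub>R v)) has_derivative (\<lambda>h. dir_deriv (h *\<^sub>R v) \<phi> x)) (at 0)"
    by (rule has_derivative_compose[where x="0::real" and f="\<lambda>h. x + h *\<^sub>R v"])
      (auto intro!: derivative_eq_intros smooth_has_derivative[OF assms])
  then have "((\<lambda>h. \<phi> (x + h *\<^sub>R v)) has_real_derivative dir_deriv v \<phi> x) (at 0)"
    by (simp add: has_field_derivative_def scaleR mult.commute[of _ "dir_deriv v \<phi> x"])
  from diff_quot_has_real_derivative[OF this] show ?thesis
    by (simp add: diff_quot_def del: of_nat_Suc)
qed

lemma lborel_integral_translate: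
  fixes h :: "'a::euclidean_space \<Rightarrow> real"
  assumes [measurable]: "h \<in> borel_measurable borel"
  shows "(\<integral>x. h (x + c) \<partial>lborel) = (\<integral>x. h x \<partial>lborel)"
proof -
  have "(\<integral>x. h x \<partial>lborel) = (\<integral>x. h x \<partial>distr lborel borel ((+) c))"
    by (simp add: lborel_distr_plus)
  also have "\<dots> = (\<integral>x. h (c + x) \<partial>lborel)"
    by (rule integral_distr) auto
  finally show ?thesis
    by (simp add: add.commute)
qed

lemma integrable_bounded_compact:
  fixes u :: "'a::euclidean_space \<Rightarrow> real"
  assumes "u \<in> borel_measurable borel" "compact K"
    "\<And>x. x \<in> K \<Longrightarrow> \<bar>u x\<bar> \<le> B" "\<And>x. x \<notin> K \<Longrightarrow> u x = 0"
  shows "integrable lborel u"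
  by (rule integrableI_bounded_set[where A=K and B=B])
    (use assms emeasure_bounded_finite[OF compact_imp_bounded[OF assms(2)]] in \<open>auto simp: compact_imp_closed\<close>)

lemma absolutely_integrable_bounded_compact:
  fixes u :: "'a::euclidean_space \<Rightarrow> real"
  assumes "u \<in> borel_measurable borel" "compact K" "\<And>x. x \<in> K \<Longrightarrow> \<bar>u x\<bar> \<le> B"
  shows "u absolutely_integrable_on K"
proof -
  have "K \<in> sets borel"
    using assms(2) by (simp add: compact_imp_closed)
  with assms(1) have m: "(\<lambda>x. indicator K x *\<^sub>R u x) \<in> borel_measurable borel"
    by simp
  have "integrable lborel (\<lambda>x. indicator K x *\<^sub>R u x)"
    by (rule integrable_bounded_compact[OF m assms(2), of B]) (use assms(3) in auto)
  with m show ?thesis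
    by (simp add: set_integrable_def integrable_completion)
qed

lemma weak_deriv_cong:
  assumes "weak_deriv \<omega> v f g" "\<And>x. x \<in> \<omega> \<Longrightarrow> f x = f' x" "\<And>x. x \<in> \<omega> \<Longrightarrow> g x = g' x"
  shows "weak_deriv \<omega> v f' g'"
proof -
  have *: "loc_integrable_on h' \<omega>" if "loc_integrable_on h \<omega>" "\<And>x. x \<in> \<omega> \<Longrightarrow> h x = h' x" for h h' :: "'a \<Rightarrow> real"
    unfolding loc_integrable_on_def
  proof (intro allI impI)
    fix K assume K: "compact K \<and> K \<subseteq> \<omega>"
    have "h absolutely_integrable_on K"
      using that(1) K unfolding loc_integrable_on_def by blast
    then show "h' absolutely_integrable_on K"
      by (rule absolutely_integrable_spike[of _ _ "{}"]) (use K that(2) in auto)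
  qed
  have **: "(LINT x:\<omega>|lebesgue. h x * k x) = (LINT x:\<omega>|lebesgue. h' x * k x)"
    if "\<And>x. x \<in> \<omega> \<Longrightarrow> h x = h' x" for h h' k :: "'a \<Rightarrow> real"
    unfolding set_lebesgue_integral_def
    by (rule Bochner_Integration.integral_cong) (use that in \<open>auto simp: indicator_def\<close>)
  have "loc_integrable_on f' \<omega>" "loc_integrable_on g' \<omega>"
    using assms(1) by (auto simp: weak_deriv_def intro: *[of f f'] *[of g g'] assms(2,3))
  then show ?thesis
    using assms(1) **[of f f', OF assms(2)] **[of g g', OF assms(3)] by (simp add: weak_deriv_def)
qed

lemma LINT_restrict:
  fixes u k :: "'a::euclidean_space \<Rightarrow> real"
  assumes "u \<in> borel_measurable borel" "k \<in> borel_measurable borel" "\<And>x. x \<notin> \<omega> \<Longrightarrow> k x = 0"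
  shows "(LINT x:\<omega>|lebesgue. u x * k x) = (\<integral>x. u x * k x \<partial>lborel)"
proof -
  have "(\<lambda>x. indicator \<omega> x *\<^sub>R (u x * k x)) = (\<lambda>x. u x * k x)"
    using assms(3) by (force simp: indicator_def)
  then show ?thesis
    using assms(1,2) by (simp add: set_lebesgue_integral_def integral_completion)
qed

lemma dir_deriv_measurable: "smooth \<phi> \<Longrightarrow> dir_deriv v \<phi> \<in> borel_measurable borel"
  by (intro smooth_measurable smooth_dir_deriv)

text \<open>Supplies the dominating constants: one M for \<open>f\<close> near K, for its difference
  quotients whose step has length at most e, and for their limits.\<close>

lemma locally_lipschitz_bounds:
  fixes f :: "'a::euclidean_space \<Rightarrow> real"
  assumes \<omega>: "open \<omega>" and f: "locally_lipschitz_on \<omega> f" and K: "compact K" "K \<subseteq> \<omega>"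
  obtains e M where "e > 0" "M \<ge> 0" "(\<Union>x\<in>K. cball x e) \<subseteq> \<omega>" "compact (\<Union>x\<in>K. cball x e)"
    "\<And>x. x \<in> (\<Union>x\<in>K. cball x e) \<Longrightarrow> \<bar>f x\<bar> \<le> M" "\<And>x. x \<in> K \<Longrightarrow> \<bar>quot_deriv v f x\<bar> \<le> M"
    "\<And>x n. x \<in> K \<Longrightarrow> norm v / real (Suc n) \<le> e \<Longrightarrow> \<bar>diff_quot v f n x\<bar> \<le> M"
proof -
  obtain e L where e: "e > 0" "(\<Union>x\<in>K. cball x e) \<subseteq> \<omega>" "compact (\<Union>x\<in>K. cball x e)"
      "L-lipschitz_on (\<Union>x\<in>K. cball x e) f"
    by (rule locally_lipschitz_near_compact[OF \<omega> f K])
  have "bounded (f ` (\<Union>x\<in>K. cball x e))"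
    by (intro compact_imp_bounded compact_continuous_image lipschitz_on_continuous_on[OF e(4)] e(3))
  then obtain M0 where M0: "\<And>x. x \<in> (\<Union>x\<in>K. cball x e) \<Longrightarrow> \<bar>f x\<bar> \<le> M0"
    unfolding bounded_iff by (metis imageI real_norm_def)
  have L0: "0 \<le> L" using lipschitz_on_nonneg[OF e(4)] .
  define M where "M = max M0 (L * norm v)"
  have M: "M0 \<le> M" "L * norm v \<le> M" "0 \<le> M"
    using L0 by (auto simp: M_def le_max_iff_disj)
  have "\<bar>quot_deriv v f x\<bar> \<le> M" if "x \<in> K" for x
  proof -
    have "L-lipschitz_on (ball x e) f"
      by (rule lipschitz_on_subset[OF e(4)]) (use that in force)
    from quot_deriv_bound[OF this open_ball, of x v] e(1) M(2) show ?thesis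
      by simp
  qed
  moreover have "\<bar>diff_quot v f n x\<bar> \<le> M" if "x \<in> K" "norm v / real (Suc n) \<le> e" for n x
  proof -
    have "x \<in> (\<Union>x\<in>K. cball x e)" "x + (1 / real (Suc n)) *\<^sub>R v \<in> (\<Union>x\<in>K. cball x e)"
      using that e(1) by (auto simp: dist_norm intro!: bexI[of _ x] simp del: of_nat_Suc)
    from diff_quot_bound[OF e(4) this] M(2) show ?thesis
      by simp
  qed
  moreover have "\<bar>f x\<bar> \<le> M" if "x \<in> (\<Union>x\<in>K. cball x e)" for x
    using M0[OF that] M(1) by simp
  ultimately show ?thesis
    using that[OF e(1) M(3) e(2,3)] by blast
qed

text \<open>Discrete integration by parts: translation invariance moves the difference quotient from
  the test function to \<open>f\<close>, and dominated convergence passes to the limit on both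
  sides.\<close>

lemma weak_deriv_quot_deriv_borel:
  fixes f :: "'a::euclidean_space \<Rightarrow> real"
  assumes fm[measurable]: "f \<in> borel_measurable borel" and \<omega>: "open \<omega>" and f: "locally_lipschitz_on \<omega> f"
    and ae: "AE x in lborel. x \<in> \<omega> \<longrightarrow> convergent (\<lambda>n. diff_quot v f n x)"
  shows "weak_deriv \<omega> v f (quot_deriv v f)"
proof -
  note qm[measurable] = quot_deriv_measurable[OF fm, of v]
  have li: "loc_integrable_on f \<omega>" "loc_integrable_on (quot_deriv v f) \<omega>"
    unfolding loc_integrable_on_def
  proof (safe)
    fix K assume K: "compact K" "K \<subseteq> \<omega>"
    obtain e M where eM: "e > 0" "\<And>x. x\<in>(\<Union>x\<in>K. cball x e) \<Longrightarrow> \<bar>f x\<bar> \<le> M"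
        "\<And>x. x \<in> K \<Longrightarrow> \<bar>quot_deriv v f x\<bar> \<le> M"
      by (rule locally_lipschitz_bounds[OF \<omega> f K, of v]) blast
    have "\<bar>f x\<bar> \<le> M" if "x \<in> K" for x
      by (rule eM(2)) (use that eM(1) in force)
    then show "f absolutely_integrable_on K"
      by (rule absolutely_integrable_bounded_compact[OF fm K(1)])
    show "quot_deriv v f absolutely_integrable_on K"
      by (rule absolutely_integrable_bounded_compact[OF qm K(1) eM(3)])
  qed
  have "(LINT x:\<omega>|lebesgue. f x * dir_deriv v \<phi> x) = - (LINT x:\<omega>|lebesgue. quot_deriv v f x * \<phi> x)"
    if \<phi>t: "\<phi> \<in> test_functions \<omega>" for \<phi>
  proof -
    note \<phi> = test_functionsD[OF \<phi>t]
    have [measurable]: "\<phi> \<in> borel_measurable borel" "dir_deriv v \<phi> \<in> borel_measurable borel"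
      using \<phi>(1) by (auto intro: smooth_measurable dir_deriv_measurable)
    obtain C where C: "C \<ge> 0" "\<And>x. \<bar>\<phi> x\<bar> \<le> C" "C-lipschitz_on UNIV \<phi>"
      by (rule test_function_bounds[OF \<phi>t]) blast
    obtain e M where eM: "e > 0" "M \<ge> 0" "compact (\<Union>x\<in>spt \<phi>. cball x e)"
        "\<And>x. x\<in>(\<Union>x\<in>spt \<phi>. cball x e) \<Longrightarrow> \<bar>f x\<bar> \<le> M"
        "\<And>x n. x \<in> spt \<phi> \<Longrightarrow> norm v / real (Suc n) \<le> e \<Longrightarrow> \<bar>diff_quot v f n x\<bar> \<le> M"
      by (rule locally_lipschitz_bounds[OF \<omega> f \<phi>(2,3), of v]) blast
    define K where "K = (\<Union>x\<in>spt \<phi>. cball x e)"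
    have sK: "spt \<phi> \<subseteq> K"
      using eM(1) by (auto simp: K_def)
    have K[measurable]: "K \<in> sets borel"
      using eM(3) by (simp add: K_def compact_imp_closed)
    have fK: "\<bar>f x\<bar> \<le> M" if "x \<in> K" for x
      using eM(4) that by (simp add: K_def)
    \<comment> \<open>From this index on the steps have length at most e, so the translated supports
      stay in the neighbourhood where \<open>f\<close> is bounded.\<close>
    obtain n0 where n0: "norm v / real (Suc n0) < e"
    proof -
      have "(\<lambda>n. norm v * inverse (real (Suc n))) \<longlonglongrightarrow> norm v * 0"
        by (intro tendsto_intros LIMSEQ_inverse_real_of_nat)
      then have "eventually (\<lambda>n. norm v * inverse (real (Suc n)) < e) sequentially"
        using eM(1) by (intro order_tendstoD(2)) auto
      then show ?thesis
        using that by (auto simp: eventually_sequentially divide_inverse)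
    qed
    define w where "w n = (1 / real (Suc (n + n0))) *\<^sub>R v" for n
    have hn: "norm v / real (Suc (n + n0)) \<le> e" for n
    proof -
      have "norm v / real (Suc (n + n0)) \<le> norm v / real (Suc n0)"
        by (intro divide_left_mono) auto
      with n0 show ?thesis by linarith
    qed
    have wn: "norm (w n) \<le> e" for n
      using hn[of n] by (simp add: w_def del: of_nat_Suc)
    let ?c = "\<lambda>n. real (Suc (n + n0))"
    let ?l = "\<lambda>n x. f x * (?c n * (\<phi> x - \<phi> (x - w n)))" and ?r = "\<lambda>n x. diff_quot v f (n + n0) x * \<phi> x"
    have \<phi>0: "\<phi> (x - w n) = 0" if "x \<notin> K" for x n
    proof -
      have "x - w n \<notin> spt \<phi>"
        using that wn[of n] by (force simp: K_def dist_norm norm_minus_commute)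
      then show ?thesis by (rule not_in_spt_zero)
    qed
    have \<phi>1: "\<phi> x = 0" if "x \<notin> K" for x
      using that sK not_in_spt_zero by blast
    have fin: "emeasure lborel K < \<infinity>"
      using emeasure_bounded_finite[OF compact_imp_bounded[OF eM(3)]] by (simp add: K_def)
    have i1: "integrable lborel (\<lambda>x. f x * \<phi> x)"
      by (rule integrable_bounded_compact[of _ K "M * C"])
        (use eM(2,3) C fK \<phi>1 in \<open>auto simp: K_def[symmetric] abs_mult intro!: mult_mono\<close>)
    have i2: "integrable lborel (\<lambda>x. f x * \<phi> (x - w n))" for n
      by (rule integrable_bounded_compact[of _ K "M * C"])
        (use eM(2,3) C fK \<phi>0 in \<open>auto simp: K_def[symmetric] abs_mult intro!: mult_mono\<close>)
    have i3: "integrable lborel (\<lambda>x. f (x + w n) * \<phi> x)" for n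
    proof (rule integrable_bounded_compact[of _ K "M * C"])
      fix x
      show "\<bar>f (x + w n) * \<phi> x\<bar> \<le> M * C"
      proof (cases "x \<in> spt \<phi>")
        case True
        then have "x + w n \<in> K"
          using wn[of n] by (auto simp: K_def dist_norm intro!: bexI[of _ x])
        then show ?thesis
          using fK C eM(2) by (auto simp: abs_mult intro!: mult_mono)
      qed (use not_in_spt_zero[of x \<phi>] eM(2) C(1) in auto)
    qed (use eM(3) \<phi>1 in \<open>auto simp: K_def[symmetric]\<close>)
    have eq: "(\<integral>x. ?l n x \<partial>lborel)
        = - (\<integral>x. ?r n x \<partial>lborel)" for n
    proof -
      have "(\<integral>x. ?l n x \<partial>lborel)
          = (\<integral>x. ?c n * (f x * \<phi> x - f x * \<phi> (x - w n)) \<partial>lborel)"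
        by (simp only: algebra_simps)
      also have "\<dots> = ?c n * ((\<integral>x. f x * \<phi> x \<partial>lborel) - (\<integral>x. f x * \<phi> (x - w n) \<partial>lborel))"
        by (simp add: Bochner_Integration.integral_diff[OF i1 i2] del: of_nat_Suc)
      also have "(\<integral>x. f x * \<phi> (x - w n) \<partial>lborel) = (\<integral>x. f (x + w n) * \<phi> x \<partial>lborel)"
        using lborel_integral_translate[of "\<lambda>x. f x * \<phi> (x - w n)" "w n"] by simp
      also have "?c n * ((\<integral>x. f x * \<phi> x \<partial>lborel) - (\<integral>x. f (x + w n) * \<phi> x \<partial>lborel))
          = - (\<integral>x. ?c n * (f (x + w n) * \<phi> x - f x * \<phi> x) \<partial>lborel)"
        by (simp add: Bochner_Integration.integral_diff[OF i3 i1] del: of_nat_Suc)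
          (simp only: right_diff_distrib minus_diff_eq)
      also have "(\<integral>x. ?c n * (f (x + w n) * \<phi> x - f x * \<phi> x) \<partial>lborel)
          = (\<integral>x. ?r n x \<partial>lborel)"
        by (rule Bochner_Integration.integral_cong)
          (auto simp: diff_quot_def w_def algebra_simps simp del: of_nat_Suc)
      finally show ?thesis .
    qed
    have lim1: "(\<lambda>n. \<integral>x. ?l n x \<partial>lborel) \<longlonglongrightarrow> (\<integral>x. f x * dir_deriv v \<phi> x \<partial>lborel)"
    proof (rule integral_dominated_convergence[where w="\<lambda>x. indicator K x * (M * (C * norm v))"])
      \<comment> \<open>A backward difference is minus the forward difference in direction - v; the
        two signs cancel in the limit.\<close>
      have q: "?c n * (\<phi> x - \<phi> (x - w n)) = - diff_quot (- v) \<phi> (n + n0) x" for n x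
        by (simp add: diff_quot_def w_def algebra_simps del: of_nat_Suc)
      show "integrable lborel (\<lambda>x. indicator K x * (M * (C * norm v)))"
        using fin by simp
      have "(\<lambda>n. ?c n * (\<phi> x - \<phi> (x - w n))) \<longlonglongrightarrow> dir_deriv v \<phi> x" for x
      proof -
        have "linear (\<lambda>v. dir_deriv v \<phi> x)"
          using smooth_has_derivative[OF \<phi>(1)] by (rule has_derivative_linear)
        note minus = linear_neg[OF this]
        have "(\<lambda>n. - diff_quot (- v) \<phi> (n + n0) x) \<longlonglongrightarrow> - dir_deriv (- v) \<phi> x"
          by (intro tendsto_minus LIMSEQ_ignore_initial_segment diff_quot_smooth_tendsto \<phi>(1))
        then show ?thesis
          unfolding q by (simp add: minus)
      qed
      then show "AE x in lborel. (\<lambda>n. ?l n x) \<longlonglongrightarrow> f x * dir_deriv v \<phi> x"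
        by (intro AE_I2 tendsto_mult_left)
      show "AE x in lborel. norm (?l n x) \<le> indicator K x * (M * (C * norm v))" for n
      proof (rule AE_I2)
        fix x
        have "\<bar>?c n * (\<phi> x - \<phi> (x - w n))\<bar> \<le> C * norm v"
          unfolding q using diff_quot_bound[OF C(3), of x "n + n0" "- v"] by simp
        then show "norm (?l n x) \<le> indicator K x * (M * (C * norm v))"
          using fK[of x] \<phi>0[of x n] \<phi>1[of x] eM(2)
          by (cases "x \<in> K") (auto simp: abs_mult intro!: mult_mono)
      qed
    qed auto
    have lim2: "(\<lambda>n. \<integral>x. ?r n x \<partial>lborel) \<longlonglongrightarrow> (\<integral>x. quot_deriv v f x * \<phi> x \<partial>lborel)"
    proof (rule integral_dominated_convergence[where w="\<lambda>x. indicator K x * (M * C)"])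
      have [measurable]: "diff_quot v f n \<in> borel_measurable borel" for n
        by (rule diff_quot_measurable[OF fm])
      show "(\<lambda>x. quot_deriv v f x * \<phi> x) \<in> borel_measurable lborel"
        "(\<lambda>x. ?r n x) \<in> borel_measurable lborel" for n
        by auto
      show "integrable lborel (\<lambda>x. indicator K x * (M * C))"
        using fin by simp
      show "AE x in lborel. (\<lambda>n. ?r n x) \<longlonglongrightarrow> quot_deriv v f x * \<phi> x"
        using ae
      proof eventually_elim
        case (elim x)
        show ?case
        proof (cases "x \<in> spt \<phi>")
          case True
          with elim \<phi>(3) show ?thesis
            by (intro tendsto_mult_right LIMSEQ_ignore_initial_segment tendsto_quot_deriv) auto
        qed (use not_in_spt_zero[of x \<phi>] in auto)
      qed
      show "AE x in lborel. norm (?r n x) \<le> indicator K x * (M * C)" for n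
      proof (rule AE_I2)
        fix x
        show "norm (?r n x) \<le> indicator K x * (M * C)"
        proof (cases "x \<in> spt \<phi>")
          case True
          then have "x \<in> K" using sK by blast
          with eM(5)[OF True hn[of n]] C(2)[of x] eM(2) show ?thesis
            by (auto simp: abs_mult intro!: mult_mono)
        qed (use not_in_spt_zero[of x \<phi>] eM(2) C(1) in auto)
      qed
    qed
    have "(\<integral>x. f x * dir_deriv v \<phi> x \<partial>lborel) = - (\<integral>x. quot_deriv v f x * \<phi> x \<partial>lborel)"
      using LIMSEQ_unique[OF lim1[unfolded eq] tendsto_minus[OF lim2]] .
    moreover have "\<phi> x = 0" "dir_deriv v \<phi> x = 0" if "x \<notin> \<omega>" for x
      using that \<phi>(3) not_in_spt_zero dir_deriv_zero_outside_spt by blast+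
    ultimately show ?thesis
      by (simp add: LINT_restrict)
  qed
  with li show ?thesis
    unfolding weak_deriv_def by blast
qed

text \<open>The difference of two weak derivatives annihilates every test function.\<close>

lemma weak_deriv_unique:
  assumes \<omega>: "open \<omega>" and g: "weak_deriv \<omega> v f g" and g': "weak_deriv \<omega> v f g'"
  shows "AE x in lborel. x \<in> \<omega> \<longrightarrow> g x = g' x"
proof -
  have li: "loc_integrable_on g \<omega>" "loc_integrable_on g' \<omega>"
    using g g' by (auto simp: weak_deriv_def)
  then have "loc_integrable_on (\<lambda>x. g x - g' x) \<omega>"
    unfolding loc_integrable_on_def by (auto intro: set_integral_diff)
  moreover have "(LINT x:\<omega>|lebesgue. (g x - g' x) * \<phi> x) = 0" if \<phi>t: "\<phi> \<in> test_functions \<omega>" for \<phi>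
  proof -
    note \<phi> = test_functionsD[OF \<phi>t]
    obtain C where C: "\<And>x. \<bar>\<phi> x\<bar> \<le> C"
      by (rule test_function_bounds[OF \<phi>t]) blast
    have int: "integrable lebesgue (\<lambda>x. h x * \<phi> x)" if "loc_integrable_on h \<omega>" for h
      using that \<phi> not_in_spt_zero unfolding loc_integrable_on_def
      by (intro integrable_mult_bounded_compact[where K="spt \<phi>" and B=C] C smooth_measurable)
        (auto simp: compact_imp_closed)
    have eq: "(LINT x:\<omega>|lebesgue. h x * \<phi> x) = (LINT x|lebesgue. h x * \<phi> x)" for h
      unfolding set_lebesgue_integral_def
      by (rule Bochner_Integration.integral_cong)
        (use \<phi>(3) not_in_spt_zero[of _ \<phi>] in \<open>auto simp: indicator_def\<close>)
    have "(LINT x|lebesgue. g x * \<phi> x) = (LINT x|lebesgue. g' x * \<phi> x)"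
      using bspec[OF conjunct2[OF conjunct2[OF g[unfolded weak_deriv_def]]] \<phi>t]
        bspec[OF conjunct2[OF conjunct2[OF g'[unfolded weak_deriv_def]]] \<phi>t]
      unfolding eq by linarith
    then show ?thesis
      unfolding eq
      using Bochner_Integration.integral_diff[OF int[OF li(1)] int[OF li(2)]]
      by (simp add: left_diff_distrib)
  qed
  ultimately have "AE x in lborel. x \<in> \<omega> \<longrightarrow> g x - g' x = 0"
    by (rule AE_zero_of_test_functions[OF \<omega>])
  then show ?thesis by simp
qed

section \<open>The first variation\<close>

definition grad_rep :: "(real \<times> real \<Rightarrow> real) \<Rightarrow> real \<times> real \<Rightarrow> real"
  where "grad_rep f p = quot_deriv (1, 0) f p + f p * quot_deriv (0, 1) f p"

text \<open>The derivative of z |-> sqrt (1 + z^2) at the intrinsic gradient; this is the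
  \<open>h\<close> of the overview.\<close>

definition slope :: "(real \<times> real \<Rightarrow> real) \<Rightarrow> real \<times> real \<Rightarrow> real"
  where "slope f p = grad_rep f p / sqrt (1 + (grad_rep f p)\<^sup>2)"

lemma grad_rep_measurable: "f \<in> borel_measurable borel \<Longrightarrow> grad_rep f \<in> borel_measurable borel"
  unfolding grad_rep_def by (intro borel_measurable_add borel_measurable_times quot_deriv_measurable)

lemma slope_measurable:
  assumes "f \<in> borel_measurable borel"
  shows "slope f \<in> borel_measurable borel"
proof -
  note [measurable] = grad_rep_measurable[OF assms]
  show ?thesis
    unfolding slope_def by measurable
qed

text \<open>An equality of predicates, so that the choice operator in \<open>intrinsic_grad\<close>
  selects the same representative for both functions.\<close>

lemma represents_intrinsic_grad_cong:
  assumes "\<And>x. x \<in> \<omega> \<Longrightarrow> f x = f' x"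
  shows "represents_intrinsic_grad \<omega> f = represents_intrinsic_grad \<omega> f'"
proof -
  have "represents_intrinsic_grad \<omega> h' g"
    if hg: "represents_intrinsic_grad \<omega> h g" and eq: "\<And>x. x \<in> \<omega> \<Longrightarrow> h x = h' x" for h h' g
  proof -
    obtain fy ft where "weak_deriv \<omega> (1, 0) h fy" "weak_deriv \<omega> (0, 1) h ft"
        and ae: "AE p in lebesgue. p \<in> \<omega> \<longrightarrow> g p = fy p + h p * ft p"
      using hg unfolding represents_intrinsic_grad_def by blast
    then have "weak_deriv \<omega> (1, 0) h' fy" "weak_deriv \<omega> (0, 1) h' ft"
      using weak_deriv_cong[of \<omega> _ h _ h'] eq by blast+
    moreover have "AE p in lebesgue. p \<in> \<omega> \<longrightarrow> g p = fy p + h' p * ft p"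
      using ae by eventually_elim (use eq in auto)
    ultimately show ?thesis
      unfolding represents_intrinsic_grad_def by blast
  qed
  with assms show ?thesis
    by (intro ext iffI) (metis, metis)
qed

lemma represents_grad_rep:
  assumes "f \<in> borel_measurable borel" "open \<omega>" "locally_lipschitz_on \<omega> f"
  shows "represents_intrinsic_grad \<omega> f (grad_rep f)"
  unfolding represents_intrinsic_grad_def
  using weak_deriv_quot_deriv_borel[OF assms locally_lipschitz_AE_convergent[OF assms(2,3)]]
  by (rule_tac exI[of _ "quot_deriv (1, 0) f"], rule_tac exI[of _ "quot_deriv (0, 1) f"])
    (auto simp: grad_rep_def)

text \<open>The representative selected by the choice operator is arbitrary; uniqueness of weak
  derivatives identifies it almost everywhere with the Borel one.\<close>

lemma intrinsic_grad_AE: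
  assumes "f \<in> borel_measurable borel" "open \<omega>" "locally_lipschitz_on \<omega> f"
  shows "AE p in lborel. p \<in> \<omega> \<longrightarrow> intrinsic_grad \<omega> f p = grad_rep f p"
proof -
  have "represents_intrinsic_grad \<omega> f (intrinsic_grad \<omega> f)"
    unfolding intrinsic_grad_def by (rule someI[of _ "grad_rep f"], rule represents_grad_rep[OF assms])
  then obtain fy ft where w: "weak_deriv \<omega> (1, 0) f fy" "weak_deriv \<omega> (0, 1) f ft"
      and ae: "AE p in lebesgue. p \<in> \<omega> \<longrightarrow> intrinsic_grad \<omega> f p = fy p + f p * ft p"
    unfolding represents_intrinsic_grad_def by blast
  have q: "weak_deriv \<omega> v f (quot_deriv v f)" if "v = (1, 0) \<or> v = (0, 1)" for v
    by (rule weak_deriv_quot_deriv_borel[OF assms locally_lipschitz_AE_convergent[OF assms(2,3) that]])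
  have "AE p in lborel. p \<in> \<omega> \<longrightarrow> fy p = quot_deriv (1, 0) f p"
    by (rule weak_deriv_unique[OF assms(2) w(1) q]) simp
  moreover have "AE p in lborel. p \<in> \<omega> \<longrightarrow> ft p = quot_deriv (0, 1) f p"
    by (rule weak_deriv_unique[OF assms(2) w(2) q]) simp
  moreover have "AE p in lborel. p \<in> \<omega> \<longrightarrow> intrinsic_grad \<omega> f p = fy p + f p * ft p"
    using ae by (simp add: AE_completion_iff)
  ultimately show ?thesis
    by eventually_elim (simp add: grad_rep_def)
qed

lemma locally_lipschitz_on_add_test_function:
  assumes "locally_lipschitz_on \<omega> f" "\<phi> \<in> test_functions \<omega>"
  shows "locally_lipschitz_on \<omega> (\<lambda>p. f p + \<epsilon> * \<phi> p)"
  unfolding locally_lipschitz_on_def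
proof
  fix x assume "x \<in> \<omega>"
  then obtain r L where r: "r > 0" "L-lipschitz_on (ball x r \<inter> \<omega>) f"
    using assms(1) unfolding locally_lipschitz_on_def by blast
  obtain C where "C-lipschitz_on UNIV \<phi>"
    by (rule test_function_bounds[OF assms(2)]) blast
  then have "C-lipschitz_on (ball x r \<inter> \<omega>) \<phi>"
    by (rule lipschitz_on_subset) simp
  then have "(\<bar>\<epsilon>\<bar> * C)-lipschitz_on (ball x r \<inter> \<omega>) (\<lambda>p. \<epsilon> * \<phi> p)"
    by (rule lipschitz_on_cmult_real)
  with r(2) have "(L + \<bar>\<epsilon>\<bar> * C)-lipschitz_on (ball x r \<inter> \<omega>) (\<lambda>p. f p + \<epsilon> * \<phi> p)"
    by (rule lipschitz_on_add)
  with r(1) show "\<exists>r>0. \<exists>L. L-lipschitz_on (ball x r \<inter> \<omega>) (\<lambda>p. f p + \<epsilon> * \<phi> p)"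
    by blast
qed

text \<open>The coefficient of \<epsilon> in the intrinsic gradient of f + \<epsilon> \<phi>. The
  last term stems from perturbing the coefficient f in front of the t-derivative.\<close>

definition variation :: "(real \<times> real \<Rightarrow> real) \<Rightarrow> (real \<times> real \<Rightarrow> real) \<Rightarrow> real \<times> real \<Rightarrow> real"
  where "variation f \<phi> p = dir_deriv (1, 0) \<phi> p + f p * dir_deriv (0, 1) \<phi> p + quot_deriv (0, 1) f p * \<phi> p"

text \<open>The intrinsic gradient is quadratic in the function, so the expansion in \<epsilon> ends
  exactly at the second order.\<close>

lemma grad_rep_perturbation_AE:
  assumes "open \<omega>" "locally_lipschitz_on \<omega> f" "\<phi> \<in> test_functions \<omega>"
  shows "AE p in lborel. p \<in> \<omega> \<longrightarrow> grad_rep (\<lambda>p. f p + \<epsilon> * \<phi> p) p =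
    grad_rep f p + \<epsilon> * variation f \<phi> p + \<epsilon>\<^sup>2 * (\<phi> p * dir_deriv (0, 1) \<phi> p)"
proof -
  have "AE p in lborel. p \<in> \<omega> \<longrightarrow>
      quot_deriv v (\<lambda>p. f p + \<epsilon> * \<phi> p) p = quot_deriv v f p + \<epsilon> * dir_deriv v \<phi> p"
    if "v = (1, 0) \<or> v = (0, 1)" for v
    using locally_lipschitz_AE_convergent[OF assms(1,2) that]
  proof eventually_elim
    case (elim p)
    show ?case
    proof
      assume "p \<in> \<omega>"
      with elim have "(\<lambda>n. diff_quot v f n p + \<epsilon> * diff_quot v \<phi> n p) \<longlonglongrightarrow> quot_deriv v f p + \<epsilon> * dir_deriv v \<phi> p"
        by (intro tendsto_add tendsto_mult_left tendsto_quot_deriv diff_quot_smooth_tendsto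
            test_functionsD[OF assms(3)]) auto
      moreover have "diff_quot v f n p + \<epsilon> * diff_quot v \<phi> n p = diff_quot v (\<lambda>p. f p + \<epsilon> * \<phi> p) n p" for n
        by (simp add: diff_quot_def algebra_simps del: of_nat_Suc)
      ultimately show "quot_deriv v (\<lambda>p. f p + \<epsilon> * \<phi> p) p = quot_deriv v f p + \<epsilon> * dir_deriv v \<phi> p"
        by (intro quot_deriv_eqI) simp
    qed
  qed
  from this[of "(1, 0)"] this[of "(0, 1)"]
  have "AE p in lborel. p \<in> \<omega> \<longrightarrow>
      quot_deriv (1, 0) (\<lambda>p. f p + \<epsilon> * \<phi> p) p = quot_deriv (1, 0) f p + \<epsilon> * dir_deriv (1, 0) \<phi> p"
    "AE p in lborel. p \<in> \<omega> \<longrightarrow>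
      quot_deriv (0, 1) (\<lambda>p. f p + \<epsilon> * \<phi> p) p = quot_deriv (0, 1) f p + \<epsilon> * dir_deriv (0, 1) \<phi> p"
    by auto
  then show ?thesis
    by eventually_elim (auto simp: grad_rep_def variation_def power2_eq_square algebra_simps)
qed

lemma perturbation_measurable:
  assumes f[measurable]: "f \<in> borel_measurable borel" and \<phi>: "\<phi> \<in> test_functions \<omega>"
  shows "\<phi> \<in> borel_measurable borel" "dir_deriv v \<phi> \<in> borel_measurable borel"
    "grad_rep f \<in> borel_measurable borel" "slope f \<in> borel_measurable borel"
    "variation f \<phi> \<in> borel_measurable borel" "spt \<phi> \<in> sets borel"
proof -
  note \<phi>' = test_functionsD[OF \<phi>]
  note [measurable] = smooth_measurable[OF \<phi>'(1)] dir_deriv_measurable[OF \<phi>'(1)]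
    quot_deriv_measurable[OF f] grad_rep_measurable[OF f] slope_measurable[OF f]
  show "\<phi> \<in> borel_measurable borel" "dir_deriv v \<phi> \<in> borel_measurable borel"
    "grad_rep f \<in> borel_measurable borel" "slope f \<in> borel_measurable borel"
    by measurable
  show "variation f \<phi> \<in> borel_measurable borel"
    unfolding variation_def by measurable
  show "spt \<phi> \<in> sets borel"
    using \<phi>'(2) by (simp add: compact_imp_closed)
qed

lemma intrinsic_area_perturbation:
  assumes fm[measurable]: "f \<in> borel_measurable borel" and \<omega>: "open \<omega>" and f: "locally_lipschitz_on \<omega> f"
    and \<phi>: "\<phi> \<in> test_functions \<omega>"
  shows "enn2real (intrinsic_area \<omega> (\<lambda>p. f p + \<epsilon> * \<phi> p) (spt \<phi>)) =
    (\<integral>p. indicator (spt \<phi>) p * sqrt (1 + (grad_rep f p + \<epsilon> * variation f \<phi> p +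
        \<epsilon>\<^sup>2 * (\<phi> p * dir_deriv (0, 1) \<phi> p))\<^sup>2) \<partial>lborel)"
proof -
  note \<phi>' = test_functionsD[OF \<phi>]
  note [measurable] = perturbation_measurable[OF fm \<phi>]
  let ?F = "\<lambda>p. grad_rep f p + \<epsilon> * variation f \<phi> p + \<epsilon>\<^sup>2 * (\<phi> p * dir_deriv (0, 1) \<phi> p)"
  have "(\<lambda>p. f p + \<epsilon> * \<phi> p) \<in> borel_measurable borel"
    by measurable
  from intrinsic_grad_AE[OF this \<omega> locally_lipschitz_on_add_test_function[OF f \<phi>]]
    grad_rep_perturbation_AE[OF \<omega> f \<phi>, of \<epsilon>]
  have "AE p in lborel. p \<in> \<omega> \<longrightarrow> intrinsic_grad \<omega> (\<lambda>p. f p + \<epsilon> * \<phi> p) p = ?F p"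
    by eventually_elim simp
  then have "AE p in lebesgue. p \<in> \<omega> \<longrightarrow> intrinsic_grad \<omega> (\<lambda>p. f p + \<epsilon> * \<phi> p) p = ?F p"
    by (rule AE_completion)
  then have "intrinsic_area \<omega> (\<lambda>p. f p + \<epsilon> * \<phi> p) (spt \<phi>) =
      (\<integral>\<^sup>+p. ennreal (indicator (spt \<phi>) p * sqrt (1 + (?F p)\<^sup>2)) \<partial>lebesgue)"
    unfolding intrinsic_area_def
    by (intro nn_integral_cong_AE, eventually_elim) (use \<phi>'(3) in \<open>auto simp: indicator_def\<close>)
  also have "\<dots> = (\<integral>\<^sup>+p. ennreal (indicator (spt \<phi>) p * sqrt (1 + (?F p)\<^sup>2)) \<partial>lborel)"
    by (rule nn_integral_completion)
  finally show ?thesis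
    by (simp add: integral_eq_nn_integral)
qed

text \<open>The reverse triangle inequality for the plane vectors (1, a) and (1, b).\<close>

lemma sqrt_one_plus_square_lipschitz: "\<bar>sqrt (1 + a\<^sup>2) - sqrt (1 + b\<^sup>2)\<bar> \<le> \<bar>a - b\<bar>"
  using norm_triangle_ineq3[of "(1 :: real, a)" "(1, b)"] by (simp add: norm_prod_def)

text \<open>Differentiation under the integral sign. Stationarity already provides the derivative of
  the area, so it can be identified along the steps 1/(n+1), where dominated convergence for
  sequences applies.\<close>

lemma first_variation:
  assumes fm[measurable]: "f \<in> borel_measurable borel" and \<omega>: "open \<omega>" and f: "locally_lipschitz_on \<omega> f"
    and st: "stationary \<omega> f" and \<phi>: "\<phi> \<in> test_functions \<omega>"
  shows "(\<integral>p. slope f p * variation f \<phi> p \<partial>lborel) = 0"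
proof -
  note \<phi>' = test_functionsD[OF \<phi>]
  note [measurable] = perturbation_measurable[OF fm \<phi>]
  let ?S = "spt \<phi>"
  let ?B = "\<lambda>p. \<phi> p * dir_deriv (0, 1) \<phi> p"
  let ?F = "\<lambda>\<epsilon> p. sqrt (1 + (grad_rep f p + \<epsilon> * variation f \<phi> p + \<epsilon>\<^sup>2 * ?B p)\<^sup>2)"
  let ?q = "\<lambda>n p. indicator ?S p * diff_quot 1 (\<lambda>\<epsilon>. ?F \<epsilon> p) n 0"
  obtain M where M: "\<And>p. p \<in> ?S \<Longrightarrow> \<bar>f p\<bar> \<le> M" "\<And>p. p \<in> ?S \<Longrightarrow> \<bar>quot_deriv (1, 0) f p\<bar> \<le> M"
      "\<And>p. p \<in> ?S \<Longrightarrow> \<bar>quot_deriv (0, 1) f p\<bar> \<le> M" "M \<ge> 0"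
  proof -
    obtain e1 M1 where 1: "e1 > 0" "\<And>x. x \<in> (\<Union>x\<in>?S. cball x e1) \<Longrightarrow> \<bar>f x\<bar> \<le> M1" "M1 \<ge> 0"
        "\<And>p. p \<in> ?S \<Longrightarrow> \<bar>quot_deriv (1, 0) f p\<bar> \<le> M1"
      by (rule locally_lipschitz_bounds[OF \<omega> f \<phi>'(2,3), of "(1, 0)"]) blast
    obtain M2 where 2: "\<And>p. p \<in> ?S \<Longrightarrow> \<bar>quot_deriv (0, 1) f p\<bar> \<le> M2"
      by (rule locally_lipschitz_bounds[OF \<omega> f \<phi>'(2,3), of "(0, 1)"]) blast
    have "\<bar>f p\<bar> \<le> M1" if "p \<in> ?S" for p
      by (rule 1(2)) (use that 1(1) in force)
    with 1(3,4) 2 show ?thesis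
      by (intro that[of "max M1 M2"]) (auto simp: le_max_iff_disj)
  qed
  obtain C where C: "C \<ge> 0" "\<And>x. \<bar>\<phi> x\<bar> \<le> C" "\<And>v x. \<bar>dir_deriv v \<phi> x\<bar> \<le> C * norm v"
    by (rule test_function_bounds[OF \<phi>]) blast
  have C1: "\<bar>dir_deriv (1, 0) \<phi> x\<bar> \<le> C" "\<bar>dir_deriv (0, 1) \<phi> x\<bar> \<le> C" for x
    using C(3)[of "(1, 0)" x] C(3)[of "(0, 1)" x] by (auto simp: norm_Pair)
  have Vb: "\<bar>variation f \<phi> p\<bar> \<le> C + M * C + M * C" if "p \<in> ?S" for p
  proof -
    have "\<bar>f p * dir_deriv (0, 1) \<phi> p\<bar> \<le> M * C"
      unfolding abs_mult by (intro mult_mono M that C C1 abs_ge_zero)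
    moreover have "\<bar>quot_deriv (0, 1) f p * \<phi> p\<bar> \<le> M * C"
      unfolding abs_mult by (intro mult_mono M that C C1 abs_ge_zero)
    ultimately show ?thesis
      using C1(1)[of p]
      unfolding variation_def by linarith
  qed
  have Bb: "\<bar>?B p\<bar> \<le> C * C" for p
    unfolding abs_mult using C C1 by (intro mult_mono) auto
  have gb: "\<bar>grad_rep f p\<bar> \<le> M + M * M" if "p \<in> ?S" for p
  proof -
    have "\<bar>f p * quot_deriv (0, 1) f p\<bar> \<le> M * M"
      unfolding abs_mult by (intro mult_mono M that abs_ge_zero)
    with M(2)[OF that] show ?thesis
      unfolding grad_rep_def by linarith
  qed
  \<comment> \<open>A Lipschitz constant at \<epsilon> = 0 of the integrand, valid for |\<epsilon>|
    \<le> 1: the bound of the linear coefficient plus that of the quadratic one.\<close>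
  define D where "D = (C + M * C + M * C) + C * C"
  have fin: "emeasure lborel ?S < \<infinity>"
    using emeasure_bounded_finite[OF compact_imp_bounded[OF \<phi>'(2)]] .
  have Fb: "\<bar>?F \<epsilon> p - ?F 0 p\<bar> \<le> \<bar>\<epsilon>\<bar> * D" if "p \<in> ?S" "\<bar>\<epsilon>\<bar> \<le> 1" for \<epsilon> p
  proof -
    have "\<bar>?F \<epsilon> p - ?F 0 p\<bar> \<le> \<bar>\<epsilon> * (variation f \<phi> p + \<epsilon> * ?B p)\<bar>"
      using sqrt_one_plus_square_lipschitz[of "grad_rep f p + \<epsilon> * variation f \<phi> p + \<epsilon>\<^sup>2 * ?B p" "grad_rep f p"]
      by (simp add: algebra_simps power2_eq_square)
    also have "\<dots> = \<bar>\<epsilon>\<bar> * \<bar>variation f \<phi> p + \<epsilon> * ?B p\<bar>"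
      by (rule abs_mult)
    also have "\<dots> \<le> \<bar>\<epsilon>\<bar> * D"
    proof (rule mult_left_mono)
      have "\<bar>\<epsilon> * ?B p\<bar> \<le> 1 * (C * C)"
        unfolding abs_mult[of \<epsilon>] using that(2) Bb by (intro mult_mono) auto
      with Vb[OF that(1)] show "\<bar>variation f \<phi> p + \<epsilon> * ?B p\<bar> \<le> D"
        unfolding D_def by linarith
    qed simp
    finally show ?thesis .
  qed
  have F0b: "\<bar>?F 0 p\<bar> \<le> 1 + (M + M * M)" if "p \<in> ?S" for p
    using sqrt_one_plus_square_lipschitz[of "grad_rep f p" 0] gb[OF that] by auto
  have D0: "0 \<le> D"
    using C(1) M(4) by (simp add: D_def)
  have int: "integrable lborel (\<lambda>p. indicator ?S p * ?F \<epsilon> p)" if e: "\<bar>\<epsilon>\<bar> \<le> 1" for \<epsilon>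
  proof (rule integrable_bounded_compact[OF _ \<phi>'(2)])
    fix p assume p: "p \<in> ?S"
    have "\<bar>\<epsilon>\<bar> * D \<le> 1 * D"
      using e D0 by (intro mult_right_mono)
    then show "\<bar>indicator ?S p * ?F \<epsilon> p\<bar> \<le> 1 + (M + M * M) + D"
      using Fb[OF p e] F0b[OF p] p by simp
  qed auto
  define area where "area \<epsilon> = (\<integral>p. indicator ?S p * ?F \<epsilon> p \<partial>lborel)" for \<epsilon>
  have "(area has_real_derivative 0) (at 0)"
    using st \<phi> unfolding stationary_def area_def intrinsic_area_perturbation[OF fm \<omega> f \<phi>, symmetric]
    by blast
  then have "(\<lambda>n. diff_quot 1 area n 0) \<longlonglongrightarrow> 0"
    by (rule diff_quot_has_real_derivative)
  moreover have "diff_quot 1 area n 0 = (\<integral>p. ?q n p \<partial>lborel)" for n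
  proof -
    let ?h = "0 + (1 / real (Suc n)) *\<^sub>R (1 :: real)"
    have i: "integrable lborel (\<lambda>p. indicator ?S p * ?F ?h p)"
      "integrable lborel (\<lambda>p. indicator ?S p * ?F 0 p)"
      by (rule int, simp)+
    have "diff_quot 1 area n 0 = real (Suc n) * (\<integral>p. indicator ?S p * ?F ?h p - indicator ?S p * ?F 0 p \<partial>lborel)"
      unfolding diff_quot_def area_def by (simp only: Bochner_Integration.integral_diff[OF i])
    also have "\<dots> = (\<integral>p. real (Suc n) * (indicator ?S p * ?F ?h p - indicator ?S p * ?F 0 p) \<partial>lborel)"
      by (simp only: integral_mult_right_zero)
    also have "\<dots> = (\<integral>p. ?q n p \<partial>lborel)"
      unfolding diff_quot_def by (simp only: right_diff_distrib mult.left_commute)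
    finally show ?thesis .
  qed
  moreover have "(\<lambda>n. \<integral>p. ?q n p \<partial>lborel)
      \<longlonglongrightarrow> (\<integral>p. indicator ?S p * (slope f p * variation f \<phi> p) \<partial>lborel)"
  proof (rule integral_dominated_convergence[where w="\<lambda>p. indicator ?S p * D"])
    show "integrable lborel (\<lambda>p. indicator ?S p * D)"
      using fin by simp
    show "(\<lambda>p. indicator ?S p * (slope f p * variation f \<phi> p)) \<in> borel_measurable lborel"
      by measurable
    show "(\<lambda>p. ?q n p) \<in> borel_measurable lborel" for n
      unfolding diff_quot_def by measurable
    have "((\<lambda>\<epsilon>. ?F \<epsilon> p) has_real_derivative slope f p * variation f \<phi> p) (at 0)" for p
    proof -
      have "1 + (grad_rep f p)\<^sup>2 > 0"
        by (simp add: add_pos_nonneg)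
      then show ?thesis
        by (auto intro!: derivative_eq_intros simp: slope_def divide_simps)
    qed
    then show "AE p in lborel. (\<lambda>n. ?q n p)
        \<longlonglongrightarrow> indicator ?S p * (slope f p * variation f \<phi> p)"
      by (intro AE_I2 tendsto_mult_left diff_quot_has_real_derivative)
    show "AE p in lborel. norm (?q n p) \<le> indicator ?S p * D" for n
    proof (rule AE_I2)
      fix p
      show "norm (?q n p) \<le> indicator ?S p * D"
      proof (cases "p \<in> ?S")
        case True
        have "real (Suc n) * \<bar>?F (1 / real (Suc n)) p - ?F 0 p\<bar> \<le> real (Suc n) * (\<bar>1 / real (Suc n)\<bar> * D)"
          by (intro mult_left_mono Fb[OF True]) auto
        with True show ?thesis
          by (simp add: diff_quot_def abs_mult del: of_nat_Suc)
      qed simp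
    qed
  qed
  ultimately have "(\<integral>p. indicator ?S p * (slope f p * variation f \<phi> p) \<partial>lborel) = 0"
    using LIMSEQ_unique by simp
  moreover have "indicator ?S p * (slope f p * variation f \<phi> p) = slope f p * variation f \<phi> p" for p
    using dir_deriv_zero_outside_spt[of p \<phi>] not_in_spt_zero[of p \<phi>]
    by (auto simp: indicator_def variation_def)
  ultimately show ?thesis by simp
qed

section \<open>The characteristic flow\<close>

lemma AE_imp_negligible:
  assumes "AE x in lborel. P x"
  obtains N where "negligible N" "\<And>x. x \<notin> N \<Longrightarrow> P x"
proof -
  obtain N where "N \<in> null_sets lborel" "{x. \<not> P x} \<subseteq> N"
    using assms by (auto simp: eventually_ae_filter)
  moreover from this(1) have "negligible N"
    by (simp add: negligible_iff_null_sets null_sets_completionI)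
  ultimately show ?thesis
    using that by blast
qed

text \<open>The smallness condition makes the Picard operator on the strip [c, d] a contraction with
  factor 1/4; the factors 4/3, 2/3 and 3/2 below all descend from it.\<close>

locale characteristics =
  fixes F :: "real \<times> real \<Rightarrow> real" and L M c d :: real
  assumes lip: "L-lipschitz_on UNIV F" and bound: "\<And>p. \<bar>F p\<bar> \<le> M"
    and cd: "c < d" and small: "(d - c) * L \<le> 1 / 4"
begin

text \<open>Freezing the parameter outside [c, d] makes the curves bounded on the whole line, so the
  fixed point can be sought in the complete type
  \<open>real \<Rightarrow>\<^sub>C real\<close>.\<close>

definition cl :: "real \<Rightarrow> real"
  where "cl y = max c (min d y)"

lemma cl_mem: "cl y \<in> {c..d}" and cl_id: "y \<in> {c..d} \<Longrightarrow> cl y = y"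
  and cl_lip: "\<bar>cl y - cl y'\<bar> \<le> \<bar>y - y'\<bar>"
  using cd by (auto simp: cl_def max_def min_def abs_if)

lemma L_nonneg: "0 \<le> L"
  using lipschitz_on_nonneg[OF lip] .

lemma M_nonneg: "0 \<le> M"
  using order_trans[OF abs_ge_zero bound] .

lemma F_continuous_on: "continuous_on S F"
  using lipschitz_on_continuous_on[OF lip] continuous_on_subset by blast

lemma F_lip_snd: "\<bar>F (y, t) - F (y, t')\<bar> \<le> L * \<bar>t - t'\<bar>"
  using lipschitz_onD[OF lip, of "(y, t)" "(y, t')"] by (simp add: dist_prod_def dist_real_def)

abbreviation along :: "(real \<Rightarrow> real) \<Rightarrow> real \<Rightarrow> real"
  where "along \<xi> \<equiv> \<lambda>\<tau>. F (\<tau>, \<xi> \<tau>)"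

lemma integrable_along:
  "continuous_on UNIV (\<xi> :: real \<Rightarrow> real) \<Longrightarrow> (along \<xi>) integrable_on {a..b}"
  by (intro integrable_continuous_real continuous_on_compose2[OF F_continuous_on[of UNIV]] continuous_intros)
    (auto intro: continuous_on_subset)

lemma integral_along_bound:
  assumes "continuous_on UNIV (\<xi> :: real \<Rightarrow> real)" "a \<le> b"
  shows "\<bar>integral {a..b} (along \<xi>)\<bar> \<le> M * (b - a)"
proof -
  have "norm (integral {a..b} (along \<xi>)) \<le> M * (b - a)"
  proof (rule integral_bound[OF assms(2)])
    show "continuous_on {a..b} (along \<xi>)"
      by (intro continuous_intros continuous_on_compose2[OF F_continuous_on[of UNIV]]
          continuous_on_subset[OF assms(1)]) auto
  qed (simp add: bound)
  then show ?thesis by simp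
qed

section \<open>Characteristics as fixed points of the Picard operator\<close>

definition picard :: "real \<Rightarrow> (real \<Rightarrow>\<^sub>C real) \<Rightarrow> real \<Rightarrow> real"
  where "picard s \<xi> y = s + integral {c..cl y} (along (apply_bcontfun \<xi>))"

lemma apply_bcontfun_continuous: "continuous_on UNIV (apply_bcontfun (\<xi> :: real \<Rightarrow>\<^sub>C real))"
  using apply_bcontfun[of \<xi>] by (simp add: bcontfun_def)

lemma picard_bcontfun: "picard s \<xi> \<in> bcontfun"
proof (rule bcontfun_normI)
  have "continuous_on {c..d} (\<lambda>y. integral {c..y} (along (apply_bcontfun \<xi>)))"
    by (intro indefinite_integral_continuous_1 integrable_along apply_bcontfun_continuous)
  then have "continuous_on UNIV (\<lambda>y. integral {c..cl y} (along (apply_bcontfun \<xi>)))"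
    by (rule continuous_on_compose2) (use cl_mem in \<open>auto simp: cl_def[abs_def] intro!: continuous_intros\<close>)
  then show "continuous_on UNIV (picard s \<xi>)"
    unfolding picard_def by (intro continuous_intros)
  fix y
  have "\<bar>integral {c..cl y} (along (apply_bcontfun \<xi>))\<bar> \<le> M * (cl y - c)"
    using cl_mem[of y] by (intro integral_along_bound apply_bcontfun_continuous) auto
  also have "\<dots> \<le> M * (d - c)"
    using cl_mem[of y] M_nonneg by (intro mult_left_mono) auto
  finally show "norm (picard s \<xi> y) \<le> \<bar>s\<bar> + M * (d - c)"
    unfolding picard_def by simp
qed

text \<open>The starting values are subtracted so that one estimate gives both the contraction (s =
  s') and the dependence of the characteristics on s.\<close>

lemma picard_diff:
  "\<bar>(picard s \<xi> y - s) - (picard s' \<xi>' y - s')\<bar> \<le> 1 / 4 * dist \<xi> \<xi>'"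
proof -
  let ?I = "\<lambda>\<xi>. integral {c..cl y} (along (apply_bcontfun \<xi>))"
  have i: "(along (apply_bcontfun \<xi>)) integrable_on {c..cl y}" for \<xi>
    by (intro integrable_along apply_bcontfun_continuous)
  have "norm (?I \<xi> - ?I \<xi>') = norm (integral {c..cl y} (\<lambda>\<tau>. F (\<tau>, apply_bcontfun \<xi> \<tau>) - F (\<tau>, apply_bcontfun \<xi>' \<tau>)))"
    by (simp only: Henstock_Kurzweil_Integration.integral_diff[OF i i])
  also have "\<dots> \<le> (L * dist \<xi> \<xi>') * (cl y - c)"
  proof (rule integral_bound)
    show "c \<le> cl y" using cl_mem[of y] by simp
    show "continuous_on {c..cl y} (\<lambda>\<tau>. F (\<tau>, apply_bcontfun \<xi> \<tau>) - F (\<tau>, apply_bcontfun \<xi>' \<tau>))"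
      by (intro continuous_intros continuous_on_compose2[OF F_continuous_on[of UNIV]]
          continuous_on_subset[OF apply_bcontfun_continuous]) auto
    fix \<tau>
    have "\<bar>F (\<tau>, apply_bcontfun \<xi> \<tau>) - F (\<tau>, apply_bcontfun \<xi>' \<tau>)\<bar>
        \<le> L * \<bar>apply_bcontfun \<xi> \<tau> - apply_bcontfun \<xi>' \<tau>\<bar>"
      by (rule F_lip_snd)
    also have "\<dots> \<le> L * dist \<xi> \<xi>'"
      using dist_bounded[of \<xi> \<tau> \<xi>'] L_nonneg by (intro mult_left_mono) (auto simp: dist_real_def)
    finally show "norm (F (\<tau>, apply_bcontfun \<xi> \<tau>) - F (\<tau>, apply_bcontfun \<xi>' \<tau>)) \<le> L * dist \<xi> \<xi>'"
      by simp
  qed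
  also have "\<dots> \<le> (L * dist \<xi> \<xi>') * (d - c)"
    using cl_mem[of y] L_nonneg by (intro mult_left_mono) auto
  also have "\<dots> = ((d - c) * L) * dist \<xi> \<xi>'"
    by simp
  also have "\<dots> \<le> 1 / 4 * dist \<xi> \<xi>'"
    by (intro mult_right_mono small) simp
  finally show ?thesis
    by (simp add: picard_def)
qed

lemma ex1_char: "\<exists>!\<xi>. Bcontfun (picard s \<xi>) = \<xi>"
proof (rule banach_fix_type[of "1 / 4"])
  have "dist (Bcontfun (picard s \<xi>)) (Bcontfun (picard s \<xi>')) \<le> 1 / 4 * dist \<xi> \<xi>'" for \<xi> \<xi>'
  proof (rule dist_bound)
    fix y
    show "dist (apply_bcontfun (Bcontfun (picard s \<xi>)) y) (apply_bcontfun (Bcontfun (picard s \<xi>')) y)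
        \<le> 1 / 4 * dist \<xi> \<xi>'"
      using picard_diff[of s \<xi> y s \<xi>'] by (simp add: Bcontfun_inverse[OF picard_bcontfun] dist_real_def)
  qed
  then show "\<forall>\<xi> \<xi>'. dist (Bcontfun (picard s \<xi>)) (Bcontfun (picard s \<xi>')) \<le> 1 / 4 * dist \<xi> \<xi>'"
    by blast
qed auto

definition bchar :: "real \<Rightarrow> real \<Rightarrow>\<^sub>C real"
  where "bchar s = (THE \<xi>. Bcontfun (picard s \<xi>) = \<xi>)"

definition char :: "real \<Rightarrow> real \<Rightarrow> real"
  where "char s = apply_bcontfun (bchar s)"

lemma char_continuous: "continuous_on S (char s)"
  unfolding char_def using apply_bcontfun_continuous continuous_on_subset by blast

lemma char_picard: "char s y = picard s (bchar s) y"
proof -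
  have "Bcontfun (picard s (bchar s)) = bchar s"
    unfolding bchar_def by (rule theI'[OF ex1_char])
  then have "apply_bcontfun (Bcontfun (picard s (bchar s))) y = char s y"
    by (simp add: char_def)
  then show ?thesis
    by (simp add: Bcontfun_inverse[OF picard_bcontfun])
qed

lemma char_eq: "char s y = s + integral {c..cl y} (along (char s))"
  unfolding char_def[symmetric] by (subst char_picard) (simp add: picard_def char_def)

lemma char_cl: "char s (cl y) = char s y"
  using char_eq[of s y] char_eq[of s "cl y"] cl_id[OF cl_mem] by simp

lemma char_start: "char s c = s"
  using char_eq[of s c] cl_id[of c] cd by simp

text \<open>The distance is at most |s - s'| plus a quarter of itself; solving for it gives 1 / (1 -
  1/4) = 4/3.\<close>

lemma dist_bchar: "dist (bchar s) (bchar s') \<le> 4 / 3 * \<bar>s - s'\<bar>"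
proof -
  have "dist (bchar s) (bchar s') \<le> \<bar>s - s'\<bar> + 1 / 4 * dist (bchar s) (bchar s')"
  proof (rule dist_bound)
    fix y
    show "dist (apply_bcontfun (bchar s) y) (apply_bcontfun (bchar s') y)
        \<le> \<bar>s - s'\<bar> + 1 / 4 * dist (bchar s) (bchar s')"
      using picard_diff[of s "bchar s" y s' "bchar s'"] char_picard[of s y] char_picard[of s' y]
      unfolding char_def dist_real_def by linarith
  qed
  then show ?thesis by simp
qed

lemma char_lip_start: "\<bar>char s y - char s' y\<bar> \<le> 4 / 3 * \<bar>s - s'\<bar>"
  using dist_bounded[of "bchar s" y "bchar s'"] dist_bchar[of s s'] by (simp add: char_def dist_real_def)

text \<open>The integral parts differ by at most 1/4 * 4/3 = 1/3 of |s - s'|, which leaves 2/3.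
  Hence characteristics with different starting values never meet.\<close>

lemma char_expand_start: "2 / 3 * \<bar>s - s'\<bar> \<le> \<bar>char s y - char s' y\<bar>"
  using picard_diff[of s "bchar s" y s' "bchar s'"] char_picard[of s y] char_picard[of s' y] dist_bchar[of s s']
  by (simp add: abs_if split: if_splits)

lemma char_diff: "c \<le> y \<Longrightarrow> y \<le> y' \<Longrightarrow> y' \<le> d \<Longrightarrow>
  char s y' - char s y = integral {y..y'} (along (char s))"
  using Henstock_Kurzweil_Integration.integral_combine[of c y y' "along (char s)"]
    integrable_along[OF char_continuous, of s c y'] char_eq[of s y] char_eq[of s y']
  by (simp add: cl_id)

lemma char_lip: "\<bar>char s y - char s y'\<bar> \<le> M * \<bar>y - y'\<bar>"
proof -
  have *: "\<bar>char s a - char s b\<bar> \<le> M * \<bar>a - b\<bar>" if "a \<in> {c..d}" "b \<in> {c..d}" "a \<le> b" for a b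
    using char_diff[of a b s] integral_along_bound[OF char_continuous[of UNIV s] that(3)] that
    by (simp add: abs_minus_commute)
  have "\<bar>char s (cl y) - char s (cl y')\<bar> \<le> M * \<bar>cl y - cl y'\<bar>"
    using *[OF cl_mem cl_mem, of y y'] *[OF cl_mem cl_mem, of y' y]
    by (cases "cl y \<le> cl y'") (auto simp: abs_minus_commute)
  also have "\<dots> \<le> M * \<bar>y - y'\<bar>"
    using cl_lip M_nonneg by (rule mult_left_mono)
  finally show ?thesis
    by (simp add: char_cl)
qed

lemma char_has_derivative:
  assumes "y \<in> {c..d}"
  shows "(char s has_vector_derivative F (y, char s y)) (at y within {c..d})"
proof -
  have "((\<lambda>y. integral {c..y} (\<lambda>\<tau>. F (\<tau>, char s \<tau>))) has_vector_derivative F (y, char s y)) (at y within {c..d})"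
    by (rule integral_has_vector_derivative[OF _ assms])
      (auto intro!: continuous_intros continuous_on_compose2[OF F_continuous_on[of UNIV]] char_continuous)
  then have "((\<lambda>y. s + integral {c..y} (\<lambda>\<tau>. F (\<tau>, char s \<tau>))) has_vector_derivative F (y, char s y)) (at y within {c..d})"
    by (auto intro!: derivative_eq_intros)
  then show ?thesis
  proof (rule has_vector_derivative_transform[OF assms, rotated])
    fix y assume "y \<in> {c..d}"
    then show "char s y = s + integral {c..y} (\<lambda>\<tau>. F (\<tau>, char s \<tau>))"
      using char_eq[of s y] by (simp only: cl_id)
  qed
qed

text \<open>Over the strip a characteristic moves vertically by at most M * (d - c), so starting
  values this far below and above \<open>t\<close> bracket it, and the intermediate value theorem
  applies.\<close>

lemma char_surj: "\<exists>s. char s y = t"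
proof -
  let ?R = "M * (d - c)"
  have b: "\<bar>char s y - s\<bar> \<le> ?R" for s
  proof -
    have "\<bar>char s y - char s c\<bar> \<le> M * \<bar>cl y - c\<bar>"
      using char_lip[of s "cl y" c] by (simp add: char_cl)
    also have "\<dots> \<le> ?R"
      using cl_mem[of y] M_nonneg by (intro mult_left_mono) auto
    finally show ?thesis by (simp add: char_start)
  qed
  have "continuous_on S (\<lambda>s. char s y)" for S
    by (rule lipschitz_on_continuous_on[of "4 / 3"], rule lipschitz_onI)
      (use char_lip_start in \<open>auto simp: dist_real_def\<close>)
  moreover have "char (t - ?R) y \<le> t" "t \<le> char (t + ?R) y" "t - ?R \<le> t + ?R"
    using b[of "t - ?R"] b[of "t + ?R"] M_nonneg cd by (auto simp: abs_le_iff)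
  ultimately show ?thesis
    using IVT'[of "\<lambda>s. char s y" "t - ?R" t "t + ?R"] by blast
qed

section \<open>Straightening of the characteristics\<close>

definition label :: "real \<times> real \<Rightarrow> real"
  where "label p = (SOME s. char s (fst p) = snd p)"

lemma char_label: "char (label p) (fst p) = snd p"
  unfolding label_def by (rule someI_ex[OF char_surj])

lemma label_char: "label (y, char s y) = s"
  using char_expand_start[of "label (y, char s y)" s y] char_label[of "(y, char s y)"] by simp

lemma label_lip: "\<bar>label p - label q\<bar> \<le> 3 / 2 * (1 + M) * dist p q"
proof -
  have "2 / 3 * \<bar>label p - label q\<bar> \<le> \<bar>char (label p) (fst p) - char (label q) (fst p)\<bar>"
    by (rule char_expand_start)
  also have "\<dots> \<le> \<bar>snd p - snd q\<bar> + \<bar>char (label q) (fst q) - char (label q) (fst p)\<bar>"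
    using char_label[of p] char_label[of q] by linarith
  also have "\<dots> \<le> dist p q + M * dist p q"
  proof (rule add_mono)
    show "\<bar>snd p - snd q\<bar> \<le> dist p q"
      using dist_snd_le[of p q] by (simp add: dist_real_def)
    have "\<bar>char (label q) (fst q) - char (label q) (fst p)\<bar> \<le> M * \<bar>fst q - fst p\<bar>"
      by (rule char_lip)
    also have "\<dots> \<le> M * dist p q"
      using dist_fst_le[of q p] M_nonneg by (intro mult_left_mono) (auto simp: dist_real_def dist_commute)
    finally show "\<bar>char (label q) (fst q) - char (label q) (fst p)\<bar> \<le> M * dist p q" .
  qed
  finally show ?thesis
    by (simp add: algebra_simps)
qed

lemma label_lipschitz_on: "(3 / 2 * (1 + M))-lipschitz_on S label"
  using label_lip M_nonneg by (intro lipschitz_onI) (auto simp: dist_real_def)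

text \<open>The straightening p |-> (label p, fst p) is Lipschitz and maps null sets to null sets;
  in the straightened coordinates the characteristics are parallel lines and Fubini applies.\<close>

lemma AE_along_characteristics:
  assumes "AE p in lborel. P p"
  shows "AE s in lborel. AE y in lborel. P (y, char s y)"
proof -
  obtain N where N: "negligible N" "\<And>p. p \<notin> N \<Longrightarrow> P p"
    using AE_imp_negligible[OF assms] by blast
  define N1 where "N1 = (\<lambda>p. (label p, fst p)) ` N"
  have "negligible N1"
    unfolding N1_def
  proof (rule negligible_locally_Lipschitz_image[OF _ N(1)])
    fix p assume "p \<in> N"
    have "norm ((label q, fst q) - (label p, fst p)) \<le> (3 / 2 * (1 + M) + 1) * norm (q - p)" for q
    proof -
      have "norm ((label q, fst q) - (label p, fst p)) \<le> norm (label q - label p) + norm (fst q - fst p)"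
        using norm_Pair_le[of "label q - label p" "fst q - fst p"] by simp
      also have "\<dots> \<le> 3 / 2 * (1 + M) * dist q p + dist q p"
        using label_lip[of q p] dist_fst_le[of q p] by (intro add_mono) (auto simp: dist_real_def)
      finally show ?thesis
        by (simp add: dist_norm algebra_simps)
    qed
    then show "\<exists>T B. open T \<and> p \<in> T \<and> (\<forall>q\<in>N \<inter> T. norm ((label q, fst q) - (label p, fst p)) \<le> B * norm (q - p))"
      by (intro exI[of _ UNIV] exI[of _ "3 / 2 * (1 + M) + 1"]) auto
  qed simp
  then have "AE q in lborel \<Otimes>\<^sub>M lborel. q \<notin> N1"
    unfolding lborel_prod by (rule negligible_imp_AE)
  then have "AE s in lborel. AE y in lborel. (s, y) \<notin> N1"
    by (rule lborel_pair.AE_pair)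
  then show ?thesis
  proof eventually_elim
    case (elim s)
    then show ?case
    proof eventually_elim
      case (elim y)
      have "(y, char s y) \<notin> N"
      proof
        assume "(y, char s y) \<in> N"
        then have "(label (y, char s y), fst (y, char s y)) \<in> N1"
          unfolding N1_def by (rule imageI)
        with elim show False by (simp add: label_char)
      qed
      then show ?case by (rule N(2))
    qed
  qed
qed

text \<open>The inverse of the straightening is Lipschitz too. Measurability is assumed because null
  slices give a null set only for measurable sets.\<close>

lemma AE_from_characteristics:
  assumes meas: "{p. P p} \<in> sets borel" and ae: "AE s in lborel. AE y in lborel. P (y, char s y)"
  shows "AE p in lborel. P p"
proof -
  let ?\<Psi> = "\<lambda>q. (snd q, char (fst q) (snd q))"
  have \<Psi>_lip: "norm (?\<Psi> q - ?\<Psi> q') \<le> (1 + 4 / 3 + M) * norm (q - q')" for q q'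
  proof -
    have d: "\<bar>fst q - fst q'\<bar> \<le> norm (q - q')" "\<bar>snd q - snd q'\<bar> \<le> norm (q - q')"
      using dist_fst_le[of q q'] dist_snd_le[of q q'] by (simp_all add: dist_norm)
    have "norm (?\<Psi> q - ?\<Psi> q') \<le> norm (snd q - snd q') + norm (char (fst q) (snd q) - char (fst q') (snd q'))"
      using norm_Pair_le[of "snd q - snd q'" "char (fst q) (snd q) - char (fst q') (snd q')"] by simp
    also have "\<dots> \<le> \<bar>snd q - snd q'\<bar> + (4 / 3 * \<bar>fst q - fst q'\<bar> + M * \<bar>snd q - snd q'\<bar>)"
      using char_lip_start[of "fst q" "snd q" "fst q'"] char_lip[of "fst q'" "snd q" "snd q'"]
      unfolding real_norm_def by linarith
    also have "\<dots> \<le> norm (q - q') + (4 / 3 * norm (q - q') + M * norm (q - q'))"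
      using d M_nonneg by (intro add_mono mult_left_mono) auto
    finally show ?thesis
      by (simp add: algebra_simps)
  qed
  have "(1 + 4 / 3 + M)-lipschitz_on UNIV ?\<Psi>"
    using \<Psi>_lip M_nonneg by (intro lipschitz_onI) (auto simp: dist_norm)
  then have "?\<Psi> \<in> borel_measurable borel"
    by (intro borel_measurable_continuous_onI lipschitz_on_continuous_on)
  from measurable_sets[OF this meas] have "{q. P (?\<Psi> q)} \<in> sets borel"
    by (simp add: vimage_def)
  then have "{q \<in> space (lborel \<Otimes>\<^sub>M lborel). P (?\<Psi> q)} \<in> sets (lborel \<Otimes>\<^sub>M lborel)"
    unfolding lborel_prod by simp
  then have "AE q in lborel \<Otimes>\<^sub>M lborel. P (?\<Psi> q)"
    by (rule lborel_pair.AE_pair_measure) (use ae in simp)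
  then have "AE q in lborel. P (?\<Psi> q)"
    unfolding lborel_prod .
  then obtain N where N: "negligible N" "\<And>q. q \<notin> N \<Longrightarrow> P (?\<Psi> q)"
    using AE_imp_negligible by blast
  have "negligible (?\<Psi> ` N)"
  proof (rule negligible_locally_Lipschitz_image[OF _ N(1)])
    show "\<exists>T B. open T \<and> q' \<in> T \<and> (\<forall>q\<in>N \<inter> T. norm (?\<Psi> q - ?\<Psi> q') \<le> B * norm (q - q'))" for q'
      using \<Psi>_lip[of _ q'] by (intro exI[of _ UNIV] exI[of _ "1 + 4 / 3 + M"]) blast
  qed simp
  from negligible_imp_AE[OF this] show ?thesis
  proof eventually_elim
    case (elim p)
    have "p = ?\<Psi> (label p, fst p)"
      by (simp add: char_label)
    with elim have "(label p, fst p) \<notin> N"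
      by blast
    from N(2)[OF this] show ?case
      by (simp add: char_label)
  qed
qed

end

section \<open>Mollification along characteristics\<close>

lemma mollifier_dir_deriv_translate: "dir_deriv v (mollifier n x0) x = dir_deriv v (mollifier n 0) (x - x0)"
proof -
  have "((\<lambda>x. mollifier n 0 (x - x0)) has_derivative (\<lambda>v. dir_deriv v (mollifier n 0) (x - x0))) (at x)"
    by (rule has_derivative_compose[OF _ smooth_has_derivative[OF mollifier_smooth]])
      (auto intro!: derivative_eq_intros)
  then have "(mollifier n x0 has_derivative (\<lambda>v. dir_deriv v (mollifier n 0) (x - x0))) (at x)"
    by (subst ext[of "mollifier n x0", OF mollifier_translate])
  then show ?thesis
    unfolding dir_deriv_def[of v "mollifier n x0"] by (simp only: frechet_derivative_at[symmetric])
qed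

definition mollify :: "nat \<Rightarrow> ('a::euclidean_space \<Rightarrow> real) \<Rightarrow> 'a \<Rightarrow> real"
  where "mollify n u p = (\<integral>x. u x * mollifier n p x \<partial>lborel)"

text \<open>The mollifier is a function of x - p, so moving its base point with velocity v
  differentiates it in direction - v; hence the minus sign. The Lipschitz bounds of \<gamma> and of
  the mollifier dominate the difference quotients.\<close>

lemma mollify_has_derivative_along:
  fixes u :: "'a::euclidean_space \<Rightarrow> real"
  assumes u[measurable]: "u \<in> borel_measurable borel" and B: "\<And>x. \<bar>u x\<bar> \<le> B"
    and \<gamma>: "C-lipschitz_on {a..b} \<gamma>" "(\<gamma> has_vector_derivative v) (at y within {a..b})"
    and y: "y \<in> {a..b}"
  shows "((\<lambda>y. mollify n u (\<gamma> y)) has_vector_derivative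
    - (\<integral>x. u x * dir_deriv v (mollifier n (\<gamma> y)) x \<partial>lborel)) (at y within {a..b})"
proof -
  let ?m = "mollifier n (0 :: 'a)" and ?D = "dir_deriv v (mollifier n (\<gamma> y))"
    and ?Q = "\<lambda>z x. (mollifier n (\<gamma> z) x - mollifier n (\<gamma> y) x) / (z - y)"
    and ?U = "\<lambda>z. (mollify n u (\<gamma> z) - mollify n u (\<gamma> y)) / (z - y)"
  have B0: "0 \<le> B" using order_trans[OF abs_ge_zero B] .
  have C0: "0 \<le> C" using lipschitz_on_nonneg[OF \<gamma>(1)] .
  have mt: "?m \<in> test_functions UNIV"
    by (rule mollifier_test_function) simp
  obtain D where D: "D \<ge> 0" "\<And>x. \<bar>?m x\<bar> \<le> D" "D-lipschitz_on UNIV ?m"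
    by (rule test_function_bounds[OF mt]) blast
  note [measurable] = mollifier_measurable[of n]
    dir_deriv_measurable[OF mollifier_smooth[of n]]
  have mb: "\<bar>mollifier n p x\<bar> \<le> D" for p x :: 'a
    using D(2) by (simp add: mollifier_translate[of n p])
  have mi: "integrable lborel (\<lambda>x. u x * mollifier n p x)" for p :: 'a
  proof (rule integrable_bounded_compact[where K="corner_box n p" and B="B * D"])
    show "\<bar>u x * mollifier n p x\<bar> \<le> B * D" for x
      unfolding abs_mult by (intro mult_mono B mb B0 abs_ge_zero)
  qed (auto simp: corner_box_def mollifier_zero)
  have lip: "\<bar>mollifier n p x - mollifier n q x\<bar> \<le> D * dist p q" for p q x :: 'a
    using lipschitz_onD[OF D(3), of "x - p" "x - q"]
    by (simp add: mollifier_translate[of n p] mollifier_translate[of n q] dist_norm norm_minus_commute)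
  have "((\<lambda>z. ?U z) \<longlongrightarrow>
      - (\<integral>x. u x * ?D x \<partial>lborel)) (at y within {a..b})"
    unfolding tendsto_at_iff_sequentially comp_def
  proof (intro allI impI)
    fix Y :: "nat \<Rightarrow> real" assume Y: "\<forall>i. Y i \<in> {a..b} - {y}" "Y \<longlonglongrightarrow> y"
    \<comment> \<open>The ball of radius R about \<gamma> y contains all supporting cubes based on
      the curve: the first term bounds the displacement of the corner, the dimension bounds the
      diameter of a cube of side at most 1.\<close>
    define R where "R = C * (b - a) + DIM('a)"
    have q: "?U (Y i) =
        (\<integral>x. u x * (?Q (Y i) x) \<partial>lborel)" for i
    proof -
      have "mollify n u (\<gamma> (Y i)) - mollify n u (\<gamma> y) =
          (\<integral>x. u x * mollifier n (\<gamma> (Y i)) x - u x * mollifier n (\<gamma> y) x \<partial>lborel)"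
        unfolding mollify_def by (rule Bochner_Integration.integral_diff[symmetric, OF mi mi])
      then have "?U (Y i) =
          (\<integral>x. (u x * mollifier n (\<gamma> (Y i)) x - u x * mollifier n (\<gamma> y) x) / (Y i - y) \<partial>lborel)"
        by simp
      then show ?thesis
        by (simp add: right_diff_distrib)
    qed
    have "(\<lambda>i. \<integral>x. u x * (?Q (Y i) x) \<partial>lborel)
        \<longlonglongrightarrow> (\<integral>x. u x * (- ?D x) \<partial>lborel)"
    proof (rule integral_dominated_convergence[where w="\<lambda>x. indicator (cball (\<gamma> y) R) x * (B * (D * C))"])
      show "integrable lborel (\<lambda>x. indicator (cball (\<gamma> y) R) x * (B * (D * C)))"
        using emeasure_bounded_finite[OF bounded_cball, of "\<gamma> y" R] by simp
      show "AE x in lborel. (\<lambda>i. u x * (?Q (Y i) x))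
          \<longlonglongrightarrow> u x * (- ?D x)"
      proof (rule AE_I2, rule tendsto_mult_left)
        fix x
        have lin: "linear (\<lambda>v. dir_deriv v ?m (x - \<gamma> y))"
          using smooth_has_derivative[OF mollifier_smooth] by (rule has_derivative_linear)
        have "((\<lambda>z. ?m (x - \<gamma> z)) has_derivative (\<lambda>h. dir_deriv (- (h *\<^sub>R v)) ?m (x - \<gamma> y))) (at y within {a..b})"
          by (rule has_derivative_compose[OF _ smooth_has_derivative[OF mollifier_smooth]])
            (use \<gamma>(2) in \<open>auto simp: has_vector_derivative_def intro!: derivative_eq_intros\<close>)
        moreover have "dir_deriv (- (h *\<^sub>R v)) ?m (x - \<gamma> y) = - ?D x * h" for h
          using linear_neg[OF lin, of "h *\<^sub>R v"] linear_scale[OF lin, of h v]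
          by (simp add: mollifier_dir_deriv_translate[of v n "\<gamma> y"])
        ultimately have "((\<lambda>z. mollifier n (\<gamma> z) x) has_real_derivative - ?D x) (at y within {a..b})"
          unfolding has_field_derivative_def by (simp only: mollifier_translate[of n "\<gamma> _"])
        then have "((\<lambda>z. ?Q z x) \<longlongrightarrow>
            - ?D x) (at y within {a..b})"
          by (simp add: has_field_derivative_iff)
        then show "(\<lambda>i. ?Q (Y i) x)
            \<longlonglongrightarrow> - ?D x"
          unfolding tendsto_at_iff_sequentially comp_def using Y by blast
      qed
      show "AE x in lborel. norm (u x * (?Q (Y i) x))
          \<le> indicator (cball (\<gamma> y) R) x * (B * (D * C))" for i
      proof (rule AE_I2)
        fix x
        have Yi: "Y i \<in> {a..b}" "Y i \<noteq> y"
          using Y(1) by auto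
        have d: "dist (\<gamma> (Y i)) (\<gamma> y) \<le> C * \<bar>Y i - y\<bar>"
          using lipschitz_onD[OF \<gamma>(1) Yi(1) y] by (simp add: dist_real_def)
        show "norm (u x * (?Q (Y i) x))
            \<le> indicator (cball (\<gamma> y) R) x * (B * (D * C))"
        proof (cases "x \<in> cball (\<gamma> y) R")
          case True
          have "\<bar>mollifier n (\<gamma> (Y i)) x - mollifier n (\<gamma> y) x\<bar> \<le> D * (C * \<bar>Y i - y\<bar>)"
            using lip[of "\<gamma> (Y i)" x "\<gamma> y"] mult_left_mono[OF d D(1)] by linarith
          then have "\<bar>?Q (Y i) x\<bar> \<le> D * C"
            using Yi(2) by (simp add: field_simps)
          then have "\<bar>u x * (?Q (Y i) x)\<bar> \<le> B * (D * C)"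
            unfolding abs_mult[of "u x"] by (intro mult_mono B B0 abs_ge_zero)
          with True show ?thesis
            by simp
        next
          case False
          have out: "x \<notin> corner_box n p" if "dist p (\<gamma> y) \<le> C * (b - a)" for p
          proof
            assume "x \<in> corner_box n p"
            then have "dist p x \<le> DIM('a) / real (Suc n)"
              using corner_box_subset_cball[of n p] by auto
            also have "\<dots> \<le> DIM('a)"
              by (simp add: divide_le_eq)
            finally have "dist (\<gamma> y) x \<le> R"
              using that dist_triangle[of "\<gamma> y" x p] by (simp add: R_def dist_commute)
            with False show False by simp
          qed
          have "C * \<bar>Y i - y\<bar> \<le> C * (b - a)"
            using Yi y C0 by (intro mult_left_mono) auto
          then have "mollifier n (\<gamma> (Y i)) x = 0" "mollifier n (\<gamma> y) x = 0"
            using out[of "\<gamma> (Y i)"] out[of "\<gamma> y"] d y C0 mollifier_zero by auto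
          with False show ?thesis by simp
        qed
      qed
    qed measurable
    then show "(\<lambda>i. ?U (Y i))
        \<longlonglongrightarrow> - (\<integral>x. u x * ?D x \<partial>lborel)"
      unfolding q by simp
  qed
  then show ?thesis
    by (simp add: has_real_derivative_iff_has_vector_derivative[symmetric] has_field_derivative_iff)
qed

lemma mollify_tendsto:
  fixes u :: "'a::euclidean_space \<Rightarrow> real"
  assumes "u \<in> borel_measurable borel" "\<And>x. \<bar>u x\<bar> \<le> B" "lebesgue_point u p"
  shows "(\<lambda>n. mollify n u p) \<longlonglongrightarrow> u p"
proof -
  have ai: "u absolutely_integrable_on cbox a b" for a b
    by (rule absolutely_integrable_bounded_compact[OF assms(1) compact_cbox assms(2)])
  have "(LINT z|lebesgue. u z * mollifier n p z) = mollify n u p" for n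
    unfolding mollify_def using assms(1) mollifier_measurable[of n p] by (simp add: integral_completion)
  with mollifier_lebesgue_point[OF ai assms(3)] show ?thesis by simp
qed

lemma AE_lebesgue_point_bounded:
  fixes u :: "'a::euclidean_space \<Rightarrow> real"
  assumes "u \<in> borel_measurable borel" "\<And>x. \<bar>u x\<bar> \<le> B"
  shows "AE p in lborel. lebesgue_point u p"
  by (rule AE_lebesgue_point, rule absolutely_integrable_bounded_compact[OF assms(1) compact_cbox assms(2)])

lemma mollify_bounded:
  fixes u :: "'a::euclidean_space \<Rightarrow> real"
  assumes [measurable]: "u \<in> borel_measurable borel" and B: "\<And>x. \<bar>u x\<bar> \<le> B"
  shows "\<bar>mollify n u p\<bar> \<le> B"
proof -
  note [measurable] = mollifier_measurable[of n p]
  have mi: "integrable lborel (mollifier n p)"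
    by (rule integrable_continuous_compact_zero[OF smooth_continuous_on[OF mollifier_smooth], of "corner_box n p"])
      (auto simp: corner_box_def mollifier_zero)
  have "norm (mollify n u p) \<le> (\<integral>x. norm (u x * mollifier n p x) \<partial>lborel)"
    unfolding mollify_def by (rule integral_norm_bound)
  also have "\<dots> \<le> (\<integral>x. B * mollifier n p x \<partial>lborel)"
    by (rule integral_mono') (use mi B mollifier_nonneg[of n p] order_trans[OF abs_ge_zero B] in
        \<open>auto simp: abs_mult intro!: mult_right_mono\<close>)
  also have "\<dots> = B"
    by (simp add: integral_mollifier)
  finally show ?thesis by simp
qed

text \<open>The oscillation over a cube of side 1/(n+1) is O(1/(n+1)). Having every point, and not
  almost every point, is what later recovers \<open>F\<close> at all points of a
  characteristic.\<close>

lemma lebesgue_point_lipschitz: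
  fixes F :: "'a::euclidean_space \<Rightarrow> real"
  assumes F: "L-lipschitz_on UNIV F"
  shows "lebesgue_point F p"
  unfolding lebesgue_point_def
proof (rule Lim_null_comparison)
  let ?I = "\<lambda>n. integral (corner_box n p) (\<lambda>z. \<bar>F z - F p\<bar>)"
  have "norm (real (Suc n) ^ DIM('a) * ?I n)
      \<le> L * DIM('a) * inverse (real (Suc n))" for n
  proof -
    let ?b = "L * (DIM('a) / real (Suc n))"
    have ci: "(\<lambda>z. \<bar>F z - F p\<bar>) integrable_on corner_box n p"
      unfolding corner_box_def
      by (intro integrable_continuous continuous_intros continuous_on_subset[OF lipschitz_on_continuous_on[OF F]]) auto
    have "?I n \<le> integral (corner_box n p) (\<lambda>z. ?b)"
    proof (rule integral_le[OF ci])
      show "(\<lambda>z. ?b) integrable_on corner_box n p"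
        unfolding corner_box_def by (rule integrable_const)
      fix z assume "z \<in> corner_box n p"
      then have "dist z p \<le> DIM('a) / real (Suc n)"
        using corner_box_subset_cball[of n p] by (auto simp: dist_commute)
      then have "L * dist z p \<le> ?b"
        using lipschitz_on_nonneg[OF F] by (rule mult_left_mono)
      with lipschitz_onD[OF F, of z p] show "\<bar>F z - F p\<bar> \<le> ?b"
        by (simp add: dist_real_def)
    qed
    also have "\<dots> = (1 / real (Suc n)) ^ DIM('a) * ?b"
      using measure_corner_box[of n p] unfolding corner_box_def by simp
    finally have "real (Suc n) ^ DIM('a) * ?I n
        \<le> real (Suc n) ^ DIM('a) * ((1 / real (Suc n)) ^ DIM('a) * ?b)"
      by (intro mult_left_mono) auto
    moreover have "0 \<le> ?I n"
      by (rule integral_nonneg[OF ci]) simp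
    moreover have "real (Suc n) ^ DIM('a) * ((1 / real (Suc n)) ^ DIM('a) * ?b) = L * DIM('a) * inverse (real (Suc n))"
      by (simp add: mult.assoc[symmetric] power_mult_distrib[symmetric] divide_inverse del: of_nat_Suc)
    ultimately show ?thesis
      by simp
  qed
  then show "eventually (\<lambda>n. norm (real (Suc n) ^ DIM('a) * ?I n)
      \<le> L * DIM('a) * inverse (real (Suc n))) sequentially"
    by simp
  show "(\<lambda>n. L * DIM('a) * inverse (real (Suc n))) \<longlonglongrightarrow> 0"
    using tendsto_mult_left[OF LIMSEQ_inverse_real_of_nat, of "L * DIM('a)"] by simp
qed

text \<open>Dominated convergence after setting all functions to 0 on the exceptional null
  set.\<close>

lemma integral_tendsto_AE:
  fixes f :: "nat \<Rightarrow> real \<Rightarrow> real"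
  assumes f: "\<And>n. f n integrable_on {a..b}" and B: "\<And>n y. y \<in> {a..b} \<Longrightarrow> \<bar>f n y\<bar> \<le> B"
    and ae: "AE y in lborel. y \<in> {a..b} \<longrightarrow> (\<lambda>n. f n y) \<longlonglongrightarrow> g y"
  shows "(\<lambda>n. integral {a..b} (f n)) \<longlonglongrightarrow> integral {a..b} g"
proof -
  obtain N where N: "negligible N" "\<And>y. y \<notin> N \<Longrightarrow> y \<in> {a..b} \<longrightarrow> (\<lambda>n. f n y) \<longlonglongrightarrow> g y"
    using AE_imp_negligible[OF ae] by blast
  let ?f = "\<lambda>n y. if y \<in> N then 0 else f n y" and ?g = "\<lambda>y. if y \<in> N then 0 else g y"
  have "(\<lambda>n. integral {a..b} (?f n)) \<longlonglongrightarrow> integral {a..b} ?g"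
  proof (rule dominated_convergence(2))
    show "?f n integrable_on {a..b}" for n
      by (rule integrable_spike[OF f N(1)]) auto
    show "(\<lambda>y. B) integrable_on {a..b}"
      using integrable_const_ivl by blast
    show "norm (?f n y) \<le> B" if "y \<in> {a..b}" for n y
      using B[OF that, of n] by auto
    show "(\<lambda>n. ?f n y) \<longlonglongrightarrow> ?g y" if "y \<in> {a..b}" for y
      using N(2)[of y] that by auto
  qed
  moreover have "integral {a..b} (?f n) = integral {a..b} (f n)" for n
    by (rule integral_spike[OF N(1)]) auto
  moreover have "integral {a..b} ?g = integral {a..b} g"
    by (rule integral_spike[OF N(1)]) auto
  ultimately show ?thesis by simp
qed

lemma dir_deriv_pair:
  fixes \<phi> :: "real \<times> real \<Rightarrow> real"
  assumes "smooth \<phi>"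
  shows "dir_deriv (a, b) \<phi> x = a * dir_deriv (1, 0) \<phi> x + b * dir_deriv (0, 1) \<phi> x"
proof -
  have "linear (\<lambda>v. dir_deriv v \<phi> x)"
    using smooth_has_derivative[OF assms] by (rule has_derivative_linear)
  from linear_add[OF this, of "a *\<^sub>R (1, 0)" "b *\<^sub>R (0, 1)"]
    linear_scale[OF this, of a "(1, 0)"] linear_scale[OF this, of b "(0, 1)"]
  show ?thesis by simp
qed

text \<open>z / sqrt (1 + z^2) maps the line onto (-1, 1) with inverse w / sqrt (1 - w^2); a
  constant slope therefore means a constant intrinsic gradient.\<close>

lemma slope_abs_less_1: "\<bar>slope f p\<bar> < 1"
  and grad_rep_eq_slope: "grad_rep f p = slope f p / sqrt (1 - (slope f p)\<^sup>2)"
proof -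
  let ?g = "grad_rep f p"
  have pos: "1 + ?g\<^sup>2 > 0"
    by (simp add: add_pos_nonneg)
  have sq: "(slope f p)\<^sup>2 = ?g\<^sup>2 / (1 + ?g\<^sup>2)"
    using pos by (simp add: slope_def power_divide)
  then have "(slope f p)\<^sup>2 < 1"
    using pos by simp
  then show "\<bar>slope f p\<bar> < 1"
    by (simp add: abs_square_less_1)
  have "1 - (slope f p)\<^sup>2 = 1 / (1 + ?g\<^sup>2)"
    unfolding sq using pos by (simp add: field_simps)
  then have "sqrt (1 - (slope f p)\<^sup>2) = 1 / sqrt (1 + ?g\<^sup>2)"
    by (simp add: real_sqrt_divide)
  then show "?g = slope f p / sqrt (1 - (slope f p)\<^sup>2)"
    using pos by (simp add: slope_def)
qed

text \<open>A nonzero value would persist on a nonempty open set, which is not negligible. This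
  upgrades statements on almost every characteristic to every characteristic.\<close>

lemma AE_zero_imp_zero_on_open:
  fixes u :: "'a::euclidean_space \<Rightarrow> real"
  assumes J: "open J" and u: "continuous_on J u" and ae: "AE s in lborel. s \<in> J \<longrightarrow> u s = 0" and s: "s \<in> J"
  shows "u s = 0"
proof (rule ccontr)
  assume "u s \<noteq> 0"
  obtain N where N: "negligible N" "\<And>s. s \<notin> N \<Longrightarrow> s \<in> J \<longrightarrow> u s = 0"
    using AE_imp_negligible[OF ae] by blast
  have "open (J \<inter> u -` (- {0}))"
    by (rule continuous_open_preimage[OF u J]) (simp add: open_Compl)
  moreover have "s \<in> J \<inter> u -` (- {0})"
    using s \<open>u s \<noteq> 0\<close> by simp
  moreover have "negligible (J \<inter> u -` (- {0}))"
    by (rule negligible_subset[OF N(1)]) (use N(2) in blast)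
  ultimately show False
    using open_not_negligible by blast
qed

text \<open>The tube condition keeps the characteristics with label in J at a uniform distance from
  the complement of W, so that small mollifiers based on them are admissible in the first
  variation.\<close>

locale stationary_flow = characteristics +
  fixes W :: "(real \<times> real) set" and J :: "real set" and r :: real
  assumes first_var: "\<And>\<phi>. \<phi> \<in> test_functions W \<Longrightarrow> (\<integral>p. slope F p * variation F \<phi> p \<partial>lborel) = 0"
    and r_pos: "r > 0" and J_open: "open J"
    and tube: "\<And>s y. s \<in> J \<Longrightarrow> y \<in> {c..d} \<Longrightarrow> cball (y, char s y) r \<subseteq> W"
begin

abbreviation "Fy \<equiv> quot_deriv (1, 0) F"
abbreviation "Ft \<equiv> quot_deriv (0, 1) F"

lemma F_meas: "F \<in> borel_measurable borel"
  by (rule borel_measurable_continuous_onI[OF F_continuous_on])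

lemma Fy_bound: "\<bar>Fy p\<bar> \<le> L" and Ft_bound: "\<bar>Ft p\<bar> \<le> L"
  using quot_deriv_bound[OF lip open_UNIV, of p "(1, 0)"] quot_deriv_bound[OF lip open_UNIV, of p "(0, 1)"]
  by (simp_all add: norm_Pair)

lemma slope_bound: "\<bar>slope F p\<bar> \<le> 1"
  using slope_abs_less_1[of F p] by simp

lemma measurables:
  "F \<in> borel_measurable borel" "quot_deriv v F \<in> borel_measurable borel" "slope F \<in> borel_measurable borel"
  "grad_rep F \<in> borel_measurable borel"
  using F_meas by (auto intro: quot_deriv_measurable slope_measurable grad_rep_measurable)

lemma weak_identity:
  assumes v: "v = (1, 0) \<or> v = (0, 1)" and \<phi>: "\<phi> \<in> test_functions UNIV"
  shows "(\<integral>x. F x * dir_deriv v \<phi> x \<partial>lborel) = - (\<integral>x. quot_deriv v F x * \<phi> x \<partial>lborel)"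
proof -
  have ll: "locally_lipschitz_on UNIV F"
    unfolding locally_lipschitz_on_def using lipschitz_on_subset[OF lip] by (metis subset_UNIV zero_less_one)
  have "weak_deriv UNIV v F (quot_deriv v F)"
    by (rule weak_deriv_quot_deriv_borel[OF F_meas open_UNIV ll
          locally_lipschitz_AE_convergent[OF open_UNIV ll v]])
  then have "(LINT x:UNIV|lebesgue. F x * dir_deriv v \<phi> x) = - (LINT x:UNIV|lebesgue. quot_deriv v F x * \<phi> x)"
    using \<phi> unfolding weak_deriv_def by blast
  moreover have "(LINT x:UNIV|lebesgue. F x * dir_deriv v \<phi> x) = (\<integral>x. F x * dir_deriv v \<phi> x \<partial>lborel)"
    by (rule LINT_restrict)
      (use test_functionsD(1)[OF \<phi>] F_meas in \<open>auto intro: dir_deriv_measurable\<close>)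
  moreover have "(LINT x:UNIV|lebesgue. quot_deriv v F x * \<phi> x) = (\<integral>x. quot_deriv v F x * \<phi> x \<partial>lborel)"
    by (rule LINT_restrict)
      (use test_functionsD(1)[OF \<phi>] measurables(2) in \<open>auto intro: smooth_measurable\<close>)
  ultimately show ?thesis by simp
qed

text \<open>Integration by parts against the constant function 1.\<close>

lemma integral_dir_deriv_zero:
  fixes v :: "real \<times> real"
  assumes \<phi>: "\<phi> \<in> test_functions UNIV"
  shows "(\<integral>x. dir_deriv v \<phi> x \<partial>lborel) = 0"
proof -
  have q: "diff_quot v (\<lambda>x :: real \<times> real. 1) n x = 0" for n x
    by (simp add: diff_quot_def)
  then have q0: "quot_deriv v (\<lambda>x :: real \<times> real. 1) x = 0" for x
    by (intro quot_deriv_eqI) simp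
  have ll: "locally_lipschitz_on UNIV (\<lambda>x :: real \<times> real. 1 :: real)"
    unfolding locally_lipschitz_on_def using lipschitz_on_constant by (metis zero_less_one)
  have "weak_deriv UNIV v (\<lambda>x :: real \<times> real. 1) (quot_deriv v (\<lambda>x. 1))"
    by (rule weak_deriv_quot_deriv_borel[OF _ open_UNIV ll]) (auto simp: q convergent_const)
  then have "(LINT x:UNIV|lebesgue. 1 * dir_deriv v \<phi> x) = - (LINT x:UNIV|lebesgue. quot_deriv v (\<lambda>x. 1) x * \<phi> x)"
    using \<phi> unfolding weak_deriv_def by blast
  moreover have "(LINT x:UNIV|lebesgue. 1 * dir_deriv v \<phi> x) = (\<integral>x. 1 * dir_deriv v \<phi> x \<partial>lborel)"
    by (rule LINT_restrict) (use test_functionsD(1)[OF \<phi>] dir_deriv_measurable in auto)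
  ultimately show ?thesis
    by (simp add: q0)
qed

section \<open>Drift and commutator of the mollified functions\<close>

lemma mollifier_test_UNIV: "mollifier n (p :: real \<times> real) \<in> test_functions UNIV"
  by (rule mollifier_test_function) simp

lemma dir_deriv_mollifier_zero: "x \<notin> corner_box n p \<Longrightarrow> dir_deriv v (mollifier n p) x = 0"
  using spt_mollifier[of n p] by (intro dir_deriv_zero_outside_spt) blast

lemma integrable_mult_mollifier:
  assumes u: "u \<in> borel_measurable borel" "\<And>x. \<bar>u x\<bar> \<le> B"
  shows "integrable lborel (\<lambda>x. u x * mollifier n (p :: real \<times> real) x)"
    and "integrable lborel (\<lambda>x. u x * dir_deriv v (mollifier n (p :: real \<times> real)) x)"
proof -
  obtain C where C: "\<And>x. \<bar>mollifier n p x\<bar> \<le> C" "\<And>v x. \<bar>dir_deriv v (mollifier n p) x\<bar> \<le> C * norm v"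
    by (rule test_function_bounds[OF mollifier_test_UNIV]) blast
  have B0: "0 \<le> B" using order_trans[OF abs_ge_zero u(2)] .
  note m = mollifier_measurable[of n p] dir_deriv_measurable[OF mollifier_smooth[of n p]]
  show "integrable lborel (\<lambda>x. u x * mollifier n p x)"
  proof (rule integrable_bounded_compact[where K="corner_box n p" and B="B * C"])
    show "\<bar>u x * mollifier n p x\<bar> \<le> B * C" for x
      unfolding abs_mult by (intro mult_mono u C B0 abs_ge_zero)
  qed (use u m in \<open>auto simp: mollifier_zero corner_box_def\<close>)
  show "integrable lborel (\<lambda>x. u x * dir_deriv v (mollifier n p) x)"
  proof (rule integrable_bounded_compact[where K="corner_box n p" and B="B * (C * norm v)"])
    show "\<bar>u x * dir_deriv v (mollifier n p) x\<bar> \<le> B * (C * norm v)" for x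
      unfolding abs_mult by (intro mult_mono u C B0 abs_ge_zero)
  qed (use u m dir_deriv_mollifier_zero[of _ n p v] in \<open>auto simp: corner_box_def\<close>)
qed

text \<open>Minus the derivative of \<open>mollify n u\<close> at \<open>p\<close> along the vector \<open>(1, F p)\<close>.\<close>

definition drift :: "nat \<Rightarrow> (real \<times> real \<Rightarrow> real) \<Rightarrow> real \<times> real \<Rightarrow> real"
  where "drift n u p = (\<integral>x. u x * dir_deriv (1, F p) (mollifier n p) x \<partial>lborel)"

definition commutator :: "nat \<Rightarrow> real \<times> real \<Rightarrow> real \<times> real \<Rightarrow> real"
  where "commutator n p x = (F x - F p) * dir_deriv (0, 1) (mollifier n p) x + Ft x * mollifier n p x"

lemma integrable_mult_commutator:
  assumes u: "u \<in> borel_measurable borel" "\<And>x. \<bar>u x\<bar> \<le> B"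
  shows "integrable lborel (\<lambda>x. u x * commutator n p x)"
proof -
  have B0: "0 \<le> B" using order_trans[OF abs_ge_zero u(2)] .
  note [measurable] = u(1) F_meas measurables(2)
  have 1: "\<bar>u x * (F x - F p)\<bar> \<le> B * (M + M)" for x
    unfolding abs_mult using bound[of x] bound[of p] by (intro mult_mono u B0) auto
  have 2: "\<bar>u x * Ft x\<bar> \<le> B * L" for x
    unfolding abs_mult by (intro mult_mono u B0 Ft_bound) auto
  have "integrable lborel (\<lambda>x. (u x * (F x - F p)) * dir_deriv (0, 1) (mollifier n p) x + (u x * Ft x) * mollifier n p x)"
    by (intro Bochner_Integration.integrable_add integrable_mult_mollifier(2)[OF _ 1]
        integrable_mult_mollifier(1)[OF _ 2] borel_measurable_times borel_measurable_diff
        u(1) F_meas measurables(2) borel_measurable_const)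
  then show ?thesis
    by (simp add: commutator_def algebra_simps)
qed

lemma integral_commutator: "(\<integral>x. commutator n p x \<partial>lborel) = 0"
proof -
  note i = integrable_mult_mollifier
  have iF: "integrable lborel (\<lambda>x. F x * dir_deriv (0, 1) (mollifier n p) x)"
    by (rule i(2)[OF F_meas bound])
  have i1: "integrable lborel (\<lambda>x. F p * dir_deriv (0, 1) (mollifier n p) x)"
    by (rule i(2)[of _ "\<bar>F p\<bar>"]) auto
  have it: "integrable lborel (\<lambda>x. Ft x * mollifier n p x)"
    by (rule i(1)[OF measurables(2) Ft_bound])
  have "(\<integral>x. commutator n p x \<partial>lborel) = (\<integral>x. (F x * dir_deriv (0, 1) (mollifier n p) x
      - F p * dir_deriv (0, 1) (mollifier n p) x) + Ft x * mollifier n p x \<partial>lborel)"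
    by (simp add: commutator_def left_diff_distrib)
  also have "\<dots> = (\<integral>x. F x * dir_deriv (0, 1) (mollifier n p) x \<partial>lborel)
      - F p * (\<integral>x. dir_deriv (0, 1) (mollifier n p) x \<partial>lborel) + (\<integral>x. Ft x * mollifier n p x \<partial>lborel)"
    using iF i1 it
    by (subst Bochner_Integration.integral_add, simp, simp, subst Bochner_Integration.integral_diff) auto
  also have "\<dots> = 0"
    using weak_identity[OF _ mollifier_test_UNIV, of "(0, 1)" n p]
      integral_dir_deriv_zero[OF mollifier_test_UNIV, of "(0, 1)" n p] by simp
  finally show ?thesis .
qed

text \<open>The first variation tested with the mollifier vanishes and exchanges the drift for the
  commutator; the zero mean of the commutator allows subtracting the value at p.\<close>

lemma drift_slope:
  assumes "corner_box n p \<subseteq> W"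
  shows "- drift n (slope F) p = (\<integral>x. (slope F x - slope F p) * commutator n p x \<partial>lborel)"
proof -
  let ?h = "slope F" and ?m = "mollifier n p"
  have iv: "integrable lborel (\<lambda>x. ?h x * dir_deriv v ?m x)" for v
    by (rule integrable_mult_mollifier(2)[OF measurables(3) slope_bound])
  have ik: "integrable lborel (\<lambda>x. ?h x * commutator n p x)"
    by (rule integrable_mult_commutator[OF measurables(3) slope_bound])
  have ic: "integrable lborel (\<lambda>x. ?h p * commutator n p x)"
    by (rule integrable_mult_commutator[of _ "\<bar>?h p\<bar>"]) auto
  have "?h x * variation F ?m x = ?h x * dir_deriv (1, F p) ?m x + ?h x * commutator n p x" for x
    by (simp add: variation_def commutator_def dir_deriv_pair[OF mollifier_smooth, of 1 "F p"] algebra_simps)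
  then have "0 = (\<integral>x. ?h x * dir_deriv (1, F p) ?m x + ?h x * commutator n p x \<partial>lborel)"
    using first_var[OF mollifier_test_function[OF assms]] by simp
  also have "\<dots> = drift n ?h p + (\<integral>x. ?h x * commutator n p x \<partial>lborel)"
    unfolding drift_def by (rule Bochner_Integration.integral_add[OF iv ik])
  finally have "- drift n ?h p = (\<integral>x. ?h x * commutator n p x \<partial>lborel) - ?h p * (\<integral>x. commutator n p x \<partial>lborel)"
    by (simp add: integral_commutator)
  also have "\<dots> = (\<integral>x. ?h x * commutator n p x - ?h p * commutator n p x \<partial>lborel)"
    using Bochner_Integration.integral_diff[OF ik ic] by simp
  finally show ?thesis
    by (simp add: left_diff_distrib)
qed

text \<open>On the cube |F x - F p| is at most 2 L / (n+1), with 2 the dimension, which absorbs the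
  extra factor n + 1 of the derivative. The two summands contribute 2 L C and L C.\<close>

lemma commutator_bound:
  obtains K where "K \<ge> 0" "\<And>n p x. \<bar>commutator n p x\<bar> \<le> K * real (Suc n) ^ DIM(real \<times> real)"
    "\<And>n p x. x \<notin> corner_box n p \<Longrightarrow> commutator n p x = 0"
proof -
  obtain C where C: "C \<ge> 0"
    "\<And>n x0 x. \<bar>mollifier n (x0 :: real \<times> real) x\<bar> \<le> C * real (Suc n) ^ DIM(real \<times> real)"
    "\<And>n v x0 x. \<bar>dir_deriv v (mollifier n (x0 :: real \<times> real)) x\<bar> \<le> C * real (Suc n) ^ (DIM(real \<times> real) + 1) * norm v"
    by (rule mollifier_bounds[where 'a="real \<times> real"]) blast
  have zero: "commutator n p x = 0" if "x \<notin> corner_box n p" for n p x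
    using that by (simp add: commutator_def mollifier_zero dir_deriv_mollifier_zero)
  have "\<bar>commutator n p x\<bar> \<le> (3 * L * C) * real (Suc n) ^ DIM(real \<times> real)" for n p x
  proof (cases "x \<in> corner_box n p")
    case True
    let ?c = "real (Suc n)"
    have "dist x p \<le> 2 / ?c"
      using True corner_box_subset_cball[of n p] by (auto simp: dist_commute)
    then have "L * dist x p \<le> L * (2 / ?c)"
      using L_nonneg by (rule mult_left_mono)
    with lipschitz_onD[OF lip, of x p] have Fx: "\<bar>F x - F p\<bar> \<le> L * (2 / ?c)"
      by (simp add: dist_real_def)
    have "\<bar>dir_deriv (0, 1) (mollifier n p) x\<bar> \<le> C * ?c ^ 3"
      using C(3)[of "(0, 1)" n p x] by (simp add: norm_Pair numeral_3_eq_3 del: of_nat_Suc)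
    then have "\<bar>(F x - F p) * dir_deriv (0, 1) (mollifier n p) x\<bar> \<le> (L * (2 / ?c)) * (C * ?c ^ 3)"
      unfolding abs_mult using Fx L_nonneg by (intro mult_mono) auto
    moreover have "(L * (2 / ?c)) * (C * ?c ^ 3) = 2 * L * C * ?c ^ 2"
      by (simp add: field_simps power3_eq_cube power2_eq_square del: of_nat_Suc)
    moreover have "\<bar>Ft x * mollifier n p x\<bar> \<le> L * (C * ?c ^ 2)"
      unfolding abs_mult using C(2)[of n p x] L_nonneg
      by (intro mult_mono Ft_bound) (auto simp del: of_nat_Suc simp: numeral_2_eq_2)
    ultimately have "\<bar>commutator n p x\<bar> \<le> 3 * L * C * ?c ^ 2"
      unfolding commutator_def by linarith
    then show ?thesis
      by (simp add: numeral_2_eq_2 del: of_nat_Suc)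
  next
    case False
    then show ?thesis
      using zero C(1) L_nonneg by simp
  qed
  then show ?thesis
    using that[of "3 * L * C"] C(1) L_nonneg zero by simp
qed

lemma drift_slope_tendsto:
  assumes p: "lebesgue_point (slope F) p" and W: "open W" "p \<in> W"
  shows "(\<lambda>n. drift n (slope F) p) \<longlonglongrightarrow> 0"
proof -
  obtain K where K: "\<And>n x. \<bar>commutator n p x\<bar> \<le> K * real (Suc n) ^ DIM(real \<times> real)"
    "\<And>n x. x \<notin> corner_box n p \<Longrightarrow> commutator n p x = 0"
    by (rule commutator_bound) blast
  have ai: "slope F absolutely_integrable_on cbox a b" for a b
    by (rule absolutely_integrable_bounded_compact[OF measurables(3) compact_cbox slope_bound])
  have "(\<lambda>n. LINT x|lebesgue. (slope F x - slope F p) * commutator n p x) \<longlonglongrightarrow> 0"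
    by (rule lebesgue_point_kernel[OF ai p K])
  moreover have "(LINT x|lebesgue. (slope F x - slope F p) * commutator n p x)
      = (\<integral>x. (slope F x - slope F p) * commutator n p x \<partial>lborel)" for n
  proof (rule integral_completion)
    note [measurable] = measurables mollifier_measurable[of n p]
      dir_deriv_measurable[OF mollifier_smooth[of n p]]
    show "(\<lambda>x. (slope F x - slope F p) * commutator n p x) \<in> borel_measurable lborel"
      unfolding commutator_def by measurable
  qed
  ultimately have "(\<lambda>n. \<integral>x. (slope F x - slope F p) * commutator n p x \<partial>lborel) \<longlonglongrightarrow> 0"
    by simp
  moreover have "eventually (\<lambda>n. (\<integral>x. (slope F x - slope F p) * commutator n p x \<partial>lborel) = - drift n (slope F) p) sequentially"
    using eventually_corner_box_subset[OF W] by eventually_elim (simp add: drift_slope)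
  ultimately have "(\<lambda>n. - drift n (slope F) p) \<longlonglongrightarrow> 0"
    by (rule Lim_transform_eventually)
  then show ?thesis
    using tendsto_minus by fastforce
qed

text \<open>Two values of the slope differ by at most 2, and the kernel bound times the volume of
  the cube is K. This is the domination used on characteristics.\<close>

lemma drift_slope_bound:
  obtains K where "\<And>n p. corner_box n p \<subseteq> W \<Longrightarrow> \<bar>drift n (slope F) p\<bar> \<le> K"
proof -
  obtain K where K: "K \<ge> 0" "\<And>n p x. \<bar>commutator n p x\<bar> \<le> K * real (Suc n) ^ DIM(real \<times> real)"
    "\<And>n p x. x \<notin> corner_box n p \<Longrightarrow> commutator n p x = 0"
    by (rule commutator_bound) blast
  have "\<bar>drift n (slope F) p\<bar> \<le> 2 * K" if "corner_box n p \<subseteq> W" for n p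
  proof -
    let ?B = "2 * (K * real (Suc n) ^ DIM(real \<times> real))"
    have e: "emeasure lborel (corner_box n p) < \<infinity>"
      unfolding corner_box_def by (rule emeasure_bounded_finite[OF bounded_cbox])
    have "norm (\<integral>x. (slope F x - slope F p) * commutator n p x \<partial>lborel)
        \<le> (\<integral>x. norm ((slope F x - slope F p) * commutator n p x) \<partial>lborel)"
      by (rule integral_norm_bound)
    also have "\<dots> \<le> (\<integral>x. ?B * indicator (corner_box n p) x \<partial>lborel)"
    proof (rule integral_mono')
      show "integrable lborel (\<lambda>x. ?B * indicator (corner_box n p) x)"
        using e by (simp add: corner_box_def)
      show "norm ((slope F x - slope F p) * commutator n p x) \<le> ?B * indicator (corner_box n p) x" for x
      proof (cases "x \<in> corner_box n p")
        case True
        have "\<bar>(slope F x - slope F p) * commutator n p x\<bar> \<le> ?B"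
          unfolding abs_mult using slope_bound[of x] slope_bound[of p]
          by (intro mult_mono K(2)) auto
        with True show ?thesis by simp
      qed (use K(3) in simp)
    qed (use K(1) in auto)
    also have "\<dots> = ?B * measure lborel (corner_box n p)"
      by simp
    also have "measure lborel (corner_box n p) = (1 / real (Suc n)) ^ DIM(real \<times> real)"
      using measure_corner_box[of n p] by (simp add: corner_box_def)
    also have "?B * (1 / real (Suc n)) ^ DIM(real \<times> real) = 2 * K"
      by (simp add: mult.assoc power_mult_distrib[symmetric] del: of_nat_Suc)
    finally show ?thesis
      using drift_slope[OF that] by (metis abs_minus_cancel real_norm_def)
  qed
  then show ?thesis
    using that by blast
qed

text \<open>The counterpart of \<open>drift_slope\<close> for \<open>F\<close>: both partial
  derivatives pass to \<open>F\<close> by parts, with F p frozen, so the limit is the intrinsic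
  gradient instead of 0.\<close>

lemma drift_F: "- drift n F p = mollify n Fy p + F p * mollify n Ft p"
proof -
  have iv: "integrable lborel (\<lambda>x. F x * dir_deriv v (mollifier n p) x)" for v
    by (rule integrable_mult_mollifier(2)[OF F_meas bound])
  have "drift n F p = (\<integral>x. F x * dir_deriv (1, 0) (mollifier n p) x + F p * (F x * dir_deriv (0, 1) (mollifier n p) x) \<partial>lborel)"
    unfolding drift_def by (simp add: dir_deriv_pair[OF mollifier_smooth, of 1 "F p"] algebra_simps)
  also have "\<dots> = (\<integral>x. F x * dir_deriv (1, 0) (mollifier n p) x \<partial>lborel)
      + F p * (\<integral>x. F x * dir_deriv (0, 1) (mollifier n p) x \<partial>lborel)"
    using iv by (subst Bochner_Integration.integral_add) auto
  finally show ?thesis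
    using weak_identity[OF _ mollifier_test_UNIV, of "(1, 0)" n p] weak_identity[OF _ mollifier_test_UNIV, of "(0, 1)" n p]
    by (simp add: mollify_def)
qed

lemma drift_F_tendsto:
  assumes "lebesgue_point Fy p" "lebesgue_point Ft p"
  shows "(\<lambda>n. - drift n F p) \<longlonglongrightarrow> grad_rep F p"
  unfolding drift_F grad_rep_def
  by (intro tendsto_add tendsto_mult_left mollify_tendsto[OF measurables(2) Fy_bound assms(1)]
      mollify_tendsto[OF measurables(2) Ft_bound assms(2)])

lemma drift_F_bound: "\<bar>drift n F p\<bar> \<le> L + M * L"
proof -
  have "\<bar>F p * mollify n Ft p\<bar> \<le> M * L"
    unfolding abs_mult using M_nonneg by (intro mult_mono bound mollify_bounded[OF measurables(2) Ft_bound]) auto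
  with mollify_bounded[OF measurables(2) Fy_bound, of n p] drift_F[of n p] show ?thesis
    by linarith
qed

section \<open>Integration along the characteristics\<close>

lemma curve_has_derivative:
  assumes "y \<in> {c..d}"
  shows "((\<lambda>y. (y, char s y)) has_vector_derivative (1, F (y, char s y))) (at y within {c..d})"
  using char_has_derivative[OF assms, of s]
  by (auto intro!: derivative_eq_intros simp: has_vector_derivative_Pair)

lemma curve_lipschitz: "(1 + M)-lipschitz_on S (\<lambda>y. (y, char s y))"
proof (rule lipschitz_onI)
  fix y y'
  have "dist (y, char s y) (y', char s y') \<le> dist y y' + dist (char s y) (char s y')"
    using norm_Pair_le[of "y - y'" "char s y - char s y'"] by (simp add: dist_norm)
  also have "\<dots> \<le> dist y y' + M * dist y y'"
    using char_lip[of s y y'] by (simp add: dist_real_def)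
  finally show "dist (y, char s y) (y', char s y') \<le> (1 + M) * dist y y'"
    by (simp add: algebra_simps)
qed (use M_nonneg in simp)

lemma mollify_along:
  assumes u: "u \<in> borel_measurable borel" "\<And>x. \<bar>u x\<bar> \<le> B" and y: "c \<le> y1" "y1 \<le> y2" "y2 \<le> d"
  shows "((\<lambda>y. - drift n u (y, char s y)) has_integral
    (mollify n u (y2, char s y2) - mollify n u (y1, char s y1))) {y1..y2}"
proof (rule fundamental_theorem_of_calculus[OF y(2)])
  fix y assume "y \<in> {y1..y2}"
  with y have yy: "y \<in> {c..d}" by auto
  have "((\<lambda>y. mollify n u (y, char s y)) has_vector_derivative - drift n u (y, char s y)) (at y within {c..d})"
    unfolding drift_def by (rule mollify_has_derivative_along[OF u curve_lipschitz curve_has_derivative[OF yy] yy])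
  then show "((\<lambda>y. mollify n u (y, char s y)) has_vector_derivative - drift n u (y, char s y)) (at y within {y1..y2})"
    by (rule has_vector_derivative_within_subset) (use y in auto)
qed

text \<open>Both drift limits are integrated along the curve. The slopes are compared only between
  parameters outside a null set N, whereas \<open>F\<close> is recovered at every parameter, so the
  affine formula holds on all of [c, d].\<close>

lemma affine_along_AE:
  assumes W: "open W"
  shows "AE s in lborel. s \<in> J \<longrightarrow> (\<exists>G. (\<forall>y\<in>{c..d}. F (y, char s y) = F (c, s) + G * (y - c)) \<and>
    (AE y in lborel. y \<in> {c..d} \<longrightarrow> grad_rep F (y, char s y) = G))"
proof -
  obtain K where K: "\<And>n p. corner_box n p \<subseteq> W \<Longrightarrow> \<bar>drift n (slope F) p\<bar> \<le> K"
    by (rule drift_slope_bound) blast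
  \<comment> \<open>Raising the index by \<open>n0\<close> keeps every cube within distance r of its
    corner, hence inside W.\<close>
  obtain n0 where n0: "real DIM(real \<times> real) / real (Suc n0) < r"
  proof -
    obtain n0 where "1 / real (Suc n0) < r / 2"
      using nat_approx_posE[of "r / 2"] r_pos by auto
    then show ?thesis
      by (intro that[of n0]) (simp add: field_simps)
  qed
  have cb: "corner_box (n + n0) p \<subseteq> cball p r" for n and p :: "real \<times> real"
  proof -
    have "real DIM(real \<times> real) / real (Suc (n + n0)) \<le> real DIM(real \<times> real) / real (Suc n0)"
      by (intro divide_left_mono) auto
    with n0 have "real DIM(real \<times> real) / real (Suc (n + n0)) \<le> r"
      by linarith
    from subset_cball[OF this, of p] corner_box_subset_cball[of "n + n0" p] show ?thesis
      by blast
  qed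
  have "AE p in lborel. lebesgue_point (slope F) p \<and> lebesgue_point Fy p \<and> lebesgue_point Ft p"
    using AE_lebesgue_point_bounded[OF measurables(3) slope_bound] AE_lebesgue_point_bounded[OF measurables(2) Fy_bound]
      AE_lebesgue_point_bounded[OF measurables(2) Ft_bound] by eventually_elim simp
  from AE_along_characteristics[OF this] show ?thesis
  proof eventually_elim
    case (elim s)
    show ?case
    proof
      assume s: "s \<in> J"
      let ?\<gamma> = "\<lambda>y. (y, char s y)"
      obtain N where N: "negligible N" and LP: "\<And>y. y \<notin> N \<Longrightarrow> lebesgue_point (slope F) (?\<gamma> y)"
          "\<And>y. y \<notin> N \<Longrightarrow> lebesgue_point Fy (?\<gamma> y)" "\<And>y. y \<notin> N \<Longrightarrow> lebesgue_point Ft (?\<gamma> y)"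
        using AE_imp_negligible[OF elim] by metis
      note AEN = negligible_imp_AE[OF N]
      have inW: "?\<gamma> y \<in> W" if "y \<in> {c..d}" for y
        using tube[OF s that] r_pos by auto
      have cbW: "corner_box (n + n0) (?\<gamma> y) \<subseteq> W" if "y \<in> {c..d}" for n y
        using cb tube[OF s that] by blast
      have slope_const: "slope F (?\<gamma> y2) = slope F (?\<gamma> y1)"
        if y: "y1 \<in> {c..d} - N" "y2 \<in> {c..d} - N" "y1 \<le> y2" for y1 y2
      proof -
        let ?\<Delta> = "\<lambda>n. mollify (n + n0) (slope F) (?\<gamma> y2) - mollify (n + n0) (slope F) (?\<gamma> y1)"
          and ?v = "\<lambda>n y. - drift (n + n0) (slope F) (?\<gamma> y)"
        have mi: "(?v n has_integral ?\<Delta> n) {y1..y2}" for n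
          by (rule mollify_along[OF measurables(3) slope_bound]) (use y in auto)
        have "(\<lambda>n. integral {y1..y2} (?v n)) \<longlonglongrightarrow> integral {y1..y2} (\<lambda>y. 0)"
        proof (rule integral_tendsto_AE[where B=K])
          show "(?v n) integrable_on {y1..y2}" for n
            using mi by blast
          show "\<bar>?v n y\<bar> \<le> K" if "y \<in> {y1..y2}" for n y
            using K[OF cbW, of y n] that y by simp
          show "AE y in lborel. y \<in> {y1..y2} \<longrightarrow> (\<lambda>n. ?v n y) \<longlonglongrightarrow> 0"
            using AEN
          proof eventually_elim
            case (elim x)
            show ?case
            proof
              assume "x \<in> {y1..y2}"
              then have "x \<in> {c..d}" using y by auto
              from drift_slope_tendsto[OF LP(1)[OF elim] W inW[OF this]]
              have "(\<lambda>n. - drift n (slope F) (?\<gamma> x)) \<longlonglongrightarrow> - 0"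
                by (rule tendsto_minus)
              then show "(\<lambda>n. ?v n x) \<longlonglongrightarrow> 0"
                by (intro LIMSEQ_ignore_initial_segment) simp
            qed
          qed
        qed
        then have "(\<lambda>n. ?\<Delta> n) \<longlonglongrightarrow> 0"
          using integral_unique[OF mi] by simp
        moreover have "(\<lambda>n. ?\<Delta> n)
            \<longlonglongrightarrow> slope F (?\<gamma> y2) - slope F (?\<gamma> y1)"
          using y LP(1) by (intro tendsto_diff LIMSEQ_ignore_initial_segment
              mollify_tendsto[OF measurables(3) slope_bound]) auto
        ultimately show ?thesis
          using LIMSEQ_unique by fastforce
      qed
      \<comment> \<open>A parameter outside N serves as the reference point at which the constant
        value of the slope is read off.\<close>
      have "\<not> {c..d} \<subseteq> N"
        using negligible_subset[OF N, of "{c..d}"] negligible_interval(1)[of c d] cd by (auto simp: box_real)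
      then obtain y0 where y0: "y0 \<in> {c..d} - N" by blast
      define k where "k = slope F (?\<gamma> y0)"
      define G where "G = k / sqrt (1 - k\<^sup>2)"
      have G: "grad_rep F (?\<gamma> y) = G" if "y \<in> {c..d} - N" for y
      proof -
        have "slope F (?\<gamma> y) = k"
          unfolding k_def using slope_const[OF that y0] slope_const[OF y0 that] by (cases "y \<le> y0") auto
        then show ?thesis
          by (simp add: G_def grad_rep_eq_slope)
      qed
      have "F (?\<gamma> y) = F (c, s) + G * (y - c)" if y: "y \<in> {c..d}" for y
      proof -
        have mi: "((\<lambda>y. - drift n F (?\<gamma> y)) has_integral (mollify n F (?\<gamma> y) - mollify n F (?\<gamma> c))) {c..y}" for n
          by (rule mollify_along[OF F_meas bound]) (use y in auto)
        have "(\<lambda>n. integral {c..y} (\<lambda>y. - drift n F (?\<gamma> y))) \<longlonglongrightarrow> integral {c..y} (\<lambda>y. grad_rep F (?\<gamma> y))"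
        proof (rule integral_tendsto_AE[where B="L + M * L"])
          show "(\<lambda>y. - drift n F (?\<gamma> y)) integrable_on {c..y}" for n
            using mi by blast
          show "\<bar>- drift n F (?\<gamma> y)\<bar> \<le> L + M * L" for n y
            using drift_F_bound by simp
          show "AE x in lborel. x \<in> {c..y} \<longrightarrow> (\<lambda>n. - drift n F (?\<gamma> x)) \<longlonglongrightarrow> grad_rep F (?\<gamma> x)"
            using AEN by eventually_elim (use drift_F_tendsto LP(2,3) in blast)
        qed
        moreover have "integral {c..y} (\<lambda>y. grad_rep F (?\<gamma> y)) = integral {c..y} (\<lambda>y. G)"
          by (rule integral_spike[OF N]) (use G y in auto)
        ultimately have "(\<lambda>n. mollify n F (?\<gamma> y) - mollify n F (?\<gamma> c)) \<longlonglongrightarrow> G * (y - c)"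
          using integral_unique[OF mi] y by (simp add: mult.commute)
        moreover have "(\<lambda>n. mollify n F (?\<gamma> y) - mollify n F (?\<gamma> c)) \<longlonglongrightarrow> F (?\<gamma> y) - F (?\<gamma> c)"
          by (intro tendsto_diff mollify_tendsto[OF F_meas bound] lebesgue_point_lipschitz[OF lip])
        ultimately have "F (?\<gamma> y) - F (?\<gamma> c) = G * (y - c)"
          using LIMSEQ_unique by blast
        then show ?thesis
          by (simp add: char_start)
      qed
      moreover have "AE y in lborel. y \<in> {c..d} \<longrightarrow> grad_rep F (?\<gamma> y) = G"
        using AEN by eventually_elim (use G in auto)
      ultimately show "\<exists>G. (\<forall>y\<in>{c..d}. F (?\<gamma> y) = F (c, s) + G * (y - c)) \<and>
          (AE y in lborel. y \<in> {c..d} \<longrightarrow> grad_rep F (?\<gamma> y) = G)"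
        by blast
    qed
  qed
qed

section \<open>The slope as a Lipschitz function of the label\<close>

definition slope_at :: "real \<Rightarrow> real"
  where "slope_at s = (F (d, char s d) - F (c, s)) / (d - c)"

lemma F_char_lip: "\<bar>F (y, char s y) - F (y, char s' y)\<bar> \<le> L * (4 / 3) * \<bar>s - s'\<bar>"
  using F_lip_snd[of y "char s y" "char s' y"] mult_left_mono[OF char_lip_start[of s y s'] L_nonneg] by simp

lemma F_char_continuous: "continuous_on S (\<lambda>s. F (y, char s y))"
  by (rule lipschitz_on_continuous_on[of "L * (4 / 3)"], rule lipschitz_onI)
    (use F_char_lip L_nonneg in \<open>auto simp: dist_real_def\<close>)

text \<open>8/3 is twice 4/3: the values of \<open>F\<close> at either end of the strip depend on
  the label with constant 4/3 * L.\<close>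

lemma slope_at_lipschitz: "(L * (8 / 3) / (d - c))-lipschitz_on S slope_at"
proof (rule lipschitz_onI)
  fix s s'
  have "\<bar>(F (d, char s d) - F (c, s)) - (F (d, char s' d) - F (c, s'))\<bar> \<le> L * (8 / 3) * \<bar>s - s'\<bar>"
    using F_char_lip[of d s s'] F_char_lip[of c s s'] unfolding char_start by argo
  then have "\<bar>(F (d, char s d) - F (c, s)) - (F (d, char s' d) - F (c, s'))\<bar> / (d - c)
      \<le> L * (8 / 3) * \<bar>s - s'\<bar> / (d - c)"
    using cd by (intro divide_right_mono) auto
  then show "dist (slope_at s) (slope_at s') \<le> L * (8 / 3) / (d - c) * dist s s'"
    using cd by (simp add: slope_at_def dist_real_def diff_divide_distrib[symmetric] abs_divide)
qed (use L_nonneg cd in auto)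

text \<open>Both sides are continuous in s and agree for almost every s in the open set J.\<close>

lemma affine_along:
  assumes W: "open W" and s: "s \<in> J" and y: "y \<in> {c..d}"
  shows "F (y, char s y) = F (c, s) + slope_at s * (y - c)"
proof -
  have "F (y, char s y) - F (c, s) - slope_at s * (y - c) = 0"
  proof (rule AE_zero_imp_zero_on_open[OF J_open _ _ s])
    show "continuous_on J (\<lambda>s. F (y, char s y) - F (c, s) - slope_at s * (y - c))"
      using F_char_continuous[of J c] lipschitz_on_continuous_on[OF slope_at_lipschitz, of J]
      by (intro continuous_intros F_char_continuous) (simp_all add: char_start)
    show "AE s in lborel. s \<in> J \<longrightarrow> F (y, char s y) - F (c, s) - slope_at s * (y - c) = 0"
      using affine_along_AE[OF W]
    proof eventually_elim
      case (elim s)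
      show ?case
      proof
        assume "s \<in> J"
        with elim obtain G where G: "\<And>y. y \<in> {c..d} \<Longrightarrow> F (y, char s y) = F (c, s) + G * (y - c)"
          by blast
        have "slope_at s = G"
          using G[of d] cd by (simp add: slope_at_def)
        with G[OF y] show "F (y, char s y) - F (c, s) - slope_at s * (y - c) = 0"
          by simp
      qed
    qed
  qed
  then show ?thesis by simp
qed

text \<open>On almost every characteristic the constant G is the difference quotient between the
  ends, that is \<open>slope_at\<close>; the identity is then carried back from the straightened
  coordinates.\<close>

lemma grad_rep_eq_slope_at:
  assumes W: "open W"
  shows "AE p in lborel. fst p \<in> {c..d} \<longrightarrow> label p \<in> J \<longrightarrow> grad_rep F p = slope_at (label p)"
proof (rule AE_from_characteristics)
  have [measurable]: "label \<in> borel_measurable borel" "slope_at \<in> borel_measurable borel"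
    by (intro borel_measurable_continuous_onI lipschitz_on_continuous_on[OF label_lipschitz_on]
        lipschitz_on_continuous_on[OF slope_at_lipschitz])+
  note [measurable] = measurables(4) borel_open[OF J_open]
  have [measurable]: "(\<lambda>p. slope_at (label p)) \<in> borel_measurable borel"
    by measurable
  have "{p. fst p \<in> {c..d} \<longrightarrow> label p \<in> J \<longrightarrow> grad_rep F p = slope_at (label p)} =
      UNIV - ({c..d} \<times> UNIV) \<inter> {p. label p \<in> J} \<inter> {p. grad_rep F p \<noteq> slope_at (label p)}"
    by auto
  moreover have "{c..d} \<times> (UNIV :: real set) \<in> sets borel"
    by (intro borel_closed closed_Times) auto
  moreover have "{p. label p \<in> J} \<in> sets borel" "{p. grad_rep F p \<noteq> slope_at (label p)} \<in> sets borel"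
    by measurable
  ultimately show "{p. fst p \<in> {c..d} \<longrightarrow> label p \<in> J \<longrightarrow> grad_rep F p = slope_at (label p)} \<in> sets borel"
    by auto
  show "AE s in lborel. AE y in lborel. fst (y, char s y) \<in> {c..d} \<longrightarrow> label (y, char s y) \<in> J \<longrightarrow>
      grad_rep F (y, char s y) = slope_at (label (y, char s y))"
    using affine_along_AE[OF W]
  proof eventually_elim
    case (elim s)
    show ?case
    proof (cases "s \<in> J")
      case True
      with elim obtain G where G: "\<And>y. y \<in> {c..d} \<Longrightarrow> F (y, char s y) = F (c, s) + G * (y - c)"
          and ae: "AE y in lborel. y \<in> {c..d} \<longrightarrow> grad_rep F (y, char s y) = G"
        by blast
      have "slope_at s = G"
        using G[of d] cd by (simp add: slope_at_def)
      from ae show ?thesis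
        by eventually_elim (use \<open>slope_at s = G\<close> in \<open>auto simp: label_char\<close>)
    qed (simp add: label_char)
  qed
qed

text \<open>The curve is the characteristic through q, shifted in parameter so that it meets q at 0.
  Since q lies strictly inside the strip, the derivatives are two-sided.\<close>

lemma tangent_curve:
  assumes W: "open W" and q: "fst q \<in> {c<..<d}" "label q \<in> J"
  obtains \<kappa> :: "real \<Rightarrow> real \<times> real" where "\<kappa> 0 = q" "(\<kappa> has_vector_derivative (1, F q)) (at 0)"
    "((\<lambda>\<delta>. F (\<kappa> \<delta>)) has_vector_derivative slope_at (label q)) (at 0)"
    "((\<lambda>\<delta>. slope_at (label (\<kappa> \<delta>))) has_vector_derivative 0) (at 0)"
proof -
  define s y where "s = label q" and "y = fst q"
  let ?\<kappa> = "\<lambda>\<delta>. (y + \<delta>, char s (y + \<delta>))"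
  have q0: "(y, char s y) = q"
    using char_label[of q] by (simp add: s_def y_def)
  have y: "y \<in> {c..d}" "y \<in> interior {c..d}"
    using q(1) by (auto simp: y_def)
  have "((\<lambda>y. (y, char s y)) has_vector_derivative (1, F q)) (at y)"
    using curve_has_derivative[OF y(1), of s] at_within_interior[OF y(2)] by (simp add: q0)
  moreover have "((\<lambda>\<delta>. y + \<delta>) has_vector_derivative 1) (at 0)"
    by (auto intro!: derivative_eq_intros)
  ultimately have 1: "(?\<kappa> has_vector_derivative (1, F q)) (at 0)"
    using vector_diff_chain_at[of "\<lambda>\<delta>. y + \<delta>" 1 0 "\<lambda>y. (y, char s y)" "(1, F q)"] by (simp add: comp_def)
  have U: "open {c - y<..<d - y}" "0 \<in> {c - y<..<d - y}"
    using q(1) by (auto simp: y_def)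
  have "((\<lambda>\<delta>. F (c, s) + slope_at s * (y + \<delta> - c)) has_vector_derivative slope_at s) (at 0)"
    by (auto intro!: derivative_eq_intros simp: has_real_derivative_iff_has_vector_derivative[symmetric])
  then have 2: "((\<lambda>\<delta>. F (?\<kappa> \<delta>)) has_vector_derivative slope_at s) (at 0)"
  proof (rule has_vector_derivative_transform_within_open[OF _ U])
    fix \<delta> assume "\<delta> \<in> {c - y<..<d - y}"
    then show "F (c, s) + slope_at s * (y + \<delta> - c) = F (?\<kappa> \<delta>)"
      using affine_along[OF W q(2), of "y + \<delta>"] by (simp add: s_def)
  qed
  have 3: "((\<lambda>\<delta>. slope_at (label (?\<kappa> \<delta>))) has_vector_derivative 0) (at 0)"
    by (simp add: label_char)
  show ?thesis
    by (rule that[of ?\<kappa>]) (use q0 1 2 3 in \<open>auto simp: s_def\<close>)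
qed

end

section \<open>From local to global\<close>

text \<open>Curves tangent at s differ by o(|x - s|), and a Lipschitz function keeps the order of
  that error. The derivatives are taken within I so that endpoints of an integral curve are
  covered.\<close>

lemma has_vector_derivative_tangent_curves:
  fixes g :: "'a::real_normed_vector \<Rightarrow> real"
  assumes g: "K-lipschitz_on (ball q r) g" "r > 0"
    and \<kappa>: "\<kappa> s = q" "(\<kappa> has_vector_derivative v) (at s within I)"
    and \<gamma>: "\<gamma> s = q" "(\<gamma> has_vector_derivative v) (at s within I)"
    and D: "((\<lambda>x. g (\<kappa> x)) has_vector_derivative D) (at s within I)"
  shows "((\<lambda>x. g (\<gamma> x)) has_vector_derivative D) (at s within I)"
proof -
  have K: "0 \<le> K" using lipschitz_on_nonneg[OF g(1)] .
  have "((\<lambda>x. \<gamma> x - \<kappa> x) has_vector_derivative v - v) (at s within I)"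
    by (intro has_vector_derivative_diff \<kappa> \<gamma>)
  then have diff: "((\<lambda>x. \<gamma> x - \<kappa> x) has_derivative (\<lambda>h. 0)) (at s within I)"
    by (simp add: has_vector_derivative_def)
  have near: "eventually (\<lambda>x. \<zeta> x \<in> ball q r) (at s within I)"
    if "\<zeta> s = q" "(\<zeta> has_vector_derivative v) (at s within I)" for \<zeta> :: "real \<Rightarrow> 'a"
    using has_vector_derivative_continuous[OF that(2)] that(1) g(2)
    unfolding continuous_within by (intro topological_tendstoD) auto
  have "((\<lambda>x. g (\<gamma> x) - g (\<kappa> x)) has_derivative (\<lambda>h. 0)) (at s within I)"
    unfolding has_derivative_within_alt
  proof (intro conjI allI impI)
    fix e :: real assume e: "e > 0"
    \<comment> \<open>K + 1 in place of K guards against K = 0.\<close>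
    have "e / (K + 1) > 0"
      using e K by simp
    then obtain d1 where d1: "d1 > 0" "\<And>x. x \<in> I \<Longrightarrow> norm (x - s) < d1 \<Longrightarrow>
        norm (\<gamma> x - \<kappa> x) \<le> e / (K + 1) * norm (x - s)"
      using diff \<kappa>(1) \<gamma>(1) unfolding has_derivative_within_alt by (auto simp: real_norm_def)
    obtain d2 where d2: "d2 > 0" "\<And>x. x \<in> I \<Longrightarrow> x \<noteq> s \<Longrightarrow> dist x s < d2 \<Longrightarrow> \<kappa> x \<in> ball q r \<and> \<gamma> x \<in> ball q r"
      using eventually_conj[OF near[OF \<kappa>] near[OF \<gamma>]] unfolding eventually_at by blast
    show "\<exists>d>0. \<forall>x\<in>I. norm (x - s) < d \<longrightarrow>
        norm (g (\<gamma> x) - g (\<kappa> x) - (g (\<gamma> s) - g (\<kappa> s)) - 0) \<le> e * norm (x - s)"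
    proof (intro exI[of _ "min d1 d2"] conjI ballI impI)
      fix x assume x: "x \<in> I" "norm (x - s) < min d1 d2"
      show "norm (g (\<gamma> x) - g (\<kappa> x) - (g (\<gamma> s) - g (\<kappa> s)) - 0) \<le> e * norm (x - s)"
      proof (cases "x = s")
        case False
        have "\<kappa> x \<in> ball q r" "\<gamma> x \<in> ball q r"
          using d2(2)[OF x(1) False] x(2) by (auto simp: dist_norm)
        then have "\<bar>g (\<gamma> x) - g (\<kappa> x)\<bar> \<le> K * norm (\<gamma> x - \<kappa> x)"
          using lipschitz_onD[OF g(1)] by (simp add: dist_norm)
        also have "\<dots> \<le> K * (e / (K + 1) * norm (x - s))"
          using d1(2)[OF x(1)] x(2) K by (intro mult_left_mono) auto
        also have "\<dots> = K / (K + 1) * (e * norm (x - s))"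
          by simp
        also have "\<dots> \<le> 1 * (e * norm (x - s))"
          using K e by (intro mult_right_mono) (auto simp: divide_le_eq)
        finally show ?thesis
          using \<kappa>(1) \<gamma>(1) by simp
      qed simp
    qed (use d1 d2 in auto)
  qed simp
  then have "((\<lambda>x. g (\<gamma> x) - g (\<kappa> x)) has_vector_derivative 0) (at s within I)"
    by (simp add: has_vector_derivative_def)
  from has_vector_derivative_add[OF D this] show ?thesis by simp
qed

text \<open>The derivative of \<open>f\<close> along the characteristic through \<open>p\<close>, taken on the tangent line instead
  so that the definition involves no flow.\<close>

definition char_deriv :: "(real \<times> real \<Rightarrow> real) \<Rightarrow> real \<times> real \<Rightarrow> real"
  where "char_deriv f p = vector_derivative (\<lambda>\<delta>. f (p + \<delta> *\<^sub>R (1, f p))) (at 0)"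

text \<open>The local function is \<open>slope_at \<circ> label\<close>. It equals
  \<open>char_deriv f\<close> because the straight line with velocity (1, f q) is tangent to the
  characteristic through q.\<close>

lemma char_deriv_local:
  assumes f: "f \<in> borel_measurable borel" "open \<omega>" "locally_lipschitz_on \<omega> f" "stationary \<omega> f"
    and p: "p \<in> \<omega>"
  obtains r K g where "r > 0" "ball p r \<subseteq> \<omega>" "K-lipschitz_on UNIV g"
    "AE q in lborel. q \<in> ball p r \<longrightarrow> grad_rep f q = g q"
    "\<And>q. q \<in> ball p r \<Longrightarrow> char_deriv f q = g q"
    "\<And>q. q \<in> ball p r \<Longrightarrow> \<exists>\<kappa>. \<kappa> 0 = q \<and> (\<kappa> has_vector_derivative (1, f q)) (at 0) \<and>
      ((\<lambda>\<delta>. g (\<kappa> \<delta>)) has_vector_derivative 0) (at 0)"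
proof -
  obtain \<rho> L F M where \<rho>: "\<rho> > 0" "ball p \<rho> \<subseteq> \<omega>" and F: "L-lipschitz_on UNIV F"
      and fF: "\<And>x. x \<in> ball p \<rho> \<Longrightarrow> f x = F x" and M: "\<And>x. \<bar>F x\<bar> \<le> M"
    by (rule locally_lipschitz_extension[OF f(2,3) p]) blast
  have L0: "0 \<le> L" using lipschitz_on_nonneg[OF F] .
  have M0: "0 \<le> M" using order_trans[OF abs_ge_zero M] .
  have q_eq: "quot_deriv v f x = quot_deriv v F x" if "x \<in> ball p \<rho>" for v x
    using quot_deriv_cong[OF open_ball that fF] .
  have g_eq: "grad_rep f x = grad_rep F x" if "x \<in> ball p \<rho>" for x
    by (simp add: grad_rep_def q_eq[OF that] fF[OF that])
  \<comment> \<open>The three entries ensure a horizontal deviation of at most \<rho> / 8, the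
    contraction condition for a strip of width 2 \<delta>, and a vertical drift of at most \<rho> /
    8. The summands 1 keep the denominators positive.\<close>
  define \<delta> where "\<delta> = min (\<rho> / 8) (min (1 / (8 * (L + 1))) (\<rho> / (16 * (M + 1))))"
  have \<delta>: "\<delta> > 0" "\<delta> \<le> \<rho> / 8" "2 * \<delta> * L \<le> 1 / 4" "M * (2 * \<delta>) \<le> \<rho> / 8"
  proof -
    show "\<delta> > 0"
      using \<rho>(1) L0 M0 by (simp add: \<delta>_def)
    show "\<delta> \<le> \<rho> / 8"
      unfolding \<delta>_def by (rule min.cobounded1)
    have "\<delta> * L \<le> \<delta> * (L + 1)"
      using \<open>\<delta> > 0\<close> by simp
    also have "\<dots> \<le> 1 / (8 * (L + 1)) * (L + 1)"
      using L0 by (intro mult_right_mono) (auto simp: \<delta>_def)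
    also have "\<dots> = 1 / 8"
      using L0 by simp
    finally show "2 * \<delta> * L \<le> 1 / 4"
      by simp
    have "\<delta> * M \<le> \<delta> * (M + 1)"
      using \<open>\<delta> > 0\<close> by simp
    also have "\<dots> \<le> \<rho> / (16 * (M + 1)) * (M + 1)"
      using M0 by (intro mult_right_mono) (auto simp: \<delta>_def)
    also have "\<dots> = \<rho> / 16"
      using M0 by (simp add: divide_simps)
    finally show "M * (2 * \<delta>) \<le> \<rho> / 8"
      by argo
  qed
  define c d J where "c = fst p - \<delta>" and "d = fst p + \<delta>" and "J = {snd p - \<rho> / 4<..<snd p + \<rho> / 4}"
  interpret characteristics F L M c d
    by unfold_locales (use F M \<delta> in \<open>auto simp: c_def d_def\<close>)
  have drift_le: "\<bar>char s y - s\<bar> \<le> \<rho> / 8" if "y \<in> {c..d}" for s y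
  proof -
    have "\<bar>char s y - char s c\<bar> \<le> M * \<bar>y - c\<bar>"
      by (rule char_lip)
    also have "\<dots> \<le> M * (2 * \<delta>)"
      using that M0 by (intro mult_left_mono) (auto simp: c_def d_def)
    finally show ?thesis
      using \<delta>(4) by (simp add: char_start)
  qed
  \<comment> \<open>A characteristic with label in J stays within \<rho>/8 + \<rho>/8 + \<rho>/4 =
    \<rho>/2 of p, so tubes of radius \<rho>/4 around it remain in the ball.\<close>
  interpret stationary_flow F L M c d "ball p \<rho>" J "\<rho> / 4"
  proof
    fix \<phi> assume \<phi>: "\<phi> \<in> test_functions (ball p \<rho>)"
    then have "\<phi> \<in> test_functions \<omega>"
      using \<rho>(2) by (auto simp: test_functions_def)
    then have "(\<integral>x. slope f x * variation f \<phi> x \<partial>lborel) = 0"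
      by (rule first_variation[OF f])
    moreover have "slope f x * variation f \<phi> x = slope F x * variation F \<phi> x" for x
    proof (cases "x \<in> ball p \<rho>")
      case True
      then show ?thesis
        by (simp add: slope_def variation_def g_eq q_eq fF)
    next
      case False
      then have "x \<notin> spt \<phi>"
        using test_functionsD(3)[OF \<phi>] by blast
      then show ?thesis
        by (simp add: variation_def not_in_spt_zero dir_deriv_zero_outside_spt)
    qed
    ultimately show "(\<integral>x. slope F x * variation F \<phi> x \<partial>lborel) = 0"
      by simp
  next
    fix s y assume s: "s \<in> J" and y: "y \<in> {c..d}"
    have "dist (y, char s y) p \<le> dist y (fst p) + dist (char s y) (snd p)"
      using norm_Pair_le[of "y - fst p" "char s y - snd p"] by (cases p) (simp add: dist_norm)
    also have "\<dots> < \<rho> / 8 + (\<rho> / 8 + \<rho> / 4)"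
    proof (rule add_le_less_mono)
      show "dist y (fst p) \<le> \<rho> / 8"
        using y \<delta>(2) unfolding dist_real_def c_def d_def atLeastAtMost_iff by argo
      have "\<bar>s - snd p\<bar> < \<rho> / 4"
        using s unfolding J_def greaterThanLessThan_iff by argo
      with drift_le[OF y, of s] show "dist (char s y) (snd p) < \<rho> / 8 + \<rho> / 4"
        unfolding dist_real_def by argo
    qed
    finally have "dist (y, char s y) p < \<rho> / 2"
      by simp
    show "cball (y, char s y) (\<rho> / 4) \<subseteq> ball p \<rho>"
    proof
      fix x assume "x \<in> cball (y, char s y) (\<rho> / 4)"
      then have "dist (y, char s y) x \<le> \<rho> / 4" by simp
      with \<open>dist (y, char s y) p < \<rho> / 2\<close> dist_triangle[of p x "(y, char s y)"] \<rho>(1) show "x \<in> ball p \<rho>"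
        by (simp add: dist_commute)
    qed
  qed (use \<rho>(1) in \<open>auto simp: J_def\<close>)
  \<comment> \<open>The label of a point in this ball differs from the height of p by less than
    \<rho>/16 + \<rho>/8, hence by less than \<rho>/4, so it lies in J.\<close>
  define r where "r = min \<delta> (\<rho> / 16)"
  have r: "r > 0" "r \<le> \<rho>"
    using \<delta>(1) \<rho>(1) by (auto simp: r_def)
  have in_strip: "fst q \<in> {c<..<d}" "label q \<in> J" if q: "q \<in> ball p r" for q
  proof -
    have "\<bar>fst q - fst p\<bar> < \<delta>"
      using q dist_fst_le[of q p] by (simp add: r_def dist_real_def dist_commute)
    then show y: "fst q \<in> {c<..<d}"
      by (auto simp: c_def d_def)
    have "\<bar>snd q - snd p\<bar> < \<rho> / 16"
      using q dist_snd_le[of q p] by (simp add: r_def dist_real_def dist_commute)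
    moreover have "\<bar>snd q - label q\<bar> \<le> \<rho> / 8"
      using drift_le[of "fst q" "label q"] y by (simp add: char_label)
    ultimately have "\<bar>label q - snd p\<bar> < \<rho> / 4"
      by argo
    then show "label q \<in> J"
      unfolding J_def greaterThanLessThan_iff by argo
  qed
  define g where "g = slope_at \<circ> label"
  define K where "K = L * (8 / 3) / (d - c) * (3 / 2 * (1 + M))"
  have sub: "ball p r \<subseteq> ball p \<rho>"
    using r(2) by (rule subset_ball)
  have g: "K-lipschitz_on UNIV g"
    unfolding g_def K_def by (rule lipschitz_on_compose[OF label_lipschitz_on slope_at_lipschitz])
  have curves: "\<exists>\<kappa>. \<kappa> 0 = q \<and> (\<kappa> has_vector_derivative (1, f q)) (at 0) \<and>
      ((\<lambda>\<delta>. F (\<kappa> \<delta>)) has_vector_derivative g q) (at 0) \<and>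
      ((\<lambda>\<delta>. g (\<kappa> \<delta>)) has_vector_derivative 0) (at 0)" if q: "q \<in> ball p r" for q
    using tangent_curve[OF open_ball in_strip[OF q]] fF[of q] subsetD[OF sub q] unfolding g_def comp_def
    by metis
  have ae: "AE q in lborel. q \<in> ball p r \<longrightarrow> grad_rep f q = g q"
    using grad_rep_eq_slope_at[OF open_ball]
  proof eventually_elim
    case (elim q)
    show ?case
    proof
      assume q: "q \<in> ball p r"
      with elim in_strip[OF q] g_eq[of q] subsetD[OF sub q] show "grad_rep f q = g q"
        by (simp add: g_def)
    qed
  qed
  have cd_eq: "char_deriv f q = g q" if q: "q \<in> ball p r" for q
  proof -
    obtain \<kappa> where \<kappa>: "\<kappa> 0 = q" "(\<kappa> has_vector_derivative (1, f q)) (at 0)"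
        "((\<lambda>\<delta>. F (\<kappa> \<delta>)) has_vector_derivative g q) (at 0)"
      using curves[OF q] by blast
    have line: "((\<lambda>\<delta>. q + \<delta> *\<^sub>R (1, f q)) has_vector_derivative (1, f q)) (at 0)"
      by (auto intro!: derivative_eq_intros simp: has_vector_derivative_def)
    have "((\<lambda>\<delta>. F (q + \<delta> *\<^sub>R (1, f q))) has_vector_derivative g q) (at 0)"
      by (rule has_vector_derivative_tangent_curves[OF lipschitz_on_subset[OF F] zero_less_one \<kappa>(1,2) _ line \<kappa>(3)])
        (auto simp: zero_prod_def[symmetric])
    moreover have "open ((\<lambda>\<delta>. q + \<delta> *\<^sub>R (1, f q)) -` ball p \<rho>)"
      by (intro open_vimage open_ball continuous_intros)
    moreover have "0 \<in> (\<lambda>\<delta>. q + \<delta> *\<^sub>R (1, f q)) -` ball p \<rho>"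
      using subsetD[OF sub q] by (simp add: zero_prod_def[symmetric])
    ultimately have "((\<lambda>\<delta>. f (q + \<delta> *\<^sub>R (1, f q))) has_vector_derivative g q) (at 0)"
      by (rule has_vector_derivative_transform_within_open) (simp add: fF)
    then show ?thesis
      unfolding char_deriv_def by (rule vector_derivative_at)
  qed
  show ?thesis
    by (rule that[OF r(1) _ g ae cd_eq]) (use sub \<rho>(2) curves in blast)+
qed

lemma represents_intrinsic_grad_AE:
  assumes "represents_intrinsic_grad \<omega> f g" "AE p in lborel. p \<in> \<omega> \<longrightarrow> g p = g' p"
  shows "represents_intrinsic_grad \<omega> f g'"
proof -
  obtain fy ft where w: "weak_deriv \<omega> (1, 0) f fy" "weak_deriv \<omega> (0, 1) f ft"
      and ae: "AE p in lebesgue. p \<in> \<omega> \<longrightarrow> g p = fy p + f p * ft p"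
    using assms(1) unfolding represents_intrinsic_grad_def by blast
  have "AE p in lebesgue. p \<in> \<omega> \<longrightarrow> g' p = fy p + f p * ft p"
    using ae AE_completion[OF assms(2)] by eventually_elim auto
  with w show ?thesis
    unfolding represents_intrinsic_grad_def by blast
qed

text \<open>The local results glue because \<open>char_deriv f\<close> is given by one formula on
  all of \<omega> and agrees with each local function on its ball.\<close>

lemma intrinsic_gradient_borel:
  assumes f: "f \<in> borel_measurable borel" "open \<omega>" "locally_lipschitz_on \<omega> f" "stationary \<omega> f"
  shows "represents_intrinsic_grad \<omega> f (char_deriv f)" "locally_lipschitz_on \<omega> (char_deriv f)"
    "integral_curve \<omega> (intrinsic_field f) I \<gamma> \<Longrightarrow> (\<lambda>s. char_deriv f (\<gamma> s)) constant_on I"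
proof -
  have ae: "AE p in lborel. p \<in> \<omega> \<longrightarrow> grad_rep f p = char_deriv f p"
  proof (rule AE_local_to_global)
    fix p assume "p \<in> \<omega>"
    then obtain r K g where r: "r > 0" and ae: "AE q in lborel. q \<in> ball p r \<longrightarrow> grad_rep f q = g q"
      and eq: "\<And>q. q \<in> ball p r \<Longrightarrow> char_deriv f q = g q"
      by (rule char_deriv_local[OF f]) blast
    have "AE q in lborel. q \<in> ball p r \<longrightarrow> grad_rep f q = char_deriv f q"
      using ae by eventually_elim (use eq in auto)
    with r show "\<exists>r>0. AE q in lborel. q \<in> ball p r \<longrightarrow> grad_rep f q = char_deriv f q"
      by blast
  qed
  show "represents_intrinsic_grad \<omega> f (char_deriv f)"
    by (rule represents_intrinsic_grad_AE[OF represents_grad_rep[OF f(1-3)] ae])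
  show "locally_lipschitz_on \<omega> (char_deriv f)"
    unfolding locally_lipschitz_on_def
  proof
    fix p assume "p \<in> \<omega>"
    then obtain r K g where r: "r > 0" and g: "K-lipschitz_on UNIV g"
      and eq: "\<And>q. q \<in> ball p r \<Longrightarrow> char_deriv f q = g q"
      by (rule char_deriv_local[OF f]) blast
    have "K-lipschitz_on (ball p r \<inter> \<omega>) g"
      using g by (rule lipschitz_on_subset) simp
    then have "K-lipschitz_on (ball p r \<inter> \<omega>) (char_deriv f)"
      by (rule lipschitz_on_transform) (use eq in auto)
    with r show "\<exists>r>0. \<exists>K. K-lipschitz_on (ball p r \<inter> \<omega>) (char_deriv f)"
      by blast
  qed
  assume \<gamma>: "integral_curve \<omega> (intrinsic_field f) I \<gamma>"
  have "((\<lambda>s. char_deriv f (\<gamma> s)) has_vector_derivative 0) (at s within I)" if s: "s \<in> I" for s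
  proof -
    have \<gamma>s: "\<gamma> s \<in> \<omega>" "(\<gamma> has_vector_derivative (1, f (\<gamma> s))) (at s within I)"
      using \<gamma> s by (auto simp: integral_curve_def intrinsic_field_def)
    obtain r K g where r: "r > 0" and g: "K-lipschitz_on UNIV g"
      and eq: "\<And>q. q \<in> ball (\<gamma> s) r \<Longrightarrow> char_deriv f q = g q"
      and curve: "\<And>q. q \<in> ball (\<gamma> s) r \<Longrightarrow> \<exists>\<kappa>. \<kappa> 0 = q \<and> (\<kappa> has_vector_derivative (1, f q)) (at 0) \<and>
        ((\<lambda>\<delta>. g (\<kappa> \<delta>)) has_vector_derivative 0) (at 0)"
      by (rule char_deriv_local[OF f \<gamma>s(1)]) blast
    obtain \<kappa> where \<kappa>: "\<kappa> 0 = \<gamma> s" "(\<kappa> has_vector_derivative (1, f (\<gamma> s))) (at 0)"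
        "((\<lambda>\<delta>. g (\<kappa> \<delta>)) has_vector_derivative 0) (at 0)"
      using curve[of "\<gamma> s"] r by auto
    have shift: "((\<lambda>x. u (x - s)) has_vector_derivative D) (at s within I)"
      if "(u has_vector_derivative D) (at 0)" for u :: "real \<Rightarrow> 'b::real_normed_vector" and D
    proof -
      have "((\<lambda>x. x - s) has_vector_derivative 1) (at s)"
        by (auto intro!: derivative_eq_intros)
      from vector_diff_chain_at[OF this, of u D] that
      have "((\<lambda>x. u (x - s)) has_vector_derivative D) (at s)"
        by (simp add: comp_def)
      then show ?thesis
        by (rule has_vector_derivative_at_within)
    qed
    have gl: "K-lipschitz_on (ball (\<gamma> s) r) g"
      using g by (rule lipschitz_on_subset) simp
    \<comment> \<open>The characteristic through \<gamma> s has the same velocity there as \<gamma>,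
      and \<open>g\<close> has derivative 0 along it.\<close>
    have "((\<lambda>x. g (\<gamma> x)) has_vector_derivative 0) (at s within I)"
      by (rule has_vector_derivative_tangent_curves[OF gl r _ shift[OF \<kappa>(2)] refl \<gamma>s(2) shift[OF \<kappa>(3)]])
        (simp add: \<kappa>(1))
    then have 1: "((\<lambda>x. g (\<gamma> x)) has_derivative (\<lambda>h. 0)) (at s within I)"
      by (simp add: has_vector_derivative_def)
    have "eventually (\<lambda>x. \<gamma> x \<in> ball (\<gamma> s) r) (at s within I)"
      using has_vector_derivative_continuous[OF \<gamma>s(2)] r
      unfolding continuous_within by (intro topological_tendstoD) auto
    then have "eventually (\<lambda>x. g (\<gamma> x) = char_deriv f (\<gamma> x)) (at s within I)"
      by eventually_elim (simp add: eq)
    from has_derivative_transform_eventually[OF 1 this] s eq[of "\<gamma> s"] r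
    have "((\<lambda>x. char_deriv f (\<gamma> x)) has_derivative (\<lambda>h. 0)) (at s within I)"
      by simp
    then show ?thesis
      by (simp add: has_vector_derivative_def)
  qed
  moreover have "convex I"
    using \<gamma> by (simp add: integral_curve_def is_interval_convex)
  ultimately obtain k where "\<And>s. s \<in> I \<Longrightarrow> char_deriv f (\<gamma> s) = k"
    using has_vector_derivative_zero_constant[of I "\<lambda>s. char_deriv f (\<gamma> s)"] by blast
  then show "(\<lambda>s. char_deriv f (\<gamma> s)) constant_on I"
    by (auto simp: constant_on_def)
qed

lemma stationary_cong:
  assumes "\<And>x. x \<in> \<omega> \<Longrightarrow> f x = f' x" "stationary \<omega> f"
  shows "stationary \<omega> f'"
proof -
  have "represents_intrinsic_grad \<omega> (\<lambda>p. f p + \<epsilon> * \<phi> p) = represents_intrinsic_grad \<omega> (\<lambda>p. f' p + \<epsilon> * \<phi> p)" for \<epsilon> \<phi>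
    by (rule represents_intrinsic_grad_cong) (use assms(1) in simp)
  then show ?thesis
    using assms(2) by (simp add: stationary_def intrinsic_area_def intrinsic_grad_def)
qed

theorem theorem1p2:
  fixes \<omega> :: "(real \<times> real) set" and f :: "real \<times> real \<Rightarrow> real"
  assumes "open \<omega>"
    and "locally_lipschitz_on \<omega> f"
    and "stationary \<omega> f"
  shows "(\<exists>g. represents_intrinsic_grad \<omega> f g \<and>
              locally_lipschitz_on \<omega> g \<and>
              (\<forall>I \<gamma>. integral_curve \<omega> (intrinsic_field f) I \<gamma> \<longrightarrow>
                 (\<lambda>s. g (\<gamma> s)) constant_on I)) \<and>
         C1_intrinsic \<omega> f"
proof -
  note cont = locally_lipschitz_continuous_on[OF assms(1,2)]
  \<comment> \<open>The values of \<open>f\<close> outside \<omega> are arbitrary; extension by zero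
    gives a Borel function on the plane and preserves all the notions on \<omega>.\<close>
  define f0 where "f0 x = indicator \<omega> x *\<^sub>R f x" for x
  have eq: "f x = f0 x" if "x \<in> \<omega>" for x
    using that by (simp add: f0_def)
  have "f0 \<in> borel_measurable borel"
    unfolding f0_def[abs_def]
    by (rule borel_measurable_continuous_on_indicator[OF _ cont]) (use assms(1) in simp)
  moreover have "locally_lipschitz_on \<omega> f0"
    unfolding locally_lipschitz_on_def
  proof
    fix x assume "x \<in> \<omega>"
    then obtain r L where "r > 0" "L-lipschitz_on (ball x r \<inter> \<omega>) f"
      using assms(2) unfolding locally_lipschitz_on_def by blast
    moreover from this(2) have "L-lipschitz_on (ball x r \<inter> \<omega>) f0"
      by (rule lipschitz_on_transform) (simp add: eq)
    ultimately show "\<exists>r>0. \<exists>L. L-lipschitz_on (ball x r \<inter> \<omega>) f0"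
      by blast
  qed
  moreover have "stationary \<omega> f0"
    using eq assms(3) by (rule stationary_cong)
  ultimately have g: "represents_intrinsic_grad \<omega> f0 (char_deriv f0)" "locally_lipschitz_on \<omega> (char_deriv f0)"
      "\<And>I \<gamma>. integral_curve \<omega> (intrinsic_field f0) I \<gamma> \<Longrightarrow> (\<lambda>s. char_deriv f0 (\<gamma> s)) constant_on I"
    using intrinsic_gradient_borel assms(1) by blast+
  have 1: "represents_intrinsic_grad \<omega> f (char_deriv f0)"
    using g(1) represents_intrinsic_grad_cong[of \<omega> f f0] eq by simp
  have "integral_curve \<omega> (intrinsic_field f0) I \<gamma>" if \<gamma>: "integral_curve \<omega> (intrinsic_field f) I \<gamma>" for I \<gamma>
  proof -
    have "intrinsic_field f0 (\<gamma> s) = intrinsic_field f (\<gamma> s)" if "s \<in> I" for s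
      using \<gamma> that by (simp add: integral_curve_def intrinsic_field_def eq)
    with \<gamma> show ?thesis
      by (simp add: integral_curve_def)
  qed
  with 1 g(2,3) cont locally_lipschitz_continuous_on[OF assms(1) g(2)] show ?thesis
    unfolding C1_intrinsic_def by blast
qed

end
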